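(* Let $M=\mathrm{T}^\ast S^5$ with the Stenzel Calabi-Yau structure $(I,\omega_{\mathrm{Stz}},\Omega_{\mathrm{Stz}})$. Define $$L_1=\{({}^t(x_1,0,x_3,0,x_5,0),\,{}^t(0,\xi_2,0,\xi_4,0,\xi_6))\mid x_1^2+x_3^2+x_5^2=1,\ \xi_2,\xi_4,\xi_6\in\mathbb{R}\},$$ $$L_2=\{({}^t(x_1,0,x_3,0,0,0),\,{}^t(0,\xi_2,0,\xi_4,\xi_5,\xi_6))\mid x_1^2+x_3^2=1,\ \xi_2,\xi_4,\xi_5,\xi_6\in\mathbb{R}\},$$ both subsets of $\mathrm{T}^\ast S^5$. Let $H=\{\mathrm{diag}(h,h,h)\in GL(6,\mathbb{R})\mid h\in SO(2)\}$ (block-diagonal), acting on $\mathrm{T}^\ast S^5$ by $h\cdot(x,\xi)=(hx,h\xi)$, with Lie algebra $\mathfrak{h}$ and moment map $\mu:M\to\mathfrak{h}^\ast$ as given in the context. For $c\in\mathfrak{h}^\ast$ and $j=1,2$ put $V_c^{(j)}=L_j\cap\mu^{-1}(c)$. Then: (1) $H\cdot V_c^{(1)}$ is a special Lagrangian submanifold of $M$ for every $c\in\mathfrak{h}^\ast$ such that $V_c^{(1)}\neq\emptyset$. (2) $H\cdot V_c^{(2)}$ is a special Lagrangian submanifold of $M$ for every $c\in\mathfrak{h}^\ast$ such that $V_c^{(2)}\neq\emptyset$.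
   Context: Write $\mathrm{T}^\ast S^n=\{(x,\xi)\in\mathbb{R}^{n+1}\times\mathbb{R}^{n+1}\mid \|x\|=1,\ x\cdot\xi=0\}$ (tangent and cotangent bundles identified), on which $SO(n+1)$ acts by $h\cdot(x,\xi)=(hx,h\xi)$. Let $Q^n=\{z\in\mathbb{C}^{n+1}\mid\sum_{i=1}^{n+1}z_i^2=1\}$. The map $\Phi:\mathrm{T}^\ast S^n\to Q^n$, $\Phi(x,\xi)=\cosh(\|\xi\|)x+\sqrt{-1}\,\frac{\sinh(\|\xi\|)}{\|\xi\|}\xi$ (with $\Phi(x,0)=x$), is an $SO(n+1)$-equivariant diffeomorphism, and $\mathrm{T}^\ast S^n$ is identified with $Q^n$ through $\Phi$. The complex structure $I$ is the one of $Q^n\subset\mathbb{C}^{n+1}$. The Stenzel Kähler form is $\omega_{\mathrm{Stz}}=\sqrt{-1}\,\partial\bar\partial u(r^2)$ restricted to $Q^n$, where $r^2=\sum_i z_i\bar z_i$ and $u$ is a smooth real function such that $U(t)=u(\cosh t)$ satisfies $\frac{d}{dt}(U'(t))^n=\kappa n(\sinh t)^{n-1}$ with a constant $\kappa>0$, the constant of integration being chosen so that $\omega_{\mathrm{Stz}}$ is a Kähler form on all of $Q^n$ (i.e. $U'(0)=0$); then $U'(t)>0$, $U''(t)>0$ and $u'(t)>0$ for $t>0$ in the relevant range. $\Omega_{\mathrm{Stz}}$ is a holomorphic volume form on $Q^n$ satisfying $\frac{\omega_{\mathrm{Stz}}^n}{n!}=(-1)^{\frac{n(n-1)}{2}}\left(\frac{\sqrt{-1}}{2}\right)^n\Omega_{\mathrm{Stz}}\wedge\overline{\Omega_{\mathrm{Stz}}}$;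 it is determined up to a constant phase and is a constant multiple of the form $\Omega_0$ on $Q^n$ characterized by $\frac12 d(\sum z_i^2)\wedge\Omega_0=dz_1\wedge\cdots\wedge dz_{n+1}$ along $Q^n$. It is $SO(n+1)$-invariant. The moment map used is, under the identification by $\Phi$, $\langle\mu(z),X\rangle=u'(r^2)\,(Iz)\cdot(Xz)$ for $z\in Q^n$ and $X\in\mathfrak{h}\subset\mathfrak{so}(n+1)$, where $Iz=\sqrt{-1}z$ and $\cdot$ is the canonical real inner product on $\mathbb{C}^{n+1}\cong\mathbb{R}^{2n+2}$. Here $n=5$ and $\mathfrak{h}=\mathrm{span}\{\eta\}$ with $\eta=\xi_{12}+\xi_{34}+\xi_{56}$, $\xi_{ij}=E_{ji}-E_{ij}$, where $E_{ij}$ is the $6\times 6$ matrix whose $(i,j)$-entry is $1$ and whose other entries are $0$. A Lagrangian submanifold of $M$ ($\dim_{\mathbb R} M=2n$) is an $n$-dimensional submanifold on which $\omega_{\mathrm{Stz}}$ vanishes. It is special Lagrangian if its (local) Lagrangian angle $\theta$, defined by $\iota^\ast\Omega_{\mathrm{Stz}}=e^{\sqrt{-1}\theta}\mathrm{vol}_{\iota^\ast g}$ for (local) orientations, with $\iota$ the inclusion and $g$ the Kähler metric, is constant. *)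

theory Defs
  imports "HOL-Analysis.Analysis"
begin


section \<open>The cotangent bundle of the 5-sphere and the complex quadric\<close>

definition cotangent_sphere :: "((real^6) \<times> (real^6)) set" where
  "cotangent_sphere = {(x, \<xi>). norm x = 1 \<and> x \<bullet> \<xi> = 0}"

definition quadric :: "(complex^6) set" where
  "quadric = {z. (\<Sum>i\<in>UNIV. (z $ i)\<^sup>2) = 1}"

definition quadric_tangent :: "complex^6 \<Rightarrow> (complex^6) set" where
  "quadric_tangent z = {w. (\<Sum>i\<in>UNIV. z $ i * w $ i) = 0}"

text \<open>For \<open>\<xi> = 0\<close> the second summand vanishes, so that \<open>Phi (x, 0) = x\<close>.\<close>

definition Phi :: "(real^6) \<times> (real^6) \<Rightarrow> complex^6" where
  "Phi = (\<lambda>(x, \<xi>). \<chi> i. complex_of_real (cosh (norm \<xi>) * x $ i)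
                     + \<i> * complex_of_real (sinh (norm \<xi>) / norm \<xi> * \<xi> $ i))"


section \<open>Smooth maps\<close>

primrec Ck_on :: "nat \<Rightarrow> ('a::euclidean_space \<Rightarrow> 'b::real_normed_vector) \<Rightarrow> 'a set \<Rightarrow> bool" where
  "Ck_on 0 f S = continuous_on S f"
| "Ck_on (Suc k) f S =
     ((\<forall>x\<in>S. f differentiable (at x)) \<and>
      (\<forall>v. Ck_on k (\<lambda>x. frechet_derivative f (at x) v) S))"

text \<open>Only used for open sets.\<close>

definition smooth_on :: "('a::euclidean_space \<Rightarrow> 'b::real_normed_vector) \<Rightarrow> 'a set \<Rightarrow> bool" where
  "smooth_on f S \<longleftrightarrow> (\<forall>k. Ck_on k f S)"


section \<open>Exterior forms\<close>

text \<open>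
  A form of degree \<open>p\<close> at a point is a function of a sequence of vectors, of which only the
  entries with index below \<open>p\<close> matter.  The wedge product is normalised in such a way that
  \<open>(\<alpha> \<and> \<beta>) (v, w) = \<alpha> v * \<beta> w - \<alpha> w * \<beta> v\<close> for 1-forms.
\<close>

type_synonym 'v form = "(nat \<Rightarrow> 'v) \<Rightarrow> complex"

definition wedge :: "nat \<Rightarrow> nat \<Rightarrow> 'v form \<Rightarrow> 'v form \<Rightarrow> 'v form" where
  "wedge p q \<alpha> \<beta> = (\<lambda>v. (\<Sum>\<sigma> | \<sigma> permutes {..<p + q}.
      of_int (sign \<sigma>) * \<alpha> (\<lambda>i. v (\<sigma> i)) * \<beta> (\<lambda>i. v (\<sigma> (p + i)))) / (fact p * fact q))"

primrec wedge_power :: "nat \<Rightarrow> 'v form \<Rightarrow> nat \<Rightarrow> 'v form" where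
  "wedge_power p \<alpha> 0 = (\<lambda>v. 1)"
| "wedge_power p \<alpha> (Suc k) = wedge p (p * k) \<alpha> (wedge_power p \<alpha> k)"

definition complex_alternating_form ::
  "nat \<Rightarrow> (complex^'m) set \<Rightarrow> (complex^'m) form \<Rightarrow> bool" where
  "complex_alternating_form n T \<alpha> \<longleftrightarrow>
     (\<forall>v. (\<forall>i<n. v i \<in> T) \<longrightarrow>
        (\<forall>v'. (\<forall>i<n. v' i = v i) \<longrightarrow> \<alpha> v' = \<alpha> v) \<and>
        (\<forall>i<n. \<forall>a\<in>T. \<forall>b\<in>T. \<alpha> (v(i := a + b)) = \<alpha> (v(i := a)) + \<alpha> (v(i := b))) \<and>
        (\<forall>i<n. \<forall>a\<in>T. \<forall>s. \<alpha> (v(i := s *s a)) = s * \<alpha> (v(i := a))) \<and>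
        (\<forall>i<n. \<forall>j<n. i \<noteq> j \<and> v i = v j \<longrightarrow> \<alpha> v = 0))"


section \<open>The Stenzel Calabi-Yau structure\<close>

definition stenzel_potential :: "real \<Rightarrow> (real \<Rightarrow> real) \<Rightarrow> bool" where
  "stenzel_potential \<kappa> u \<longleftrightarrow>
     (\<exists>S. open S \<and> {1..} \<subseteq> S \<and> smooth_on u S) \<and>
     (\<forall>t. ((\<lambda>s. deriv (\<lambda>t. u (cosh t)) s ^ 5) has_real_derivative \<kappa> * 5 * sinh t ^ 4) (at t)) \<and>
     deriv (\<lambda>t. u (cosh t)) 0 = 0"

definition r2 :: "complex^6 \<Rightarrow> real" where
  "r2 z = (\<Sum>i\<in>UNIV. (cmod (z $ i))\<^sup>2)"

definition wirtinger :: "6 \<Rightarrow> (complex^6 \<Rightarrow> complex) \<Rightarrow> complex^6 \<Rightarrow> complex" where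
  "wirtinger j f z =
     (frechet_derivative f (at z) (axis j 1) - \<i> * frechet_derivative f (at z) (axis j \<i>)) / 2"

definition wirtinger_bar :: "6 \<Rightarrow> (complex^6 \<Rightarrow> complex) \<Rightarrow> complex^6 \<Rightarrow> complex" where
  "wirtinger_bar j f z =
     (frechet_derivative f (at z) (axis j 1) + \<i> * frechet_derivative f (at z) (axis j \<i>)) / 2"

definition ddbar :: "(complex^6 \<Rightarrow> complex) \<Rightarrow> complex^6 \<Rightarrow> complex^6 \<Rightarrow> complex^6 \<Rightarrow> complex" where
  "ddbar f z v w = (\<Sum>j\<in>UNIV. \<Sum>k\<in>UNIV.
     wirtinger j (wirtinger_bar k f) z * (v $ j * cnj (w $ k) - w $ j * cnj (v $ k)))"

text \<open>The potential is smooth near the quadric, since \<open>r2 z \<ge> 1\<close> there; the values of the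
  form off the quadric play no role.\<close>

definition stenzel_form ::
  "(real \<Rightarrow> real) \<Rightarrow> complex^6 \<Rightarrow> complex^6 \<Rightarrow> complex^6 \<Rightarrow> complex" where
  "stenzel_form u z v w = \<i> * ddbar (\<lambda>y. complex_of_real (u (r2 y))) z v w"

definition kaehler_metric ::
  "(complex^6 \<Rightarrow> complex^6 \<Rightarrow> complex^6 \<Rightarrow> complex) \<Rightarrow> complex^6 \<Rightarrow> complex^6 \<Rightarrow> complex^6 \<Rightarrow> real" where
  "kaehler_metric \<omega> z v w = Re (\<omega> z v (\<i> *s w))"

definition holomorphic_fun_on :: "(complex^'n \<Rightarrow> complex) \<Rightarrow> (complex^'n) set \<Rightarrow> bool" where
  "holomorphic_fun_on f W \<longleftrightarrow>
     (\<forall>w\<in>W. \<exists>D. (f has_derivative D) (at w) \<and> (\<forall>s v. D (s *s v) = s * D v))"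

text \<open>Holomorphic immersions from open subsets of \<open>complex^5\<close> are, after shrinking the domain,
  the inverses of the holomorphic charts of the quadric.\<close>

definition holomorphic_immersion_quadric ::
  "(complex^5 \<Rightarrow> complex^6) \<Rightarrow> (complex^5) set \<Rightarrow> bool" where
  "holomorphic_immersion_quadric \<psi> W \<longleftrightarrow>
     open W \<and> \<psi> ` W \<subseteq> quadric \<and> (\<forall>i. holomorphic_fun_on (\<lambda>w. \<psi> w $ i) W) \<and>
     (\<forall>w\<in>W. inj (frechet_derivative \<psi> (at w)))"

text \<open>The indices \<open>of_nat i\<close>, for \<open>i < 5\<close>, run through all elements of the index type \<open>5\<close>.\<close>

definition coord_frame ::
  "(('a::real_normed_algebra_1)^5 \<Rightarrow> complex^6) \<Rightarrow> 'a^5 \<Rightarrow> nat \<Rightarrow> complex^6" where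
  "coord_frame \<psi> w = (\<lambda>i. frechet_derivative \<psi> (at w) (axis (of_nat i) 1))"

definition holomorphic_volume_form :: "(complex^6 \<Rightarrow> (complex^6) form) \<Rightarrow> bool" where
  "holomorphic_volume_form \<Omega> \<longleftrightarrow>
     (\<forall>z\<in>quadric. complex_alternating_form 5 (quadric_tangent z) (\<Omega> z)) \<and>
     (\<forall>z\<in>quadric. \<exists>v. (\<forall>i<5. v i \<in> quadric_tangent z) \<and> \<Omega> z v \<noteq> 0) \<and>
     (\<forall>\<psi> W. holomorphic_immersion_quadric \<psi> W \<longrightarrow>
        holomorphic_fun_on (\<lambda>w. \<Omega> (\<psi> w) (coord_frame \<psi> w)) W)"

definition stenzel_volume_form :: "(real \<Rightarrow> real) \<Rightarrow> (complex^6 \<Rightarrow> (complex^6) form) \<Rightarrow> bool" where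
  "stenzel_volume_form u \<Omega> \<longleftrightarrow>
     holomorphic_volume_form \<Omega> \<and>
     (\<forall>z\<in>quadric. \<forall>v. (\<forall>i<10. v i \<in> quadric_tangent z) \<longrightarrow>
        wedge_power 2 (\<lambda>v. stenzel_form u z (v 0) (v 1)) 5 v / fact 5
        = (- 1) ^ (5 * (5 - 1) div 2) * (\<i> / 2) ^ 5 * wedge 5 5 (\<Omega> z) (\<lambda>v. cnj (\<Omega> z v)) v)"


section \<open>Special Lagrangian submanifolds\<close>

definition local_parametrization ::
  "(complex^6) set \<Rightarrow> (real^5 \<Rightarrow> complex^6) \<Rightarrow> (real^5) set \<Rightarrow> bool" where
  "local_parametrization L \<phi> U \<longleftrightarrow>
     open U \<and> smooth_on \<phi> U \<and> (\<forall>q\<in>U. inj (frechet_derivative \<phi> (at q))) \<and>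
     (\<exists>g. homeomorphism U (\<phi> ` U) \<phi> g) \<and> openin (top_of_set L) (\<phi> ` U)"

text \<open>Embedded submanifolds of real dimension 5.\<close>

definition submanifold5 :: "(complex^6) set \<Rightarrow> bool" where
  "submanifold5 L \<longleftrightarrow>
     L \<subseteq> quadric \<and> (\<forall>p\<in>L. \<exists>\<phi> U. local_parametrization L \<phi> U \<and> p \<in> \<phi> ` U)"

definition lagrangian ::
  "(complex^6 \<Rightarrow> complex^6 \<Rightarrow> complex^6 \<Rightarrow> complex) \<Rightarrow> (complex^6) set \<Rightarrow> bool" where
  "lagrangian \<omega> L \<longleftrightarrow> submanifold5 L \<and>
     (\<forall>\<phi> U. local_parametrization L \<phi> U \<longrightarrow>
        (\<forall>q\<in>U. \<forall>a b. \<omega> (\<phi> q) (frechet_derivative \<phi> (at q) a) (frechet_derivative \<phi> (at q) b) = 0))"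

text \<open>The Riemannian volume form of the metric induced on the image of \<open>\<phi>\<close>, with the orientation
  for which \<open>\<phi>\<close> is orientation preserving, evaluated at the coordinate frame of \<open>\<phi>\<close>.\<close>

definition volume_density ::
  "(complex^6 \<Rightarrow> complex^6 \<Rightarrow> complex^6 \<Rightarrow> real) \<Rightarrow> (real^5 \<Rightarrow> complex^6) \<Rightarrow> real^5 \<Rightarrow> real" where
  "volume_density g \<phi> q =
     sqrt (det (\<chi> i j. g (\<phi> q) (frechet_derivative \<phi> (at q) (axis i 1))
                              (frechet_derivative \<phi> (at q) (axis j 1)) :: real^5^5))"

text \<open>The number \<open>\<theta>\<close> is a Lagrangian angle at \<open>\<phi> q\<close>, for the orientation given by \<open>\<phi>\<close>.\<close>

definition lagrangian_angle ::
  "(complex^6 \<Rightarrow> complex^6 \<Rightarrow> complex^6 \<Rightarrow> complex) \<Rightarrow> (complex^6 \<Rightarrow> (complex^6) form) \<Rightarrow>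
   (real^5 \<Rightarrow> complex^6) \<Rightarrow> real^5 \<Rightarrow> real \<Rightarrow> bool" where
  "lagrangian_angle \<omega> \<Omega> \<phi> q \<theta> \<longleftrightarrow>
     \<Omega> (\<phi> q) (coord_frame \<phi> q)
     = exp (\<i> * complex_of_real \<theta>) * complex_of_real (volume_density (kaehler_metric \<omega>) \<phi> q)"

text \<open>Local orientations are given by local parametrizations: every local orientation is,
  near each point, the one induced by some local parametrization.\<close>

definition special_lagrangian ::
  "(complex^6 \<Rightarrow> complex^6 \<Rightarrow> complex^6 \<Rightarrow> complex) \<Rightarrow> (complex^6 \<Rightarrow> (complex^6) form) \<Rightarrow>
   (complex^6) set \<Rightarrow> bool" where
  "special_lagrangian \<omega> \<Omega> L \<longleftrightarrow> lagrangian \<omega> L \<and>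
     (\<exists>\<theta>. \<forall>p\<in>L. \<exists>\<phi> U. local_parametrization L \<phi> U \<and> p \<in> \<phi> ` U \<and>
        (\<forall>q\<in>U. lagrangian_angle \<omega> \<Omega> \<phi> q \<theta>))"


section \<open>The group action, the moment map and the Lagrangians\<close>

text \<open>In the index type \<open>6\<close> the numeral \<open>6\<close> denotes the same element as \<open>0\<close>, so the elements
  are \<open>1, \<dots>, 6\<close>; likewise for the index type \<open>2\<close>.\<close>

definition elem_mat :: "6 \<Rightarrow> 6 \<Rightarrow> real^6^6" where
  "elem_mat i j = (\<chi> a b. if a = i \<and> b = j then 1 else 0)"

definition xi :: "6 \<Rightarrow> 6 \<Rightarrow> real^6^6" where
  "xi i j = elem_mat j i - elem_mat i j"

definition eta :: "real^6^6" where
  "eta = xi 1 2 + xi 3 4 + xi 5 6"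

definition lie_H :: "(real^6^6) set" where
  "lie_H = span {eta}"

definition diag3 :: "real^2^2 \<Rightarrow> real^6^6" where
  "diag3 h = (\<Sum>(p, q)\<in>{(1, 2), (3, 4), (5, 6)}.
     (h $ 1 $ 1) *\<^sub>R elem_mat p p + (h $ 1 $ 2) *\<^sub>R elem_mat p q +
     (h $ 2 $ 1) *\<^sub>R elem_mat q p + (h $ 2 $ 2) *\<^sub>R elem_mat q q)"

definition group_H :: "(real^6^6) set" where
  "group_H = diag3 ` {h. orthogonal_matrix h \<and> det h = 1}"

definition act :: "real^6^6 \<Rightarrow> (real^6) \<times> (real^6) \<Rightarrow> (real^6) \<times> (real^6)" where
  "act h = (\<lambda>(x, \<xi>). (h *v x, h *v \<xi>))"

definition orbit_H :: "((real^6) \<times> (real^6)) set \<Rightarrow> ((real^6) \<times> (real^6)) set" where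
  "orbit_H V = {act h p | h p. h \<in> group_H \<and> p \<in> V}"

definition moment_map :: "(real \<Rightarrow> real) \<Rightarrow> complex^6 \<Rightarrow> real^6^6 \<Rightarrow> real" where
  "moment_map u z X =
     deriv u (r2 z) * ((\<i> *s z) \<bullet> ((\<chi> i j. complex_of_real (X $ i $ j)) *v z))"

text \<open>An element of the dual of \<open>lie_H\<close> is represented by a linear functional \<open>c\<close> on the whole
  matrix space, of which only the restriction to \<open>lie_H\<close> is used.\<close>

definition moment_level ::
  "(real \<Rightarrow> real) \<Rightarrow> (real^6^6 \<Rightarrow> real) \<Rightarrow> ((real^6) \<times> (real^6)) set" where
  "moment_level u c = {p \<in> cotangent_sphere. \<forall>X\<in>lie_H. moment_map u (Phi p) X = c X}"

definition L1 :: "((real^6) \<times> (real^6)) set" where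
  "L1 = {(vector [x1, 0, x3, 0, x5, 0], vector [0, \<xi>2, 0, \<xi>4, 0, \<xi>6]) | x1 x3 x5 \<xi>2 \<xi>4 \<xi>6.
           x1\<^sup>2 + x3\<^sup>2 + x5\<^sup>2 = 1}"

definition L2 :: "((real^6) \<times> (real^6)) set" where
  "L2 = {(vector [x1, 0, x3, 0, 0, 0], vector [0, \<xi>2, 0, \<xi>4, \<xi>5, \<xi>6]) | x1 x3 \<xi>2 \<xi>4 \<xi>5 \<xi>6.
           x1\<^sup>2 + x3\<^sup>2 = 1}"

end

theory Submission
  imports Defs "Jordan_Normal_Form.Determinant"
begin

text \<open>
  In the null coordinates \<open>W\<^sub>k = z\<^sub>2\<^sub>k\<^sub>-\<^sub>1 + \<i> z\<^sub>2\<^sub>k\<close>, \<open>V\<^sub>k = z\<^sub>2\<^sub>k\<^sub>-\<^sub>1 - \<i> z\<^sub>2\<^sub>k\<close> the quadric is \<open>\<Sum> W\<^sub>k V\<^sub>k = 1\<close>, the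
  group \<open>H\<close> is the circle \<open>(W, V) \<mapsto> (\<zeta> W, \<zeta>\<^sup>-\<^sup>1 V)\<close> and the moment map is \<open>u' (r\<^sup>2) (|W|\<^sup>2 - |V|\<^sup>2) / 2\<close>.
  Where \<open>W\<^sub>1 \<noteq> 0\<close> there is a holomorphic chart \<open>(s, p)\<close> with \<open>W\<^sub>1 = e\<^sup>s\<close>, in which the orbit of a level
  set is given by real \<open>p\<close> and \<open>s = S(p) + \<i> t\<close>.  The function \<open>S\<close> exists because the moment map is strictly
  increasing along the orbits of the complexified group, that is in \<open>Re s\<close>, by the differential equation for \<open>u\<close>.
  The orbit is Lagrangian because \<open>\<partial>\<^sub>s\<close> generates the complexified action and the coordinate vector
  fields are real up to the rotation by \<open>e\<^sup>\<i>\<^sup>t\<close>.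

  The volume form, evaluated at the coordinate frame of the chart, is a holomorphic function.  Its modulus is
  given by the Hermitian determinant of the metric, which is constant by the Monge-Ampere equation, so the function
  is constant, and the Lagrangian angle is the argument of this constant up to a fixed factor.  The
  charts with pivots \<open>W\<^sub>2\<close> and \<open>W\<^sub>3\<close> arise from permuting the coordinates; the constant is the same for all
  of them, as can be read off at a fixed point of the permutation.
\<close>

text \<open>No model volume form on the quadric is constructed. The normalisation of \<Omega> fixes
  only its size, so its phase has to come from holomorphy: a holomorphic coefficient of constant
  modulus \<open>sqrt (2 * \<kappa>)\<close> is constant. For this the chart is defined on the whole
  of complex 5-space (\<open>W1\<close> is an exponential, \<open>V1\<close> is eliminated) and its
  frame is triangular in the null coordinates, so that the modulus can be computed.

  The two Lagrangians differ in the third pair. In the first, all W and V become real after a common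
  rotation. In the second, the third pair obeys \<open>V3 = - cnj W3\<close>, a condition that the
  circle preserves by itself, so the chart leaves this pair unrotated. Its s-direction then is not
  the full generator of the complexified action; the missing part has purely imaginary Hermitian
  product with the relevant tangent vectors and does no harm. A flag \<open>c\<close> carries both
  cases through one argument.

  The identity for \<Omega> speaks of real tangent vectors only, while the determinant formula needs
  vectors of type (1,0) and (0,1) separately; hence the polarisation by pairs.\<close>

no_notation vec_index (infixl "$" 100)

lemmas cart_eq_iff = Finite_Cartesian_Product.vec_eq_iff

section \<open>Calculus of smooth maps\<close>

lemma frechet_derivative_eqI:
  "(f has_derivative f') (at x) \<Longrightarrow> frechet_derivative f (at x) = f'"
  by (metis frechet_derivative_at)

text \<open>Openness makes the two functions agree near each point, so they have the same
  derivatives there even though these are taken in the full space.\<close>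

lemma Ck_on_cong:
  assumes "open S" "\<And>x. x \<in> S \<Longrightarrow> f x = g x"
  shows "Ck_on k f S = Ck_on k g S"
  using assms(2)
proof (induction k arbitrary: f g)
  case 0
  then show ?case by (auto cong: continuous_on_cong_simp)
next
  case (Suc k)
  have *: "(f has_derivative D) (at x) \<longleftrightarrow> (g has_derivative D) (at x)" if "x \<in> S" for x D
    using has_derivative_transform_within_open[OF _ assms(1) that] Suc.prems by metis
  have d: "f differentiable (at x) \<longleftrightarrow> g differentiable (at x)" if "x \<in> S" for x
    using *[OF that] by (auto simp: differentiable_def)
  have e: "frechet_derivative f (at x) = frechet_derivative g (at x)" if "x \<in> S" for x
    using *[OF that] by (simp add: frechet_derivative_def)
  have "Ck_on k (\<lambda>x. frechet_derivative f (at x) v) S = Ck_on k (\<lambda>x. frechet_derivative g (at x) v) S" for v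
    by (rule Suc.IH) (simp add: e)
  then show ?case using d by auto
qed

text \<open>Allows any explicit derivative in place of the chosen \<open>frechet_derivative\<close>;
  all closure properties below are inductions through this rule.\<close>

lemma Ck_on_SucI:
  assumes "open S" "\<And>x. x \<in> S \<Longrightarrow> (f has_derivative f' x) (at x)"
    "\<And>v. Ck_on k (\<lambda>x. f' x v) S"
  shows "Ck_on (Suc k) f S"
proof -
  have "Ck_on k (\<lambda>x. frechet_derivative f (at x) v) S" for v
    using assms(3)[of v] Ck_on_cong[OF assms(1), of "\<lambda>x. frechet_derivative f (at x) v" "\<lambda>x. f' x v" k]
      frechet_derivative_eqI[OF assms(2)] by auto
  then show ?thesis using assms(2) by (auto simp: differentiable_def)
qed

lemma Ck_on_has_derivative:
  "Ck_on (Suc k) f S \<Longrightarrow> x \<in> S \<Longrightarrow> (f has_derivative frechet_derivative f (at x)) (at x)"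
  by (simp add: frechet_derivative_works)

lemma Ck_on_continuous: "Ck_on k f S \<Longrightarrow> continuous_on S f"
  by (cases k) (auto intro!: continuous_at_imp_continuous_on differentiable_imp_continuous_within)

lemma Ck_on_Suc_imp: "Ck_on (Suc k) f S \<Longrightarrow> Ck_on k f S"
proof (induction k arbitrary: f)
  case 0
  then show ?case using Ck_on_continuous by fastforce
next
  case (Suc k)
  then show ?case by (metis Ck_on.simps(2))
qed

lemma Ck_on_subset: "Ck_on k f S \<Longrightarrow> T \<subseteq> S \<Longrightarrow> Ck_on k f T"
  by (induction k arbitrary: f) (auto intro: continuous_on_subset)

lemma Ck_on_const: "Ck_on k (\<lambda>x. c) S"
proof (induction k arbitrary: c)
  case 0
  show ?case by simp
next
  case (Suc k)
  show ?case using Suc[of 0] by simp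
qed

lemma Ck_on_linear_comp:
  assumes "bounded_linear L" "open S" "Ck_on k f S"
  shows "Ck_on k (\<lambda>x. L (f x)) S"
  using assms(3)
proof (induction k arbitrary: f)
  case 0
  then show ?case by (simp add: bounded_linear.continuous_on[OF assms(1)])
next
  case (Suc k)
  show ?case
    by (rule Ck_on_SucI[OF assms(2) bounded_linear.has_derivative[OF assms(1)]])
      (use Ck_on_has_derivative[OF Suc.prems] Suc in auto)
qed

lemma Ck_on_linear:
  assumes "bounded_linear L" "open S"
  shows "Ck_on k L S"
proof (cases k)
  case 0
  then show ?thesis using linear_continuous_on[OF assms(1)] by simp
next
  case (Suc j)
  show ?thesis unfolding Suc
    by (rule Ck_on_SucI[OF assms(2) bounded_linear_imp_has_derivative[OF assms(1)]])
      (rule Ck_on_const)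
qed

lemma Ck_on_add:
  assumes "open S" "Ck_on k f S" "Ck_on k g S"
  shows "Ck_on k (\<lambda>x. f x + g x) S"
  using assms(2,3)
proof (induction k arbitrary: f g)
  case 0
  then show ?case by (simp add: continuous_on_add)
next
  case (Suc k)
  show ?case
    by (rule Ck_on_SucI[OF assms(1) has_derivative_add])
      (use Ck_on_has_derivative[OF Suc.prems(1)] Ck_on_has_derivative[OF Suc.prems(2)] Suc in auto)
qed

lemma Ck_on_sum:
  assumes "open S" "\<And>i. i \<in> I \<Longrightarrow> Ck_on k (f i) S"
  shows "Ck_on k (\<lambda>x. \<Sum>i\<in>I. f i x) S"
  using assms(2)
  by (induction I rule: infinite_finite_induct) (auto intro: Ck_on_const Ck_on_add[OF assms(1)])

lemma Ck_on_bilinear: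
  assumes "bounded_bilinear B" "open S" "Ck_on k f S" "Ck_on k g S"
  shows "Ck_on k (\<lambda>x. B (f x) (g x)) S"
  using assms(3,4)
proof (induction k arbitrary: f g)
  case 0
  then show ?case by (simp add: bounded_bilinear.continuous_on[OF assms(1)])
next
  case (Suc k)
  note c = Ck_on_Suc_imp[OF Suc.prems(1)] Ck_on_Suc_imp[OF Suc.prems(2)]
  show ?case
    by (rule Ck_on_SucI[OF assms(2) bounded_bilinear.FDERIV[OF assms(1)]])
      (use Ck_on_has_derivative[OF Suc.prems(1)] Ck_on_has_derivative[OF Suc.prems(2)] Suc c in
        \<open>auto intro!: Ck_on_add[OF assms(2)]\<close>)
qed

lemmas Ck_on_mult = Ck_on_bilinear[OF bounded_bilinear_mult]
lemmas Ck_on_scaleR = Ck_on_bilinear[OF bounded_bilinear_scaleR]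

lemma Ck_on_comp:
  fixes g :: "'a::euclidean_space \<Rightarrow> 'b::euclidean_space"
  assumes "open S" "open T" "g ` S \<subseteq> T" "Ck_on k f T" "Ck_on k g S"
  shows "Ck_on k (\<lambda>x. f (g x)) S"
  using assms(4,5)
proof (induction k arbitrary: f)
  case 0
  then show ?case using assms(3) by (auto intro: continuous_on_compose2)
next
  case (Suc k)
  \<comment> \<open>The chain rule is expanded over a basis because \<open>Ck_on\<close> controls
    derivatives in fixed directions only, whereas the inner derivative is a direction that varies
    with the point.\<close>
  let ?D = "\<lambda>x v. \<Sum>b\<in>Basis. (frechet_derivative g (at x) v \<bullet> b) *\<^sub>R frechet_derivative f (at (g x)) b"
  show ?case
  proof (rule Ck_on_SucI[OF assms(1)])
    fix x assume x: "x \<in> S"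
    have df: "(f has_derivative frechet_derivative f (at (g x))) (at (g x))"
      using Ck_on_has_derivative[OF Suc.prems(1)] x assms(3) by blast
    have dg: "(g has_derivative frechet_derivative g (at x)) (at x)"
      using Ck_on_has_derivative[OF Suc.prems(2) x] .
    interpret f': bounded_linear "frechet_derivative f (at (g x))"
      using df has_derivative_bounded_linear by blast
    have "frechet_derivative f (at (g x)) (frechet_derivative g (at x) v) = ?D x v" for v
      by (subst euclidean_representation[symmetric, of "frechet_derivative g (at x) v"])
        (simp only: f'.sum f'.scaleR)
    then show "((\<lambda>x. f (g x)) has_derivative ?D x) (at x)"
      using has_derivative_compose[OF dg df] by presburger
  next
    fix v
    have "Ck_on k (\<lambda>x. frechet_derivative g (at x) v) S" using Suc.prems by auto
    moreover have "Ck_on k (\<lambda>x. frechet_derivative f (at (g x)) b) S" for b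
      using Suc.IH[of "\<lambda>y. frechet_derivative f (at y) b"] Suc.prems Ck_on_Suc_imp by auto
    ultimately show "Ck_on k (\<lambda>x. ?D x v) S"
      by (intro Ck_on_sum[OF assms(1)] Ck_on_scaleR[OF assms(1)]
          Ck_on_linear_comp[OF bounded_linear_inner_left assms(1)]) auto
  qed
qed

lemma Ck_on_exp: "Ck_on k (exp :: 'a \<Rightarrow> 'a::{real_normed_field,banach,euclidean_space}) UNIV"
proof (induction k)
  case 0
  then show ?case by (simp add: continuous_on_exp continuous_on_id)
next
  case (Suc k)
  show ?case
    by (rule Ck_on_SucI[OF open_UNIV])
      (use DERIV_exp in \<open>auto simp: has_field_derivative_def intro!: Ck_on_mult Ck_on_const Suc\<close>)
qed

lemma Ck_on_inverse:
  fixes f :: "'a::euclidean_space \<Rightarrow> real"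
  assumes "open S" "Ck_on k f S" "\<And>x. x \<in> S \<Longrightarrow> f x \<noteq> 0"
  shows "Ck_on k (\<lambda>x. inverse (f x)) S"
  using assms(2,3)
proof (induction k)
  case 0
  then show ?case by (simp add: continuous_on_inverse)
next
  case (Suc k)
  have c: "Ck_on k (\<lambda>x. inverse (f x)) S" using Suc Ck_on_Suc_imp by blast
  have "Ck_on k (\<lambda>x. (- 1) *\<^sub>R (inverse (f x) * frechet_derivative f (at x) v * inverse (f x))) S" for v
    by (intro Ck_on_linear_comp[OF bounded_linear_scaleR_right] Ck_on_mult assms(1) c)
      (use Suc in auto)
  then show ?case
    by (intro Ck_on_SucI[OF assms(1) Deriv.has_derivative_inverse])
      (use Ck_on_has_derivative[OF Suc.prems(1)] Suc.prems(2) in auto)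
qed

lemma Ck_on_deriv:
  fixes u :: "real \<Rightarrow> real"
  assumes "open S" "Ck_on (Suc k) u S"
  shows "Ck_on k (deriv u) S"
proof -
  have "deriv u x = frechet_derivative u (at x) 1" if "x \<in> S" for x
  proof -
    have "(u has_derivative frechet_derivative u (at x)) (at x)"
      using Ck_on_has_derivative[OF assms(2) that] .
    moreover from this have "frechet_derivative u (at x) = (*) (frechet_derivative u (at x) 1)"
      by (metis has_derivative_bounded_linear real_bounded_linear mult.commute mult_1 ext)
    ultimately have "(u has_field_derivative frechet_derivative u (at x) 1) (at x)"
      by (simp add: has_field_derivative_def)
    then show ?thesis by (rule DERIV_imp_deriv)
  qed
  moreover have "Ck_on k (\<lambda>x. frechet_derivative u (at x) 1) S" using assms(2) by auto
  ultimately show ?thesis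
    using Ck_on_cong[OF assms(1), of "deriv u" "\<lambda>x. frechet_derivative u (at x) 1" k] by simp
qed

lemma bounded_linear_axis: "bounded_linear (axis i :: 'a::euclidean_space \<Rightarrow> 'a^'n)"
  by (rule linear_conv_bounded_linear[THEN iffD1], rule linearI) (auto simp: cart_eq_iff axis_def)

lemma Ck_on_vec:
  fixes f :: "'n::finite \<Rightarrow> 'a::euclidean_space \<Rightarrow> 'b::euclidean_space"
  assumes "open S" "\<And>i. Ck_on k (f i) S"
  shows "Ck_on k (\<lambda>x. \<chi> i. f i x) S"
proof -
  have "(\<chi> i. f i x) = (\<Sum>i\<in>UNIV. axis i (f i x))" for x
    by (simp add: cart_eq_iff axis_def)
  then show ?thesis
    by (simp add: Ck_on_sum Ck_on_linear_comp[OF bounded_linear_axis] assms)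
qed

lemma Ck_on_Pair:
  fixes f :: "'a::euclidean_space \<Rightarrow> 'b::euclidean_space" and g :: "'a \<Rightarrow> 'c::euclidean_space"
  assumes "open S" "Ck_on k f S" "Ck_on k g S"
  shows "Ck_on k (\<lambda>x. (f x, g x)) S"
proof -
  have "Ck_on k (\<lambda>x. (f x, 0) + (0, g x)) S"
    using assms by (intro Ck_on_add Ck_on_linear_comp[where L="\<lambda>y. (y, 0)"]
        Ck_on_linear_comp[where L="\<lambda>y. (0, y)"] bounded_linear_Pair
        bounded_linear_ident bounded_linear_zero)
  then show ?thesis by simp
qed

lemma smooth_on_has_derivative:
  "smooth_on f S \<Longrightarrow> x \<in> S \<Longrightarrow> (f has_derivative frechet_derivative f (at x)) (at x)"
  unfolding smooth_on_def using Ck_on_has_derivative by blast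

lemma smooth_on_continuous: "smooth_on f S \<Longrightarrow> continuous_on S f"
  unfolding smooth_on_def using Ck_on_continuous by blast

section \<open>An implicit function theorem for monotone equations\<close>

text \<open>Monotonicity in the real variable makes \<open>(s, q) \<mapsto> (G (s, q), q)\<close>
  globally injective, and invariance of domain makes its range open. One function therefore solves
  the equation for every \<open>q\<close> that admits a solution, and no local solutions have to be
  patched.\<close>

theorem implicit_function_monotone:
  fixes G :: "real \<times> 'a::euclidean_space \<Rightarrow> real" and c :: real
  assumes sm: "smooth_on G UNIV"
    and pos: "\<And>x. frechet_derivative G (at x) (1, 0) > 0"
  obtains S P where "open P" "smooth_on S P" "\<And>q. q \<in> P \<Longrightarrow> G (S q, q) = c"
    "\<And>s q. G (s, q) = c \<Longrightarrow> q \<in> P \<and> S q = s"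
proof -
  note dG = smooth_on_has_derivative[OF sm UNIV_I]
  have lin: "linear (frechet_derivative G (at x))" for x
    using bounded_linear.linear[OF has_derivative_bounded_linear[OF dG]] .
  have mono: "G (s, q) < G (t, q)" if "s < t" for s t q
  proof (rule DERIV_pos_imp_increasing[OF that])
    fix x :: real
    have "((\<lambda>s. (s, q)) has_derivative (\<lambda>h. (h, 0))) (at x)"
      by (auto intro!: derivative_eq_intros)
    from has_derivative_compose[OF this dG]
    have d: "((\<lambda>s. G (s, q)) has_derivative (\<lambda>h. frechet_derivative G (at (x, q)) (h, 0))) (at x)" .
    have "(\<lambda>h. frechet_derivative G (at (x, q)) (h, 0)) = (*) (frechet_derivative G (at (x, q)) (1, 0))"
    proof
      fix h
      show "frechet_derivative G (at (x, q)) (h, 0) = frechet_derivative G (at (x, q)) (1, 0) * h"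
        using linear_cmul[OF lin[of "(x, q)"], of h "(1, 0)"] by (simp add: mult.commute[of h])
    qed
    with d have "((\<lambda>s. G (s, q)) has_real_derivative frechet_derivative G (at (x, q)) (1, 0)) (at x)"
      by (simp only: has_field_derivative_def)
    then show "\<exists>y. DERIV (\<lambda>s. G (s, q)) x :> y \<and> 0 < y" using pos by blast
  qed
  define f where "f = (\<lambda>x. (G x, snd x))"
  have inj: "inj f"
  proof (rule injI)
    fix x y assume "f x = f y"
    then have "G (fst x, snd x) = G (fst y, snd x)" "snd x = snd y" by (cases x; cases y; auto simp: f_def)+
    then show "x = y" using mono[of "fst x" "fst y" "snd x"] mono[of "fst y" "fst x" "snd x"]
      by (metis linorder_neqE_linordered_idom order_less_irrefl prod.collapse)
  qed
  have df: "(f has_derivative (\<lambda>h. (frechet_derivative G (at x) h, snd h))) (at x)" for x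
    unfolding f_def by (intro has_derivative_Pair dG has_derivative_snd has_derivative_ident)
  have cf: "continuous_on UNIV f"
    by (intro continuous_at_imp_continuous_on ballI has_derivative_continuous[OF df])
  have op: "open (range f)" using invariance_of_domain[OF cf open_UNIV inj] .
  define P where "P = {q. (c, q) \<in> range f}"
  define S where "S q = fst (inv_into UNIV f (c, q))" for q
  have "open P"
  proof -
    have "P = (\<lambda>q. (c, q)) -` range f" by (auto simp: P_def)
    then show ?thesis using op by (auto intro!: open_vimage continuous_intros)
  qed
  have inv_eq: "inv_into UNIV f (c, q) = (S q, q)" if "q \<in> P" for q
  proof -
    have "f (inv_into UNIV f (c, q)) = (c, q)" using that unfolding P_def by (simp add: f_inv_into_f)
    then have "snd (inv_into UNIV f (c, q)) = q" by (simp add: f_def)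
    then show ?thesis unfolding S_def by (metis prod.collapse)
  qed
  have GS: "G (S q, q) = c" if "q \<in> P" for q
  proof -
    have "f (inv_into UNIV f (c, q)) = (c, q)" using that unfolding P_def by (simp add: f_inv_into_f)
    then show ?thesis unfolding inv_eq[OF that] by (simp add: f_def)
  qed
  have uniq: "q \<in> P \<and> S q = s" if "G (s, q) = c" for s q
  proof -
    have f: "f (s, q) = (c, q)" using that by (simp add: f_def)
    then have "q \<in> P" unfolding P_def by (metis (mono_tags) mem_Collect_eq rangeI)
    moreover have "inv_into UNIV f (c, q) = (s, q)" using inv_f_f[OF inj, of "(s, q)"] f by simp
    ultimately show ?thesis unfolding S_def by simp
  qed
  define DS where "DS = (\<lambda>q v. - frechet_derivative G (at (S q, q)) (0, v)
      * inverse (frechet_derivative G (at (S q, q)) (1, 0)))"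
  have dS: "(S has_derivative DS q) (at q)" if q: "q \<in> P" for q
  proof -
    let ?D = "frechet_derivative G (at (S q, q))"
    \<comment> \<open>Solving \<open>?D (x, b) = a\<close> for \<open>x\<close> inverts the
      differential of \<open>f\<close>; \<open>pos\<close> allows the division.\<close>
    let ?g' = "\<lambda>(a, b). ((a - ?D (0, b)) / ?D (1, 0), b)"
    have D: "?D (a, b) = a * ?D (1, 0) + ?D (0, b)" for a b
      using linear_add[OF lin[of "(S q, q)"], of "(a, 0)" "(0, b)"] linear_cmul[OF lin[of "(S q, q)"], of a "(1, 0)"] by simp
    have ne: "?D (1, 0) \<noteq> 0" using pos[of "(S q, q)"] by simp
    have "((\<lambda>h. (?D h, snd h)) \<circ> ?g') (a, b) = (a, b)" for a b
      using D[of "(a - ?D (0, b)) / ?D (1, 0)" b] ne by simp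
    then have "(\<lambda>h. (?D h, snd h)) \<circ> ?g' = id" by (simp add: fun_eq_iff)
    then have "(inv_into UNIV f has_derivative ?g') (at (f (S q, q)))"
      by (intro has_derivative_inverse_strong[OF open_UNIV UNIV_I cf _ df])
        (auto simp: inv_f_f[OF inj])
    moreover have "f (S q, q) = (c, q)" using GS[OF q] by (simp add: f_def)
    ultimately have "(inv_into UNIV f has_derivative ?g') (at (c, q))" by simp
    moreover have "((\<lambda>q. (c, q)) has_derivative (\<lambda>h. (0, h))) (at q)"
      by (auto intro!: derivative_eq_intros)
    ultimately have "((\<lambda>q. fst (inv_into UNIV f (c, q))) has_derivative (\<lambda>v. fst (?g' (0, v)))) (at q)"
      by (intro has_derivative_fst) (rule has_derivative_compose)
    moreover have "(\<lambda>v. fst (?g' (0, v))) = DS q"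
      by (auto simp: DS_def fun_eq_iff divide_inverse)
    ultimately show ?thesis by (simp add: S_def[abs_def])
  qed
  \<comment> \<open>Bootstrapping: \<open>DS\<close> is made of derivatives of \<open>G\<close> at
    \<open>(S q, q)\<close>, so \<open>k\<close> derivatives of \<open>S\<close> yield one
    more.\<close>
  have "Ck_on k S P" for k
  proof (induction k)
    case 0
    show ?case
      using has_derivative_continuous[OF dS] by (simp add: continuous_at_imp_continuous_on)
  next
    case (Suc k)
    have p: "Ck_on k (\<lambda>q. (S q, q)) P"
      using Ck_on_Pair[OF \<open>open P\<close> Suc Ck_on_linear[OF bounded_linear_ident \<open>open P\<close>]] .
    have "Ck_on k (\<lambda>x. frechet_derivative G (at x) w) UNIV" for w
      using sm unfolding smooth_on_def by (metis Ck_on.simps(2))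
    then have g: "Ck_on k (\<lambda>q. frechet_derivative G (at (S q, q)) w) P" for w
      using Ck_on_comp[OF \<open>open P\<close> open_UNIV _ _ p, of "\<lambda>x. frechet_derivative G (at x) w"] by simp
    have "Ck_on k (\<lambda>q. (- frechet_derivative G (at (S q, q)) (0, v))
        * inverse (frechet_derivative G (at (S q, q)) (1, 0))) P" for v
      by (intro Ck_on_mult Ck_on_inverse \<open>open P\<close> g Ck_on_linear_comp[where L = uminus]
          bounded_linear_minus bounded_linear_ident)
        (use pos in \<open>auto simp: less_imp_neq\<close>, metis less_irrefl pos)
    then show ?case
      by (intro Ck_on_SucI[OF \<open>open P\<close> dS]) (auto simp: DS_def)
  qed
  then have "smooth_on S P" by (simp add: smooth_on_def)
  then show ?thesis using that \<open>open P\<close> GS uniq by blast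
qed

section \<open>Alternating sums and wedge products\<close>

text \<open>Antisymmetrisation without factorials, so that the normalising factors of
  \<open>wedge\<close> can be followed separately.\<close>

definition alt_sum :: "nat \<Rightarrow> ((nat \<Rightarrow> 'v) \<Rightarrow> complex) \<Rightarrow> (nat \<Rightarrow> 'v) \<Rightarrow> complex" where
  "alt_sum n G v = (\<Sum>\<sigma> | \<sigma> permutes {..<n}. of_int (sign \<sigma>) * G (\<lambda>i. v (\<sigma> i)))"

lemma of_int_sign_square:
  "of_int (sign p) * (of_int (sign p) * a) = (a :: 'a::comm_ring_1)"
  by (simp add: sign_def)

lemma sign_compose_lessThan:
  "\<sigma> permutes {..<n} \<Longrightarrow> \<tau> permutes {..<n::nat} \<Longrightarrow> sign (\<sigma> \<circ> \<tau>) = sign \<sigma> * sign \<tau>"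
  by (intro sign_compose) (auto intro: permutes_imp_permutation[OF finite_lessThan])

lemma alt_sum_perm:
  assumes "\<tau> permutes {..<n}"
  shows "alt_sum n (\<lambda>v. G (\<lambda>i. v (\<tau> i))) v = of_int (sign \<tau>) * alt_sum n G v"
proof -
  have "alt_sum n G v = (\<Sum>\<sigma> | \<sigma> permutes {..<n}. of_int (sign (\<sigma> \<circ> \<tau>)) * G (\<lambda>i. v ((\<sigma> \<circ> \<tau>) i)))"
    unfolding alt_sum_def by (rule sum_permutations_compose_right[OF assms])
  also have "\<dots> = of_int (sign \<tau>) * alt_sum n (\<lambda>v. G (\<lambda>i. v (\<tau> i))) v"
    unfolding alt_sum_def sum_distrib_left
    by (rule sum.cong) (auto simp: sign_compose_lessThan[OF _ assms])
  finally show ?thesis by (simp add: of_int_sign_square)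
qed

lemma alt_sum_diff: "alt_sum n (\<lambda>v. F v - G v) v = alt_sum n F v - alt_sum n G v"
  by (simp add: alt_sum_def algebra_simps sum_subtractf)

text \<open>Embeds the permutations of the slots of the second wedge factor into those of all
  slots.\<close>

definition shift_perm :: "nat \<Rightarrow> (nat \<Rightarrow> nat) \<Rightarrow> nat \<Rightarrow> nat" where
  "shift_perm p \<tau> i = (if i < p then i else p + \<tau> (i - p))"

lemma shift_perm_eq_map:
  assumes "\<tau> permutes {..<q}"
  shows "shift_perm p \<tau> = map_permutation {..<q} ((+) p) \<tau>"
proof
  fix i
  show "shift_perm p \<tau> i = map_permutation {..<q} ((+) p) \<tau> i"
  proof (cases "i \<in> {p..<p+q}")
    case True
    then obtain j where j: "i = p + j" "j < q"
      by (metis atLeastLessThan_iff le_Suc_ex nat_add_left_cancel_less)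
    then show ?thesis
      using map_permutation_apply[of "(+) p" "{..<q}" j \<tau>] by (simp add: shift_perm_def)
  next
    case False
    have "(+) p ` {..<q} = {p..<p+q}"
      by (metis add.commute add_0 image_add_atLeastLessThan' lessThan_atLeast0 image_add_atLeastLessThan)
    moreover have "\<tau> (i - p) = i - p" if "p \<le> i"
      using assms False that by (intro permutes_not_in[OF assms]) auto
    ultimately show ?thesis using False
      by (auto simp: shift_perm_def map_permutation_def restrict_id_def)
  qed
qed

lemma shift_perm_permutes:
  assumes "\<tau> permutes {..<q}"
  shows "shift_perm p \<tau> permutes {..<p + q}" "sign (shift_perm p \<tau>) = sign \<tau>"
proof -
  have "bij_betw ((+) p) {..<q} {p..<p+q}"
    by (rule bij_betwI[where g = "\<lambda>i. i - p"]) auto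
  from map_permutation_permutes[OF this assms]
  show "shift_perm p \<tau> permutes {..<p + q}"
    unfolding shift_perm_eq_map[OF assms] by (rule permutes_subset) auto
  show "sign (shift_perm p \<tau>) = sign \<tau>"
    unfolding shift_perm_eq_map[OF assms] using assms by (intro sign_map_permutation) auto
qed

text \<open>An inner permutation extends by \<open>shift_perm\<close> to all slots without affecting
  \<alpha>, and reindexing absorbs it into the outer sum. The \<open>fact q\<close> inner terms
  therefore agree and cancel one factorial of the wedge product.\<close>

lemma wedge_alt_sum:
  assumes dep: "\<And>v w. (\<And>i. i < p \<Longrightarrow> v i = w i) \<Longrightarrow> \<alpha> v = \<alpha> w"
  shows "wedge p q \<alpha> (alt_sum q G) v = alt_sum (p + q) (\<lambda>v. \<alpha> v * G (\<lambda>i. v (p + i))) v / fact p"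
proof -
  let ?H = "\<lambda>v. \<alpha> v * G (\<lambda>i. v (p + i))"
  have "(\<Sum>\<sigma> | \<sigma> permutes {..<p + q}. of_int (sign \<sigma>) * \<alpha> (\<lambda>i. v (\<sigma> i))
        * alt_sum q G (\<lambda>i. v (\<sigma> (p + i))))
      = (\<Sum>\<sigma> | \<sigma> permutes {..<p + q}. \<Sum>\<tau> | \<tau> permutes {..<q}.
          of_int (sign \<tau>) * (of_int (sign \<sigma>) * (\<alpha> (\<lambda>i. v (\<sigma> i)) * G (\<lambda>i. v (\<sigma> (p + \<tau> i))))))"
  proof (rule sum.cong[OF refl])
    fix \<sigma>
    show "of_int (sign \<sigma>) * \<alpha> (\<lambda>i. v (\<sigma> i)) * alt_sum q G (\<lambda>i. v (\<sigma> (p + i))) =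
      (\<Sum>\<tau> | \<tau> permutes {..<q}. of_int (sign \<tau>) *
        (of_int (sign \<sigma>) * (\<alpha> (\<lambda>i. v (\<sigma> i)) * G (\<lambda>i. v (\<sigma> (p + \<tau> i))))))"
      unfolding alt_sum_def sum_distrib_left
      by (rule sum.cong[OF refl]) (simp add: mult.left_commute mult.assoc)
  qed
  also have "\<dots> = (\<Sum>\<tau> | \<tau> permutes {..<q}. \<Sum>\<sigma> | \<sigma> permutes {..<p + q}.
          of_int (sign \<tau>) * (of_int (sign \<sigma>) * (\<alpha> (\<lambda>i. v (\<sigma> i)) * G (\<lambda>i. v (\<sigma> (p + \<tau> i))))))"
    by (rule sum.swap)
  also have "\<dots> = (\<Sum>\<tau> | \<tau> permutes {..<q}. alt_sum (p + q) ?H v)"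
  proof (rule sum.cong[OF refl])
    fix \<tau> assume "\<tau> \<in> {\<tau>. \<tau> permutes {..<q}}"
    then have \<tau>: "\<tau> permutes {..<q}" by simp
    have "alt_sum (p + q) ?H v = of_int (sign \<tau>) * (of_int (sign \<tau>) * alt_sum (p + q) ?H v)"
      by (simp add: of_int_sign_square)
    also have "of_int (sign \<tau>) * alt_sum (p + q) ?H v =
        alt_sum (p + q) (\<lambda>v. ?H (\<lambda>i. v (shift_perm p \<tau> i))) v"
      using alt_sum_perm[OF shift_perm_permutes(1)[OF \<tau>], where G = ?H] shift_perm_permutes(2)[OF \<tau>] by simp
    also have "\<dots> = alt_sum (p + q) (\<lambda>v. \<alpha> v * G (\<lambda>i. v (p + \<tau> i))) v"
    proof -
      have "\<alpha> (\<lambda>i. w (shift_perm p \<tau> i)) = \<alpha> w" for w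
        by (rule dep) (simp add: shift_perm_def)
      then show ?thesis by (simp add: shift_perm_def)
    qed
    finally show "(\<Sum>\<sigma> | \<sigma> permutes {..<p + q}. of_int (sign \<tau>) *
        (of_int (sign \<sigma>) * (\<alpha> (\<lambda>i. v (\<sigma> i)) * G (\<lambda>i. v (\<sigma> (p + \<tau> i)))))) = alt_sum (p + q) ?H v"
      by (simp add: alt_sum_def sum_distrib_left)
  qed
  also have "\<dots> = fact q * alt_sum (p + q) ?H v"
    by (simp add: card_permutations[OF refl])
  finally show ?thesis by (simp add: wedge_def)
qed

text \<open>Exchanging the first two slots turns the subtracted term into the other one, and the
  resulting 2 cancels \<open>fact 2\<close> at each step. The iterated wedge becomes the
  antisymmetrisation of a single product.\<close>

lemma wedge_power_two_form:
  "wedge_power 2 (\<lambda>v. C (v 0) (v 1) - C (v 1) (v 0)) k =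
    alt_sum (2 * k) (\<lambda>v. \<Prod>j<k. C (v (2 * j)) (v (2 * j + 1)))"
proof (induction k)
  case 0
  have "{\<sigma>::nat \<Rightarrow> nat. \<sigma> permutes {}} = {id}" by auto
  then show ?case by (simp add: alt_sum_def fun_eq_iff)
next
  case (Suc k)
  let ?R = "\<lambda>v. \<Prod>j<k. C (v (2 * j)) (v (2 * j + 1))"
  let ?F = "\<lambda>v. C (v 0) (v 1) * ?R (\<lambda>i. v (2 + i))"
  show ?case
  proof
    fix v
    let ?\<tau> = "Transposition.transpose 0 (1::nat)"
    have \<tau>: "?\<tau> permutes {..<2 + 2 * k}" by (rule permutes_swap_id) auto
    have "alt_sum (2 + 2 * k) (\<lambda>v. C (v 1) (v 0) * ?R (\<lambda>i. v (2 + i))) v =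
        alt_sum (2 + 2 * k) (\<lambda>v. ?F (\<lambda>i. v (?\<tau> i))) v"
      by (simp add: transpose_def)
    also have "\<dots> = - alt_sum (2 + 2 * k) ?F v"
      using alt_sum_perm[OF \<tau>, where G = ?F and v = v] by (simp add: sign_swap_id)
    finally have *: "alt_sum (2 + 2 * k) (\<lambda>v. C (v 1) (v 0) * ?R (\<lambda>i. v (2 + i))) v =
      - alt_sum (2 + 2 * k) ?F v" .
    have "wedge_power 2 (\<lambda>v. C (v 0) (v 1) - C (v 1) (v 0)) (Suc k) v =
        alt_sum (2 + 2 * k) (\<lambda>v. (C (v 0) (v 1) - C (v 1) (v 0)) * ?R (\<lambda>i. v (2 + i))) v / fact 2"
      unfolding wedge_power.simps Suc by (rule wedge_alt_sum) simp
    also have "\<dots> = alt_sum (2 + 2 * k) ?F v"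
      unfolding left_diff_distrib alt_sum_diff * by simp
    also have "\<dots> = alt_sum (2 * Suc k) (\<lambda>v. \<Prod>j<Suc k. C (v (2 * j)) (v (2 * j + 1))) v"
      by (simp add: prod.lessThan_Suc_shift del: prod.lessThan_Suc)
    finally show "wedge_power 2 (\<lambda>v. C (v 0) (v 1) - C (v 1) (v 0)) (Suc k) v =
      alt_sum (2 * Suc k) (\<lambda>v. \<Prod>j<Suc k. C (v (2 * j)) (v (2 * j + 1))) v" .
  qed
qed

subsection \<open>Sums over block permutations\<close>

definition block_perm :: "nat \<Rightarrow> (nat \<Rightarrow> nat) \<Rightarrow> (nat \<Rightarrow> nat) \<Rightarrow> nat \<Rightarrow> nat" where
  "block_perm n \<pi> \<rho> = \<pi> \<circ> shift_perm n \<rho>"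

lemma block_perm_simps:
  assumes "\<pi> permutes {..<n}"
  shows "i < n \<Longrightarrow> block_perm n \<pi> \<rho> i = \<pi> i" "block_perm n \<pi> \<rho> (n + i) = n + \<rho> i"
proof -
  show "block_perm n \<pi> \<rho> i = \<pi> i" if "i < n" using that by (simp add: block_perm_def shift_perm_def)
  have "\<pi> (n + \<rho> i) = n + \<rho> i" by (rule permutes_not_in[OF assms]) simp
  then show "block_perm n \<pi> \<rho> (n + i) = n + \<rho> i" by (simp add: block_perm_def shift_perm_def)
qed

text \<open>A permutation that preserves the first block preserves the second one too and splits
  uniquely into a pair; \<open>zero\<close> removes all other terms.\<close>

lemma sum_block_perm:
  fixes g :: "(nat \<Rightarrow> nat) \<Rightarrow> complex"
  assumes zero: "\<And>\<sigma> i. \<sigma> permutes {..<n + n} \<Longrightarrow> i < n \<Longrightarrow> \<not> \<sigma> i < n \<Longrightarrow> g \<sigma> = 0"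
  shows "(\<Sum>\<sigma> | \<sigma> permutes {..<n + n}. of_int (sign \<sigma>) * g \<sigma>) =
    (\<Sum>\<pi> | \<pi> permutes {..<n}. \<Sum>\<rho> | \<rho> permutes {..<n}.
      of_int (sign \<pi>) * of_int (sign \<rho>) * g (block_perm n \<pi> \<rho>))"
proof -
  let ?S = "{\<sigma>. \<sigma> permutes {..<n}}"
  let ?B = "{\<sigma>. \<sigma> permutes {..<n + n} \<and> (\<forall>i<n. \<sigma> i < n)}"
  have perm: "\<pi> permutes {..<n + n}" if "\<pi> permutes {..<n}" for \<pi>
    using that by (rule permutes_subset) auto
  have bij: "bij_betw (\<lambda>(\<pi>, \<rho>). block_perm n \<pi> \<rho>) (?S \<times> ?S) ?B"
    unfolding bij_betw_def
  proof
    show "inj_on (\<lambda>(\<pi>, \<rho>). block_perm n \<pi> \<rho>) (?S \<times> ?S)"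
    proof (rule inj_onI, clarify)
      fix \<pi> \<rho> \<pi>' \<rho>'
      assume p: "\<pi> permutes {..<n}" "\<pi>' permutes {..<n}" "\<rho> permutes {..<n}" "\<rho>' permutes {..<n}"
        and eq: "block_perm n \<pi> \<rho> = block_perm n \<pi>' \<rho>'"
      have "\<pi> i = \<pi>' i" for i
        using fun_cong[OF eq, of i] block_perm_simps(1)[OF p(1), of i] block_perm_simps(1)[OF p(2), of i]
          permutes_not_in[OF p(1), of i] permutes_not_in[OF p(2), of i] by (cases "i < n") auto
      moreover have "\<rho> i = \<rho>' i" for i
        using fun_cong[OF eq, of "n + i"] block_perm_simps(2)[OF p(1)] block_perm_simps(2)[OF p(2)] by simp
      ultimately show "\<pi> = \<pi>' \<and> \<rho> = \<rho>'" by blast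
    qed
    show "(\<lambda>(\<pi>, \<rho>). block_perm n \<pi> \<rho>) ` (?S \<times> ?S) = ?B"
    proof (rule Set.set_eqI, rule iffI)
      fix \<sigma> assume "\<sigma> \<in> (\<lambda>(\<pi>, \<rho>). block_perm n \<pi> \<rho>) ` (?S \<times> ?S)"
      then obtain \<pi> \<rho> where p: "\<pi> permutes {..<n}" "\<rho> permutes {..<n}" and \<sigma>: "\<sigma> = block_perm n \<pi> \<rho>"
        by auto
      have "\<sigma> permutes {..<n + n}"
        unfolding \<sigma> block_perm_def by (intro permutes_compose shift_perm_permutes p perm)
      moreover have "\<sigma> i < n" if "i < n" for i
        using that permutes_in_image[OF p(1), of i] block_perm_simps(1)[OF p(1)] \<sigma> by auto
      ultimately show "\<sigma> \<in> ?B" by simp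
    next
      fix \<sigma> assume "\<sigma> \<in> ?B"
      then have \<sigma>: "\<sigma> permutes {..<n + n}" and im: "\<And>i. i < n \<Longrightarrow> \<sigma> i < n" by auto
      define \<pi> where "\<pi> i = (if i < n then \<sigma> i else i)" for i
      have inj: "inj_on \<sigma> {..<n}" using permutes_inj_on[OF \<sigma>] .
      have "bij_betw \<sigma> {..<n} {..<n}"
        unfolding bij_betw_def using inj im by (intro conjI endo_inj_surj) auto
      then have "bij_betw \<pi> {..<n} {..<n}"
        by (rule bij_betw_cong[THEN iffD1, rotated]) (simp add: \<pi>_def)
      then have \<pi>: "\<pi> permutes {..<n}" by (rule bij_imp_permutes) (simp add: \<pi>_def)
      \<comment> \<open>Undoing \<open>\<pi>\<close> leaves a permutation fixing the first block;
        transported to \<open>{..<n}\<close>, its action on the second block is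
        \<open>\<rho>\<close>.\<close>
      define \<sigma>' where "\<sigma>' = inv_into UNIV \<pi> \<circ> \<sigma>"
      have \<sigma>': "\<sigma>' permutes {..<n + n}"
        unfolding \<sigma>'_def by (intro permutes_compose \<sigma> permutes_inv perm \<pi>)
      have fixed: "\<sigma>' i = i" if "i < n" for i
      proof -
        have "\<sigma> i = \<pi> i" using that by (simp add: \<pi>_def)
        then show ?thesis unfolding \<sigma>'_def by (simp add: permutes_inverses(2)[OF \<pi>])
      qed
      have \<sigma>'2: "\<sigma>' permutes {n..<n + n}"
        by (rule permutes_superset[OF \<sigma>']) (auto simp: fixed)
      define \<rho> where "\<rho> = map_permutation {n..<n + n} (\<lambda>i. i - n) \<sigma>'"
      have b: "bij_betw (\<lambda>i. i - n) {n..<n + n} {..<n}"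
        by (rule bij_betwI[where g = "\<lambda>i. n + i"]) auto
      have \<rho>: "\<rho> permutes {..<n}"
        unfolding \<rho>_def by (rule map_permutation_permutes[OF b \<sigma>'2])
      have "shift_perm n \<rho> i = \<sigma>' i" for i
      proof (cases "i < n")
        case True
        then show ?thesis by (simp add: shift_perm_def fixed)
      next
        case False
        show ?thesis
        proof (cases "i < n + n")
          case True
          have "\<rho> (i - n) = \<sigma>' i - n"
            unfolding \<rho>_def by (rule map_permutation_apply) (use False True in \<open>auto simp: inj_on_def\<close>)
          moreover have "\<sigma>' i \<ge> n" using permutes_in_image[OF \<sigma>'2, of i] False True by auto
          ultimately show ?thesis using False by (simp add: shift_perm_def)
        next
          case F: False
          have "\<rho> (i - n) = i - n" by (rule permutes_not_in[OF \<rho>]) (use F in auto)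
          moreover have "\<sigma>' i = i" by (rule permutes_not_in[OF \<sigma>']) (use F in auto)
          ultimately show ?thesis using False by (simp add: shift_perm_def)
        qed
      qed
      then have "block_perm n \<pi> \<rho> = \<sigma>"
        unfolding block_perm_def \<sigma>'_def by (auto simp: fun_eq_iff permutes_inverses(1)[OF \<pi>])
      then show "\<sigma> \<in> (\<lambda>(\<pi>, \<rho>). block_perm n \<pi> \<rho>) ` (?S \<times> ?S)" using \<pi> \<rho> by force
    qed
  qed
  have "(\<Sum>\<sigma> | \<sigma> permutes {..<n + n}. of_int (sign \<sigma>) * g \<sigma>) = (\<Sum>\<sigma>\<in>?B. of_int (sign \<sigma>) * g \<sigma>)"
    proof (rule sum.mono_neutral_right)
    show "\<forall>\<sigma>\<in>{\<sigma>. \<sigma> permutes {..<n + n}} - ?B. of_int (sign \<sigma>) * g \<sigma> = 0"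
      using zero by fastforce
  qed (auto simp: finite_permutations)
  also have "\<dots> = (\<Sum>(\<pi>, \<rho>)\<in>?S \<times> ?S. of_int (sign (block_perm n \<pi> \<rho>)) * g (block_perm n \<pi> \<rho>))"
    using sum.reindex_bij_betw[OF bij, of "\<lambda>\<sigma>. of_int (sign \<sigma>) * g \<sigma>"] by (simp add: case_prod_unfold)
  also have "\<dots> = (\<Sum>(\<pi>, \<rho>)\<in>?S \<times> ?S. of_int (sign \<pi>) * of_int (sign \<rho>) * g (block_perm n \<pi> \<rho>))"
  proof (rule sum.cong[OF refl], clarify)
    fix \<pi> \<rho> assume "\<pi> permutes {..<n}" "\<rho> permutes {..<n}"
    then show "of_int (sign (block_perm n \<pi> \<rho>)) * g (block_perm n \<pi> \<rho>) =
        of_int (sign \<pi>) * of_int (sign \<rho>) * g (block_perm n \<pi> \<rho>)"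
      unfolding block_perm_def
      by (subst sign_compose_lessThan[where n = "n + n"]) (auto simp: perm shift_perm_permutes)
  qed
  finally show ?thesis by (simp add: sum.cartesian_product)
qed

subsection \<open>Alternating forms\<close>

locale alternating_form =
  fixes n :: nat and T :: "(complex^'m) set" and \<alpha> :: "(complex^'m) form"
  assumes alt: "complex_alternating_form n T \<alpha>"
    and T_zero: "0 \<in> T" and T_add: "\<And>a b. a \<in> T \<Longrightarrow> b \<in> T \<Longrightarrow> a + b \<in> T"
    and T_scale: "\<And>s a. a \<in> T \<Longrightarrow> s *s a \<in> T"
begin

lemmas alt_unfolded = alt[unfolded complex_alternating_form_def, THEN spec, THEN mp]

lemma dep:
  assumes "\<And>i. i < n \<Longrightarrow> v i \<in> T" "\<And>i. i < n \<Longrightarrow> v' i = v i"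
  shows "\<alpha> v' = \<alpha> v"
  by (rule alt_unfolded[THEN conjunct1, rule_format]) (use assms in auto)

lemma add:
  assumes "\<And>i. i < n \<Longrightarrow> v i \<in> T" "i < n" "a \<in> T" "b \<in> T"
  shows "\<alpha> (v(i := a + b)) = \<alpha> (v(i := a)) + \<alpha> (v(i := b))"
  by (rule alt_unfolded[THEN conjunct2, THEN conjunct1, rule_format]) (use assms in auto)

lemma scale:
  assumes "\<And>i. i < n \<Longrightarrow> v i \<in> T" "i < n" "a \<in> T"
  shows "\<alpha> (v(i := s *s a)) = s * \<alpha> (v(i := a))"
  by (rule alt_unfolded[THEN conjunct2, THEN conjunct2, THEN conjunct1, rule_format]) (use assms in auto)

lemma eq_zero:
  assumes "\<And>i. i < n \<Longrightarrow> v i \<in> T" "i < n" "j < n" "i \<noteq> j" "v i = v j"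
  shows "\<alpha> v = 0"
  by (rule alt_unfolded[THEN conjunct2, THEN conjunct2, THEN conjunct2, rule_format, of v i j]) (use assms in auto)

lemma zero: 
  assumes "\<And>i. i < n \<Longrightarrow> v i \<in> T" "i < n" "v i = 0"
  shows "\<alpha> v = 0"
proof -
  have "\<alpha> (v(i := 0 *s 0)) = 0 * \<alpha> (v(i := 0))" by (rule scale) (use assms T_zero in auto)
  moreover have "v(i := 0 *s 0) = v" using assms(3) by auto
  ultimately show ?thesis by simp
qed

lemma add_multiple:
  assumes v: "\<And>i. i < n \<Longrightarrow> v i \<in> T" and ij: "i < n" "j < n" "i \<noteq> j"
  shows "\<alpha> (v(i := v i + s *s v j)) = \<alpha> v"
proof -
  have "\<alpha> (v(i := v i + s *s v j)) = \<alpha> v + s * \<alpha> (v(i := v j))"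
  proof -
    have "\<alpha> (v(i := v i + s *s v j)) = \<alpha> (v(i := v i)) + \<alpha> (v(i := s *s v j))"
      by (rule add) (use v ij T_scale in auto)
    also have "\<alpha> (v(i := s *s v j)) = s * \<alpha> (v(i := v j))"
      by (rule scale) (use v ij in auto)
    finally show ?thesis by (simp only: fun_upd_triv)
  qed
  also have "\<alpha> (v(i := v j)) = 0"
    by (rule eq_zero[of _ i j]) (use v ij in auto)
  finally show ?thesis by (simp only: mult_zero_right add_0_right)
qed

text \<open>Expand the vanishing value with \<open>v a + v b\<close> in both slots: the two terms
  with equal arguments drop out.\<close>

lemma transpose:
  assumes v: "\<And>i. i < n \<Longrightarrow> v i \<in> T" and ab: "a < n" "b < n" "a \<noteq> b"
  shows "\<alpha> (\<lambda>i. v (Transposition.transpose a b i)) = - \<alpha> v"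
proof -
  let ?x = "v a" let ?y = "v b"
  have T: "?x \<in> T" "?y \<in> T" using v ab by auto
  have w: "\<And>i. i < n \<Longrightarrow> (v(a := p, b := q)) i \<in> T" if "p \<in> T" "q \<in> T" for p q using v that by auto
  have "0 = \<alpha> (v(a := ?x + ?y, b := ?x + ?y))"
    by (rule eq_zero[symmetric, of _ a b]) (use v T T_add ab in auto)
  also have "\<dots> = \<alpha> (v(a := ?x + ?y, b := ?x)) + \<alpha> (v(a := ?x + ?y, b := ?y))"
    by (rule add) (use v T T_add ab in auto)
  also have "\<alpha> (v(a := ?x + ?y, b := ?x)) = \<alpha> (v(b := ?x, a := ?x)) + \<alpha> (v(b := ?x, a := ?y))"
    using add[of "v(b := ?x)" a ?x ?y] v T ab by (simp add: fun_upd_twist)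
  also have "\<alpha> (v(a := ?x + ?y, b := ?y)) = \<alpha> (v(b := ?y, a := ?x)) + \<alpha> (v(b := ?y, a := ?y))"
    using add[of "v(b := ?y)" a ?x ?y] v T ab by (simp add: fun_upd_twist)
  also have "\<alpha> (v(b := ?x, a := ?x)) = 0"
    by (rule eq_zero[of _ a b]) (use v T ab in auto)
  also have "\<alpha> (v(b := ?y, a := ?y)) = 0"
    by (rule eq_zero[of _ a b]) (use v T ab in auto)
  also have "v(b := ?y, a := ?x) = v" by auto
  also have "v(b := ?x, a := ?y) = (\<lambda>i. v (Transposition.transpose a b i))"
    using ab by (auto simp: transpose_def)
  finally show ?thesis by (simp add: add_eq_0_iff)
qed

lemma perm:
  assumes "\<sigma> permutes {..<n}" and v: "\<And>i. i < n \<Longrightarrow> v i \<in> T"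
  shows "\<alpha> (\<lambda>i. v (\<sigma> i)) = of_int (sign \<sigma>) * \<alpha> v"
  using finite_lessThan assms(1)
proof (induction rule: permutes_rev_induct)
  case id
  then show ?case by simp
next
  case (swap a b p)
  have "\<alpha> (\<lambda>i. v (p (Transposition.transpose a b i))) = - \<alpha> (\<lambda>i. v (p i))"
    by (rule transpose[of "\<lambda>i. v (p i)"])
      (use swap.hyps permutes_in_image[OF \<open>p permutes {..<n}\<close>] v in auto)
  moreover have "sign (p \<circ> Transposition.transpose a b) = - sign p"
    using swap.hyps by (subst sign_compose_lessThan[where n = n])
      (auto intro: permutes_swap_id simp: sign_swap_id)
  ultimately show ?case using swap by (simp add: comp_def)
qed

end

subsection \<open>Polarisation\<close>

text \<open>A pair \<open>(a, b)\<close> stands for the complexified tangent vector whose component of type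
  \<open>(1, 0)\<close> is that of \<open>a\<close> and whose component of type \<open>(0, 1)\<close> is that of \<open>b\<close>; the real tangent
  vectors are the diagonal pairs.\<close>

definition pair_multilinear ::
  "nat \<Rightarrow> (complex^'m) set \<Rightarrow> ((nat \<Rightarrow> (complex^'m) \<times> (complex^'m)) \<Rightarrow> complex) \<Rightarrow> bool" where
  "pair_multilinear n T A \<longleftrightarrow>
     (\<forall>x i a b. (\<forall>k<n. x k \<in> T \<times> T) \<and> i < n \<and> a \<in> T \<times> T \<and> b \<in> T \<times> T \<longrightarrow>
        A (x(i := a + b)) = A (x(i := a)) + A (x(i := b))) \<and>
     (\<forall>x i a b s. (\<forall>k<n. x k \<in> T \<times> T) \<and> i < n \<and> a \<in> T \<and> b \<in> T \<longrightarrow>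
        A (x(i := (s *s a, cnj s *s b))) = s * A (x(i := (a, b))))"

lemma pair_multilinear_add:
  assumes "pair_multilinear n T A" "\<And>i. i < n \<Longrightarrow> x i \<in> T \<times> T" "i < n" "a \<in> T \<times> T" "b \<in> T \<times> T"
  shows "A (x(i := a + b)) = A (x(i := a)) + A (x(i := b))"
  by (rule assms(1)[unfolded pair_multilinear_def, THEN conjunct1, rule_format]) (use assms in auto)

lemma pair_multilinear_scale:
  assumes "pair_multilinear n T A" "\<And>i. i < n \<Longrightarrow> x i \<in> T \<times> T" "i < n" "a \<in> T" "b \<in> T"
  shows "A (x(i := (s *s a, cnj s *s b))) = s * A (x(i := (a, b)))"
  by (rule assms(1)[unfolded pair_multilinear_def, THEN conjunct2, rule_format]) (use assms in auto)

text \<open>Every pair is a complex combination of diagonal pairs, so identities known for real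
  tangent vectors extend to their complexification.\<close>

lemma pair_multilinear_eqI:
  assumes A: "pair_multilinear n T A" and B: "pair_multilinear n T B"
    and T_add: "\<And>a b. a \<in> T \<Longrightarrow> b \<in> T \<Longrightarrow> a + b \<in> T" and T_scale: "\<And>s a. a \<in> T \<Longrightarrow> s *s a \<in> T"
    and diag: "\<And>v. (\<And>i. i < n \<Longrightarrow> v i \<in> T) \<Longrightarrow> A (\<lambda>i. (v i, v i)) = B (\<lambda>i. (v i, v i))"
    and x: "\<And>i. i < n \<Longrightarrow> x i \<in> T \<times> T" "\<And>i. i \<ge> n \<Longrightarrow> fst (x i) = snd (x i)"
  shows "A x = B x"
proof -
  \<comment> \<open>Induction on the number \<open>m\<close> of leading slots that may be off the
    diagonal.\<close>
  have "m \<le> n \<Longrightarrow> (\<And>i. i < n \<Longrightarrow> x i \<in> T \<times> T) \<Longrightarrow> (\<And>i. i \<ge> m \<Longrightarrow> fst (x i) = snd (x i)) \<Longrightarrow> A x = B x" for m x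
  proof (induction m arbitrary: x)
    case 0
    have "x = (\<lambda>i. (fst (x i), fst (x i)))" using 0(3) by (simp add: prod_eq_iff fun_eq_iff)
    moreover have "fst (x i) \<in> T" if "i < n" for i using 0(2)[OF that] by auto
    ultimately show ?case using diag[of "\<lambda>i. fst (x i)"] by simp
  next
    case (Suc m)
    obtain a b where ab: "x m = (a, b)" by fastforce
    have "a \<in> T" "b \<in> T" using Suc.prems(1) Suc.prems(2)[of m] ab by auto
    \<comment> \<open>Chosen so that \<open>(a, b) = (d, d) - \<i> (c, c)\<close>: the scalar
      \<open>- \<i>\<close> acts on the second component by its conjugate \<open>\<i>\<close>, which
      produces the opposite sign there.\<close>
    let ?d = "(1/2) *s (a + b)" and ?c = "(\<i>/2) *s (a + (-1) *s b)"
    have d: "?d \<in> T" and c: "?c \<in> T"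
      using \<open>a \<in> T\<close> \<open>b \<in> T\<close> by (blast intro: T_add T_scale)+
    have x: "x = x(m := (?d, ?d) + ((- \<i>) *s ?c, cnj (- \<i>) *s ?c))"
      using ab by (auto simp: cart_eq_iff field_simps)
    have "F (x(m := (?d, ?d) + ((- \<i>) *s ?c, cnj (- \<i>) *s ?c)))
        = F (x(m := (?d, ?d))) - \<i> * F (x(m := (?c, ?c)))" if F: "pair_multilinear n T F" for F
    proof -
      have mn: "m < n" using Suc.prems(1) by simp
      have "((- \<i>) *s ?c, cnj (- \<i>) *s ?c) \<in> T \<times> T" using T_scale[OF c] by blast
      from pair_multilinear_add[OF F _ mn _ this, of x "(?d, ?d)"] Suc.prems(2) d
      have "F (x(m := (?d, ?d) + ((- \<i>) *s ?c, cnj (- \<i>) *s ?c)))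
        = F (x(m := (?d, ?d))) + F (x(m := ((- \<i>) *s ?c, cnj (- \<i>) *s ?c)))" by blast
      also have "F (x(m := ((- \<i>) *s ?c, cnj (- \<i>) *s ?c))) = (- \<i>) * F (x(m := (?c, ?c)))"
        by (rule pair_multilinear_scale[OF F _ mn c c]) (use Suc.prems(2) in blast)
      finally show ?thesis by (simp only: mult_minus_left add_uminus_conv_diff)
    qed
    note F = this[OF A] this[OF B]
    have IH: "A (x(m := (e, e))) = B (x(m := (e, e)))" if "e \<in> T" for e
    proof (rule Suc.IH)
      show "m \<le> n" using Suc.prems(1) by simp
      show "(x(m := (e, e))) i \<in> T \<times> T" if "i < n" for i
        using that \<open>e \<in> T\<close> Suc.prems(2)[of i] by (cases "i = m") simp_all
      show "fst ((x(m := (e, e))) i) = snd ((x(m := (e, e))) i)" if "i \<ge> m" for i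
        using that Suc.prems(3)[of i] by (cases "i = m") simp_all
    qed
    have "A x = A (x(m := (?d, ?d) + ((- \<i>) *s ?c, cnj (- \<i>) *s ?c)))" using x by (rule arg_cong)
    also have "\<dots> = B (x(m := (?d, ?d) + ((- \<i>) *s ?c, cnj (- \<i>) *s ?c)))"
      by (simp only: F IH[OF c] IH[OF d])
    also have "\<dots> = B x" using x[symmetric] by (rule arg_cong)
    finally show ?case .
  qed
  from this[of n x] x show ?thesis by simp
qed

lemma pair_multilinear_alt_sum:
  assumes G: "pair_multilinear n T G"
  shows "pair_multilinear n T (alt_sum n G)"
proof -
  have upd: "(\<lambda>k. (x(i := t)) (\<sigma> k)) = (\<lambda>k. x (\<sigma> k))(inv_into UNIV \<sigma> i := t)" if "\<sigma> permutes {..<n}" for \<sigma> t i x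
    using permutes_inverses[OF that] by (auto simp: fun_eq_iff)
  have G1: "G (\<lambda>k. (x(i := a + b)) (\<sigma> k)) = G (\<lambda>k. (x(i := a)) (\<sigma> k)) + G (\<lambda>k. (x(i := b)) (\<sigma> k))"
    if "\<sigma> permutes {..<n}" "\<forall>k<n. x k \<in> T \<times> T" "i < n" "a \<in> T \<times> T" "b \<in> T \<times> T" for \<sigma> x i a b
  proof -
    have "inv_into UNIV \<sigma> i < n" using permutes_in_image[OF permutes_inv[OF that(1)], of i] that by simp
    then show ?thesis unfolding upd[OF that(1)]
      by (intro pair_multilinear_add[OF G]) (use that permutes_in_image[OF that(1)] in auto)
  qed
  have G2: "G (\<lambda>k. (x(i := (s *s a, cnj s *s b))) (\<sigma> k)) = s * G (\<lambda>k. (x(i := (a, b))) (\<sigma> k))"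
    if "\<sigma> permutes {..<n}" "\<forall>k<n. x k \<in> T \<times> T" "i < n" "a \<in> T" "b \<in> T" for \<sigma> x i a b s
  proof -
    have "inv_into UNIV \<sigma> i < n" using permutes_in_image[OF permutes_inv[OF that(1)], of i] that by simp
    then show ?thesis unfolding upd[OF that(1)]
      by (intro pair_multilinear_scale[OF G]) (use that permutes_in_image[OF that(1)] in auto)
  qed
  show ?thesis
    unfolding pair_multilinear_def
  proof (intro conjI allI impI)
    fix x i a b assume "(\<forall>k<n. x k \<in> T \<times> T) \<and> i < n \<and> a \<in> T \<times> T \<and> b \<in> T \<times> T"
    then have *: "\<forall>k<n. x k \<in> T \<times> T" "i < n" "a \<in> T \<times> T" "b \<in> T \<times> T" by blast+
    show "alt_sum n G (x(i := a + b)) = alt_sum n G (x(i := a)) + alt_sum n G (x(i := b))"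
      unfolding alt_sum_def sum.distrib[symmetric]
      by (rule sum.cong[OF refl]) (simp only: mem_Collect_eq G1[OF _ *] distrib_left)
  next
    fix x i a b s assume "(\<forall>k<n. x k \<in> T \<times> T) \<and> i < n \<and> a \<in> T \<and> b \<in> T"
    then have *: "\<forall>k<n. x k \<in> T \<times> T" "i < n" "a \<in> T" "b \<in> T" by blast+
    show "alt_sum n G (x(i := (s *s a, cnj s *s b))) = s * alt_sum n G (x(i := (a, b)))"
      unfolding alt_sum_def sum_distrib_left
      by (rule sum.cong[OF refl]) (simp only: mem_Collect_eq G2[OF _ *] mult.left_commute)
  qed
qed

subsection \<open>The top power of a 2-form of type (1,1)\<close>

lemma pair_multilinear_cmult:
  assumes "pair_multilinear n T A"
  shows "pair_multilinear n T (\<lambda>x. c * A x)"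
  unfolding pair_multilinear_def
proof (intro conjI allI impI)
  fix x i a b
  assume "(\<forall>k<n. x k \<in> T \<times> T) \<and> i < n \<and> a \<in> T \<times> T \<and> b \<in> T \<times> T"
  then have *: "\<And>k. k < n \<Longrightarrow> x k \<in> T \<times> T" "i < n" "a \<in> T \<times> T" "b \<in> T \<times> T" by blast+
  show "c * A (x(i := a + b)) = c * A (x(i := a)) + c * A (x(i := b))"
    by (simp only: pair_multilinear_add[OF assms *(1) *(2-4)] distrib_left)
next
  fix x i a b s
  assume "(\<forall>k<n. x k \<in> T \<times> T) \<and> i < n \<and> a \<in> T \<and> b \<in> T"
  then have *: "\<And>k. k < n \<Longrightarrow> x k \<in> T \<times> T" "i < n" "a \<in> T" "b \<in> T" by blast+
  show "c * A (x(i := (s *s a, cnj s *s b))) = s * (c * A (x(i := (a, b))))"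
    by (simp only: pair_multilinear_scale[OF assms *(1) *(2-4)] mult.left_commute)
qed

text \<open>In the Leibniz formula the sign caused by permuting the rows cancels
  \<open>sign \<pi>\<close>, so each \<open>\<pi>\<close> contributes the same determinant.\<close>

lemma double_alt_sum:
  fixes H :: "nat \<Rightarrow> nat \<Rightarrow> complex"
  shows "(\<Sum>\<pi> | \<pi> permutes {..<n}. \<Sum>\<rho> | \<rho> permutes {..<n}.
      of_int (sign \<pi>) * of_int (sign \<rho>) * (\<Prod>j<n. H (\<pi> j) (\<rho> j))) =
    fact n * (\<Sum>\<rho> | \<rho> permutes {..<n}. of_int (sign \<rho>) * (\<Prod>j<n. H j (\<rho> j)))"
    (is "_ = fact n * ?D")
proof -
  have "(\<Sum>\<rho> | \<rho> permutes {..<n}. of_int (sign \<pi>) * of_int (sign \<rho>) * (\<Prod>j<n. H (\<pi> j) (\<rho> j))) = ?D"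
    if \<pi>: "\<pi> permutes {..<n}" for \<pi>
  proof -
    have "(\<Prod>j<n. H (\<pi> j) (v j)) = (\<Prod>j<n. H j (v (inv_into UNIV \<pi> j)))" for v :: "nat \<Rightarrow> nat"
      using prod.permute[OF \<pi>, of "\<lambda>j. H j (v (inv_into UNIV \<pi> j))"] by (simp add: permutes_inverses(2)[OF \<pi>])
    then have "alt_sum n (\<lambda>v. \<Prod>j<n. H (\<pi> j) (v j)) (\<lambda>i. i) = of_int (sign \<pi>) * ?D"
      using alt_sum_perm[OF permutes_inv[OF \<pi>], of "\<lambda>v. \<Prod>j<n. H j (v j)" "\<lambda>i. i"]
        sign_inverse[OF permutes_imp_permutation[OF finite_lessThan \<pi>]]
      by (simp add: alt_sum_def)
    moreover have "(\<Sum>\<rho> | \<rho> permutes {..<n}. of_int (sign \<pi>) * of_int (sign \<rho>) * (\<Prod>j<n. H (\<pi> j) (\<rho> j))) =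
        of_int (sign \<pi>) * alt_sum n (\<lambda>v. \<Prod>j<n. H (\<pi> j) (v j)) (\<lambda>i. i)"
      by (simp add: alt_sum_def sum_distrib_left mult.assoc)
    ultimately show ?thesis by (simp add: of_int_sign_square)
  qed
  then show ?thesis by (simp add: card_permutations[OF refl])
qed

locale type_11_form = alternating_form 5 T \<alpha>
  for T :: "(complex^'m) set" and \<alpha> :: "(complex^'m) form" +
  fixes h :: "complex^'m \<Rightarrow> complex^'m \<Rightarrow> complex"
  assumes h_add: "\<And>a b c. h (a + b) c = h a c + h b c" "\<And>a b c. h a (b + c) = h a b + h a c"
    and h_scale: "\<And>s a b. h (s *s a) b = s * h a b" "\<And>s a b. h a (s *s b) = cnj s * h a b"
begin

lemma h_zero: "h 0 b = 0" "h a 0 = 0"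
  using h_scale(1)[of 0 0 b] h_scale(2)[of a 0 0] by simp_all

text \<open>The summand of the fifth power of the (1,1)-form: components of type (1,0) are taken
  from even slots, those of type (0,1) from odd slots.\<close>

definition prod_h :: "(nat \<Rightarrow> (complex^'m) \<times> (complex^'m)) \<Rightarrow> complex" where
  "prod_h x = (\<Prod>j<5. \<i> * h (fst (x (2 * j))) (snd (x (2 * j + 1))))"

definition prod_\<alpha> :: "(nat \<Rightarrow> (complex^'m) \<times> (complex^'m)) \<Rightarrow> complex" where
  "prod_\<alpha> x = \<alpha> (\<lambda>i. fst (x i)) * cnj (\<alpha> (\<lambda>i. snd (x (5 + i))))"

lemma pair_multilinear_prod_h: "pair_multilinear (5 + 5) T prod_h"
proof -
  define F :: "(nat \<Rightarrow> (complex^'m) \<times> (complex^'m)) \<Rightarrow> nat \<Rightarrow> complex" where "F x j = \<i> * h (fst (x (2 * j))) (snd (x (2 * j + 1)))" for x j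
  have split: "prod_h (x(i := t)) = F (x(i := t)) (i div 2) * (\<Prod>j\<in>{..<5} - {i div 2}. F x j)"
    if "i < 5 + 5" for x :: "nat \<Rightarrow> (complex^'m) \<times> (complex^'m)" and i t
  proof -
    have "prod_h (x(i := t)) = F (x(i := t)) (i div 2) * (\<Prod>j\<in>{..<5} - {i div 2}. F (x(i := t)) j)"
      unfolding prod_h_def F_def by (rule prod.remove) (use that in auto)
    moreover have "F (x(i := t)) j = F x j" if "j \<noteq> i div 2" for j
      using that by (auto simp: F_def)
    ultimately show ?thesis by simp
  qed
  have par: "i = 2 * (i div 2) \<or> i = 2 * (i div 2) + 1" for i :: nat by presburger
  have add: "F (x(i := a + b)) (i div 2) = F (x(i := a)) (i div 2) + F (x(i := b)) (i div 2)" for x :: "nat \<Rightarrow> (complex^'m) \<times> (complex^'m)" and i a b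
    using par[of i] by (elim disjE; simp add: F_def h_add algebra_simps fun_upd_def)
  have scale: "F (x(i := (s *s a, cnj s *s b))) (i div 2) = s * F (x(i := (a, b))) (i div 2)" for x :: "nat \<Rightarrow> (complex^'m) \<times> (complex^'m)" and i a b s
    using par[of i] by (elim disjE; simp add: F_def h_scale algebra_simps fun_upd_def)
  show ?thesis unfolding pair_multilinear_def
  proof (intro conjI allI impI)
    fix x :: "nat \<Rightarrow> (complex^'m) \<times> (complex^'m)" and i :: nat and a b
    assume "(\<forall>k<5 + 5. x k \<in> T \<times> T) \<and> i < 5 + 5 \<and> a \<in> T \<times> T \<and> b \<in> T \<times> T"
    then have i: "i < 5 + 5" by blast
    show "prod_h (x(i := a + b)) = prod_h (x(i := a)) + prod_h (x(i := b))"
      unfolding split[OF i] add distrib_right ..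
  next
    fix x :: "nat \<Rightarrow> (complex^'m) \<times> (complex^'m)" and i :: nat and a b s
    assume "(\<forall>k<5 + 5. x k \<in> T \<times> T) \<and> i < 5 + 5 \<and> a \<in> T \<and> b \<in> T"
    then have i: "i < 5 + 5" by blast
    show "prod_h (x(i := (s *s a, cnj s *s b))) = s * prod_h (x(i := (a, b)))"
      unfolding split[OF i] scale mult.assoc ..
  qed
qed

lemma pair_multilinear_prod_\<alpha>: "pair_multilinear (5 + 5) T prod_\<alpha>"
proof -
  have low: "prod_\<alpha> (x(i := t)) = \<alpha> ((\<lambda>k. fst (x k))(i := fst t)) * cnj (\<alpha> (\<lambda>k. snd (x (5 + k))))"
    if "i < 5" for x :: "nat \<Rightarrow> (complex^'m) \<times> (complex^'m)" and i t
  proof -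
    have "(\<lambda>k. fst ((x(i := t)) k)) = (\<lambda>k. fst (x k))(i := fst t)" by auto
    moreover have "(\<lambda>k. snd ((x(i := t)) (5 + k))) = (\<lambda>k. snd (x (5 + k)))" using that by auto
    ultimately show ?thesis by (simp only: prod_\<alpha>_def)
  qed
  have high: "prod_\<alpha> (x(i := t)) = \<alpha> (\<lambda>k. fst (x k)) * cnj (\<alpha> ((\<lambda>k. snd (x (5 + k)))(i - 5 := snd t)))"
    if "\<not> i < 5" "\<forall>k<5 + 5. x k \<in> T \<times> T" for x :: "nat \<Rightarrow> (complex^'m) \<times> (complex^'m)" and i t
  proof -
    have "\<alpha> (\<lambda>k. fst ((x(i := t)) k)) = \<alpha> (\<lambda>k. fst (x k))"
      by (rule dep) (use that in \<open>auto simp: mem_Times_iff\<close>)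
    moreover have "(\<lambda>k. snd ((x(i := t)) (5 + k))) = (\<lambda>k. snd (x (5 + k)))(i - 5 := snd t)"
      using that(1) by (auto simp: fun_eq_iff)
    ultimately show ?thesis by (simp only: prod_\<alpha>_def)
  qed
  show ?thesis unfolding pair_multilinear_def
  proof (intro conjI allI impI)
    fix x :: "nat \<Rightarrow> (complex^'m) \<times> (complex^'m)" and i :: nat and a b
    assume "(\<forall>k<5 + 5. x k \<in> T \<times> T) \<and> i < 5 + 5 \<and> a \<in> T \<times> T \<and> b \<in> T \<times> T"
    then have *: "\<forall>k<5 + 5. x k \<in> T \<times> T" "i < 5 + 5" "fst a \<in> T" "snd a \<in> T" "fst b \<in> T" "snd b \<in> T" by auto
    show "prod_\<alpha> (x(i := a + b)) = prod_\<alpha> (x(i := a)) + prod_\<alpha> (x(i := b))"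
    proof (cases "i < 5")
      case True
      have "\<alpha> ((\<lambda>k. fst (x k))(i := fst a + fst b)) =
          \<alpha> ((\<lambda>k. fst (x k))(i := fst a)) + \<alpha> ((\<lambda>k. fst (x k))(i := fst b))"
        by (rule add) (use * True in \<open>auto simp: mem_Times_iff\<close>)
      then show ?thesis by (simp only: low[OF True] fst_add distrib_right)
    next
      case False
      have "\<alpha> ((\<lambda>k. snd (x (5 + k)))(i - 5 := snd a + snd b)) =
          \<alpha> ((\<lambda>k. snd (x (5 + k)))(i - 5 := snd a)) + \<alpha> ((\<lambda>k. snd (x (5 + k)))(i - 5 := snd b))"
        by (rule add) (use * False in \<open>auto simp: mem_Times_iff\<close>)
      then show ?thesis by (simp only: high[OF False *(1)] snd_add distrib_left complex_cnj_add)
    qed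
  next
    fix x :: "nat \<Rightarrow> (complex^'m) \<times> (complex^'m)" and i :: nat and a b s
    assume "(\<forall>k<5 + 5. x k \<in> T \<times> T) \<and> i < 5 + 5 \<and> a \<in> T \<and> b \<in> T"
    then have *: "\<forall>k<5 + 5. x k \<in> T \<times> T" "i < 5 + 5" "a \<in> T" "b \<in> T" by auto
    show "prod_\<alpha> (x(i := (s *s a, cnj s *s b))) = s * prod_\<alpha> (x(i := (a, b)))"
    proof (cases "i < 5")
      case True
      have "\<alpha> ((\<lambda>k. fst (x k))(i := s *s a)) = s * \<alpha> ((\<lambda>k. fst (x k))(i := a))"
        by (rule scale) (use * True in \<open>auto simp: mem_Times_iff\<close>)
      then show ?thesis by (simp only: low[OF True] fst_conv mult.assoc)
    next
      case False
      have "\<alpha> ((\<lambda>k. snd (x (5 + k)))(i - 5 := cnj s *s b)) = cnj s * \<alpha> ((\<lambda>k. snd (x (5 + k)))(i - 5 := b))"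
        by (rule scale) (use * False in \<open>auto simp: mem_Times_iff\<close>)
      then show ?thesis
        by (simp only: high[OF False *(1)] snd_conv complex_cnj_mult complex_cnj_cnj mult.left_commute)
    qed
  qed
qed

text \<open>After polarisation the identity is evaluated on five vectors of type (1,0) and their
  five conjugates. The power of the 2-form becomes the determinant of the Hermitian Gram matrix, the
  other side the squared modulus; 32 is the denominator of \<open>(\<i> / 2) ^ 5\<close>.\<close>

theorem norm_square_eq_det:
  assumes wedge_eq: "\<And>v. (\<And>i. i < 10 \<Longrightarrow> v i \<in> T) \<Longrightarrow>
      wedge_power 2 (\<lambda>v. \<i> * (h (v 0) (v 1) - h (v 1) (v 0))) 5 v / fact 5
        = (- 1) ^ (5 * (5 - 1) div 2) * (\<i> / 2) ^ 5 * wedge 5 5 \<alpha> (\<lambda>v. cnj (\<alpha> v)) v"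
    and f: "\<And>i. i < 5 \<Longrightarrow> f i \<in> T"
  shows "\<alpha> f * cnj (\<alpha> f) =
    32 * (\<Sum>\<rho> | \<rho> permutes {..<5}. of_int (sign \<rho>) * (\<Prod>j<5. h (f j) (f (\<rho> j))))"
    (is "_ = 32 * ?D")
proof -
  \<comment> \<open>The (1,0)-parts of \<open>f\<close>, then its (0,1)-parts. The zero pairs beyond
    slot 9 are diagonal, as \<open>pair_multilinear_eqI\<close> demands.\<close>
  let ?x = "\<lambda>i. if i < 5 then (f i, 0) else if i < 10 then (0, f (i - 5)) else (0, 0)"
  let ?A = "\<lambda>x. alt_sum (5 + 5) prod_h x"
  let ?B = "\<lambda>x. (\<i> / 2) ^ 5 / fact 5 * alt_sum (5 + 5) prod_\<alpha> x"
  have "?A ?x = ?B ?x"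
  proof (rule pair_multilinear_eqI[where n = "5 + 5"])
    show "pair_multilinear (5 + 5) T ?A" by (rule pair_multilinear_alt_sum[OF pair_multilinear_prod_h])
    show "pair_multilinear (5 + 5) T ?B"
      by (rule pair_multilinear_cmult[OF pair_multilinear_alt_sum[OF pair_multilinear_prod_\<alpha>]])
    show "?A (\<lambda>i. (v i, v i)) = ?B (\<lambda>i. (v i, v i))" if v: "\<And>i. i < 5 + 5 \<Longrightarrow> v i \<in> T" for v
    proof -
      have "wedge_power 2 (\<lambda>v. \<i> * (h (v 0) (v 1) - h (v 1) (v 0))) 5 v = ?A (\<lambda>i. (v i, v i))"
        using wedge_power_two_form[of "\<lambda>a b. \<i> * h a b" 5]
        by (simp add: alt_sum_def prod_h_def right_diff_distrib)
      moreover have "wedge 5 5 \<alpha> (\<lambda>v. cnj (\<alpha> v)) v =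
          alt_sum (5 + 5) prod_\<alpha> (\<lambda>i. (v i, v i)) / (fact 5 * fact 5)"
        by (simp add: wedge_def alt_sum_def prod_\<alpha>_def mult.assoc)
      ultimately show ?thesis using wedge_eq[of v] v by (simp add: field_simps)
    qed
    show "?x i \<in> T \<times> T" if "i < 5 + 5" for i using that f T_zero by auto
  qed (use T_add T_scale in auto)
  moreover have "?A ?x = \<i> ^ 5 * (fact 5 * ?D)"
  proof -
    let ?t = "Transposition.transpose :: nat \<Rightarrow> nat \<Rightarrow> nat \<Rightarrow> nat"
    \<comment> \<open>Sends \<open>j\<close> to \<open>2 * j\<close> and \<open>5 + j\<close> to
      \<open>2 * j + 1\<close>, which separates the interleaved types. It is a 6-cycle times a
      transposition, hence even.\<close>
    define \<tau> where "\<tau> = ?t 1 2 \<circ> (?t 2 4 \<circ> (?t 4 8 \<circ> (?t 8 7 \<circ> (?t 7 5 \<circ> ?t 3 6))))"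
    have tp: "?t a b permutes {..<5 + 5}" if "a < 10" "b < 10" for a b
      by (rule permutes_swap_id) (use that in auto)
    have \<tau>: "\<tau> permutes {..<5 + 5}" "sign \<tau> = 1"
      unfolding \<tau>_def
      by (intro permutes_compose tp; simp)
        (simp add: sign_compose permutation_compose permutation_swap_id sign_swap_id)
    let ?G = "\<lambda>w. \<Prod>j<5. \<i> * h (fst (w j)) (snd (w (5 + j)))"
    have "prod_h v = ?G (\<lambda>i. v (\<tau> i))" for v
      by (simp add: prod_h_def \<tau>_def transpose_def eval_nat_numeral lessThan_Suc)
    then have "?A ?x = alt_sum (5 + 5) ?G ?x"
      using alt_sum_perm[OF \<tau>(1), of ?G ?x] \<tau>(2) by (simp add: prod_h_def[abs_def])
    also have "\<dots> = (\<Sum>\<pi> | \<pi> permutes {..<5}. \<Sum>\<rho> | \<rho> permutes {..<5}.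
        of_int (sign \<pi>) * of_int (sign \<rho>) * ?G (\<lambda>i. ?x (block_perm 5 \<pi> \<rho> i)))"
      unfolding alt_sum_def
    proof (rule sum_block_perm)
      fix \<sigma> :: "nat \<Rightarrow> nat" and i assume "i < 5" "\<not> \<sigma> i < 5"
      then show "?G (\<lambda>i. ?x (\<sigma> i)) = 0"
        by (intro prod_zero) (auto intro!: bexI[of _ i] simp: h_zero)
    qed
    also have "\<dots> = (\<Sum>\<pi> | \<pi> permutes {..<5}. \<Sum>\<rho> | \<rho> permutes {..<5}.
        \<i> ^ 5 * (of_int (sign \<pi>) * of_int (sign \<rho>) * (\<Prod>j<5. h (f (\<pi> j)) (f (\<rho> j)))))"
    proof (intro sum.cong refl)
      fix \<pi> \<rho> assume "\<pi> \<in> {\<pi>. \<pi> permutes {..<5::nat}}" "\<rho> \<in> {\<rho>. \<rho> permutes {..<5::nat}}"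
      then have p: "\<pi> permutes {..<5}" "\<rho> permutes {..<5}" by auto
      have "?G (\<lambda>i. ?x (block_perm 5 \<pi> \<rho> i)) = (\<Prod>j<5. \<i> * h (f (\<pi> j)) (f (\<rho> j)))"
        by (rule prod.cong[OF refl])
          (use permutes_in_image[OF p(1)] permutes_in_image[OF p(2)] in \<open>simp add: block_perm_simps[OF p(1)]\<close>)
      then show "of_int (sign \<pi>) * of_int (sign \<rho>) * ?G (\<lambda>i. ?x (block_perm 5 \<pi> \<rho> i)) =
          \<i> ^ 5 * (of_int (sign \<pi>) * of_int (sign \<rho>) * (\<Prod>j<5. h (f (\<pi> j)) (f (\<rho> j))))"
        by (simp add: prod.distrib)
    qed
    also have "\<dots> = \<i> ^ 5 * (fact 5 * ?D)"
      using double_alt_sum[where H = "\<lambda>i j. h (f i) (f j)" and n = 5] by (simp only: sum_distrib_left[symmetric])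
    finally show ?thesis .
  qed
  moreover have "alt_sum (5 + 5) prod_\<alpha> ?x = fact 5 * fact 5 * (\<alpha> f * cnj (\<alpha> f))"
  proof -
    have "alt_sum (5 + 5) prod_\<alpha> ?x = (\<Sum>\<pi> | \<pi> permutes {..<5}. \<Sum>\<rho> | \<rho> permutes {..<5}.
        of_int (sign \<pi>) * of_int (sign \<rho>) * prod_\<alpha> (\<lambda>i. ?x (block_perm 5 \<pi> \<rho> i)))"
      unfolding alt_sum_def
    proof (rule sum_block_perm)
      fix \<sigma> :: "nat \<Rightarrow> nat" and i assume i: "i < 5" "\<not> \<sigma> i < 5"
      have "\<alpha> (\<lambda>i. fst (?x (\<sigma> i))) = 0"
        by (rule zero[of _ i]) (use i f T_zero in auto)
      then show "prod_\<alpha> (\<lambda>i. ?x (\<sigma> i)) = 0" by (simp only: prod_\<alpha>_def mult_zero_left)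
    qed
    also have "\<dots> = (\<Sum>\<pi> | \<pi> permutes {..<5::nat}. \<Sum>\<rho> | \<rho> permutes {..<5::nat}. \<alpha> f * cnj (\<alpha> f))"
    proof (intro sum.cong refl)
      fix \<pi> \<rho> assume "\<pi> \<in> {\<pi>. \<pi> permutes {..<5::nat}}" "\<rho> \<in> {\<rho>. \<rho> permutes {..<5::nat}}"
      then have p: "\<pi> permutes {..<5}" "\<rho> permutes {..<5}" by auto
      have "\<alpha> (\<lambda>i. fst (?x (block_perm 5 \<pi> \<rho> i))) = \<alpha> (\<lambda>i. f (\<pi> i))"
        by (rule dep) (use permutes_in_image[OF p(1)] f in \<open>auto simp: block_perm_simps[OF p(1)]\<close>)
      moreover have "\<alpha> (\<lambda>i. snd (?x (block_perm 5 \<pi> \<rho> (5 + i)))) = \<alpha> (\<lambda>i. f (\<rho> i))"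
        by (rule dep) (use permutes_in_image[OF p(2)] f in \<open>auto simp: block_perm_simps[OF p(1)]\<close>)
      ultimately have "prod_\<alpha> (\<lambda>i. ?x (block_perm 5 \<pi> \<rho> i)) =
          (of_int (sign \<pi>) * \<alpha> f) * cnj (of_int (sign \<rho>) * \<alpha> f)"
        unfolding prod_\<alpha>_def using perm[OF p(1), of f] perm[OF p(2), of f] f by (simp only: lessThan_iff)
      also have "\<dots> = of_int (sign \<pi>) * (of_int (sign \<rho>) * (\<alpha> f * cnj (\<alpha> f)))" by simp
      finally show "of_int (sign \<pi>) * of_int (sign \<rho>) * prod_\<alpha> (\<lambda>i. ?x (block_perm 5 \<pi> \<rho> i)) =
          \<alpha> f * cnj (\<alpha> f)"
        by (simp only: mult.assoc mult.left_commute[of "of_int (sign \<rho>)"] of_int_sign_square)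
    qed
    also have "\<dots> = fact 5 * fact 5 * (\<alpha> f * cnj (\<alpha> f))"
      by (simp add: card_permutations[OF refl] mult.assoc)
    finally show ?thesis .
  qed
  ultimately have "\<i> ^ 5 * (fact 5 * ?D) = (\<i> / 2) ^ 5 / fact 5 * (fact 5 * fact 5 * (\<alpha> f * cnj (\<alpha> f)))"
    by (simp only:)
  then show ?thesis by (simp add: power_divide field_simps)
qed

end

section \<open>The Stenzel potential\<close>

locale stenzel =
  fixes \<kappa> :: real and u :: "real \<Rightarrow> real" and S :: "real set"
  assumes kappa: "\<kappa> > 0" and S: "open S" "{1..} \<subseteq> S" and smooth_u: "smooth_on u S"
    and ode: "\<And>t. ((\<lambda>s. deriv (\<lambda>t. u (cosh t)) s ^ 5) has_real_derivative \<kappa> * 5 * sinh t ^ 4) (at t)"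
begin

abbreviation u1 :: "real \<Rightarrow> real" where "u1 \<equiv> deriv u"
abbreviation u2 :: "real \<Rightarrow> real" where "u2 \<equiv> deriv (deriv u)"

lemma smooth_u1: "smooth_on u1 S"
  using smooth_u Ck_on_deriv[OF S(1)] unfolding smooth_on_def by blast

lemma smooth_u2: "smooth_on u2 S"
  using smooth_u1 Ck_on_deriv[OF S(1)] unfolding smooth_on_def by blast

lemma has_deriv_u: "x \<in> S \<Longrightarrow> (u has_real_derivative u1 x) (at x)"
  using smooth_on_has_derivative[OF smooth_u] by (meson DERIV_deriv_iff_real_differentiable differentiable_def)

lemma has_deriv_u1: "x \<in> S \<Longrightarrow> (u1 has_real_derivative u2 x) (at x)"
  using smooth_on_has_derivative[OF smooth_u1] by (meson DERIV_deriv_iff_real_differentiable differentiable_def)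

lemma cosh_in_S: "cosh t \<in> S" for t :: real
  using S(2) cosh_real_ge_1 by auto

lemma ge_1_in_S: "1 \<le> t \<Longrightarrow> t \<in> S" for t :: real
  using S(2) by auto

text \<open>The derivative of \<open>u (cosh t)\<close> is \<open>u1 (cosh t) * sinh t\<close>.
  Differentiating its fifth power produces the factor \<open>sinh t ^ 4\<close> on both sides, and
  it may be cancelled away from \<open>t = 0\<close>.\<close>

lemma ode_gt_1:
  assumes "\<rho> > 1"
  shows "u1 \<rho> ^ 4 * (u1 \<rho> * \<rho> + u2 \<rho> * (\<rho>\<^sup>2 - 1)) = \<kappa>"
proof -
  define t where "t = arcosh \<rho>"
  have t: "cosh t = \<rho>" using assms by (simp add: t_def)
  have "deriv (\<lambda>t. u (cosh t)) = (\<lambda>s. u1 (cosh s) * sinh s)"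
  proof
    fix s
    have "(cosh has_real_derivative sinh s) (at s)" by (auto intro!: derivative_eq_intros)
    from DERIV_chain2[OF has_deriv_u[OF cosh_in_S] this]
    show "deriv (\<lambda>t. u (cosh t)) s = u1 (cosh s) * sinh s" by (rule DERIV_imp_deriv)
  qed
  then have 1: "((\<lambda>s. (u1 (cosh s) * sinh s) ^ 5) has_real_derivative \<kappa> * 5 * sinh t ^ 4) (at t)"
    using ode[of t] by simp
  have "(cosh has_real_derivative sinh t) (at t)" by (auto intro!: derivative_eq_intros)
  from DERIV_chain2[OF has_deriv_u1[OF cosh_in_S] this]
  have d1: "((\<lambda>s. u1 (cosh s)) has_real_derivative u2 (cosh t) * sinh t) (at t)" .
  have 2: "((\<lambda>s. (u1 (cosh s) * sinh s) ^ 5) has_real_derivative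
      5 * (u1 (cosh t) * sinh t) ^ 4 * (u2 (cosh t) * sinh t * sinh t + u1 (cosh t) * cosh t)) (at t)"
    by (rule derivative_eq_intros d1 refl)+ (simp add: algebra_simps)
  have sh: "(sinh t)\<^sup>2 = \<rho>\<^sup>2 - 1" using t by (simp add: sinh_square_eq)
  have "\<rho>\<^sup>2 > 1" using assms by (simp add: one_less_power)
  with sh have "sinh t \<noteq> 0" by auto
  have "sinh t ^ 4 * (u1 \<rho> ^ 4 * (u2 \<rho> * (sinh t)\<^sup>2 + u1 \<rho> * \<rho>)) = sinh t ^ 4 * \<kappa>"
    using DERIV_unique[OF 1 2] unfolding t by (simp add: algebra_simps power_mult_distrib power2_eq_square)
  then have "u1 \<rho> ^ 4 * (u2 \<rho> * (sinh t)\<^sup>2 + u1 \<rho> * \<rho>) = \<kappa>"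
    using \<open>sinh t \<noteq> 0\<close> by simp
  then show ?thesis unfolding sh by (simp add: add.commute)
qed

text \<open>On the zero section the factor just cancelled vanishes, so the endpoint is reached by
  continuity of \<open>u1\<close> and \<open>u2\<close>.\<close>

lemma ode_ge_1:
  assumes "\<rho> \<ge> 1"
  shows "u1 \<rho> ^ 4 * (u1 \<rho> * \<rho> + u2 \<rho> * (\<rho>\<^sup>2 - 1)) = \<kappa>"
proof -
  have c: "continuous_on {1..} u1" "continuous_on {1..} u2"
    using smooth_on_continuous[OF smooth_u1] smooth_on_continuous[OF smooth_u2] S(2)
    by (auto intro: continuous_on_subset)
  have cl: "closure {1<..} = {1::real..}" by simp
  show ?thesis
    by (rule continuous_constant_on_closure[of "{1<..}" "\<lambda>\<rho>. u1 \<rho> ^ 4 * (u1 \<rho> * \<rho> + u2 \<rho> * (\<rho>\<^sup>2 - 1))"])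
      (use assms ode_gt_1 in \<open>auto simp: cl intro!: continuous_intros c\<close>)
qed

text \<open>The equation prevents zeros of \<open>u1\<close> and reads
  \<open>u1 1 ^ 5 = \<kappa>\<close> at the endpoint; a change of sign would contradict the
  intermediate value theorem.\<close>

lemma u1_pos:
  assumes "\<rho> \<ge> 1"
  shows "u1 \<rho> > 0"
proof (rule ccontr)
  assume "\<not> u1 \<rho> > 0"
  have "u1 1 ^ 5 = \<kappa>" using ode_ge_1[of 1] by (simp add: eval_nat_numeral)
  then have "u1 1 > 0" using kappa zero_less_power_eq[of "u1 1" 5] by simp
  moreover have "continuous_on {1..\<rho>} u1"
    by (rule continuous_on_subset[OF smooth_on_continuous[OF smooth_u1]]) (use S(2) in auto)
  ultimately obtain x where "x \<ge> 1" "u1 x = 0"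
    using IVT2'[of u1 \<rho> 0 1] assms \<open>\<not> u1 \<rho> > 0\<close> by force
  then show False using ode_ge_1[of x] kappa by simp
qed

lemma u2_bound:
  assumes "\<rho> \<ge> 1"
  shows "u1 \<rho> * \<rho> + u2 \<rho> * (\<rho>\<^sup>2 - 1) > 0"
  using ode_ge_1[OF assms] kappa u1_pos[OF assms]
  by (metis zero_less_mult_pos zero_less_power)

end

section \<open>The Stenzel form\<close>

definition herm :: "complex^6 \<Rightarrow> complex^6 \<Rightarrow> complex" where
  "herm v w = (\<Sum>i\<in>UNIV. v $ i * cnj (w $ i))"

lemma herm_simps:
  "herm (v + v') w = herm v w + herm v' w" "herm v (w + w') = herm v w + herm v w'"
  "herm (c *s v) w = c * herm v w" "herm v (c *s w) = cnj c * herm v w"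
  "herm 0 w = 0" "herm v 0 = 0"
  by (simp_all add: herm_def algebra_simps sum.distrib sum_distrib_left)

lemma cnj_herm: "cnj (herm v w) = herm w v"
  by (simp add: herm_def mult.commute)

lemma r2_eq_inner: "r2 z = z \<bullet> z"
  by (simp add: r2_def inner_vec_def cmod_power2 inner_complex_def flip: power2_eq_square)

lemma herm_self: "herm z z = of_real (r2 z)"
  by (simp add: herm_def r2_def flip: complex_norm_square)

lemma inner_eq_herm: "v \<bullet> w = Re (herm v w)"
  by (simp add: herm_def inner_vec_def inner_complex_def)

lemma r2_quadric_ge_1:
  assumes "z \<in> quadric"
  shows "r2 z \<ge> 1"
proof -
  have "1 = cmod (\<Sum>i\<in>UNIV. (z $ i)\<^sup>2)" using assms by (simp add: quadric_def)
  also have "\<dots> \<le> r2 z" unfolding r2_def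
    by (rule order_trans[OF norm_sum]) (simp add: norm_power)
  finally show ?thesis .
qed

lemma r2_has_derivative: "(r2 has_derivative (\<lambda>v. 2 * (z \<bullet> v))) (at z)"
proof -
  have "((\<lambda>z. z \<bullet> z) has_derivative (\<lambda>v. 2 * (z \<bullet> v))) (at z)"
    by (auto intro!: derivative_eq_intros simp: inner_commute)
  then show ?thesis by (simp add: r2_eq_inner[abs_def])
qed

context stenzel
begin

text \<open>The Levi form of the potential \<open>u (r2 z)\<close>: the first summand comes from the
  mixed second derivatives of \<open>r2\<close>, the second one from the product of its first
  derivatives.\<close>

definition hform :: "complex^6 \<Rightarrow> complex^6 \<Rightarrow> complex^6 \<Rightarrow> complex" where
  "hform z v w = of_real (u1 (r2 z)) * herm v w + of_real (u2 (r2 z)) * herm v z * herm z w"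

lemma hform_simps:
  "hform z (v + v') w = hform z v w + hform z v' w" "hform z v (w + w') = hform z v w + hform z v w'"
  "hform z (c *s v) w = c * hform z v w" "hform z v (c *s w) = cnj c * hform z v w"
  by (simp_all add: hform_def herm_simps algebra_simps)

lemma cnj_hform: "cnj (hform z v w) = hform z w v"
  by (simp add: hform_def cnj_herm mult.assoc mult.commute[of "herm w z"])

lemma wirtinger_bar_potential:
  assumes "r2 y \<in> S"
  shows "wirtinger_bar k (\<lambda>y. complex_of_real (u (r2 y))) y = of_real (u1 (r2 y)) * y $ k"
proof -
  have "((\<lambda>y. complex_of_real (u (r2 y))) has_derivative
      (\<lambda>v. of_real (2 * (y \<bullet> v) * u1 (r2 y)))) (at y)"
    by (intro has_derivative_of_real DERIV_compose_FDERIV[where g = r2] has_deriv_u assms r2_has_derivative)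
  then show ?thesis
    by (simp add: wirtinger_bar_def frechet_derivative_eqI inner_axis inner_complex_def complex_eq_iff algebra_simps)
qed

lemma wirtinger_wirtinger_bar_potential:
  assumes "r2 z \<in> S"
  shows "wirtinger j (wirtinger_bar k (\<lambda>y. complex_of_real (u (r2 y)))) z =
    of_real (u2 (r2 z)) * cnj (z $ j) * z $ k + (if j = k then of_real (u1 (r2 z)) else 0)"
proof -
  let ?D = "\<lambda>v. of_real (2 * (z \<bullet> v) * u2 (r2 z)) * z $ k + of_real (u1 (r2 z)) * v $ k"
  have "((\<lambda>y. complex_of_real (u1 (r2 y))) has_derivative
      (\<lambda>v. of_real (2 * (z \<bullet> v) * u2 (r2 z)))) (at z)"
    by (intro has_derivative_of_real DERIV_compose_FDERIV[where g = r2] has_deriv_u1 assms r2_has_derivative)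
  moreover have "((\<lambda>y::complex^6. y $ k) has_derivative (\<lambda>v. v $ k)) (at z)"
    by (rule bounded_linear_imp_has_derivative[OF bounded_linear_vec_nth])
  ultimately have "((\<lambda>y. of_real (u1 (r2 y)) * y $ k) has_derivative ?D) (at z)"
    by (auto intro!: has_derivative_eq_rhs[OF has_derivative_mult] simp: add.commute)
  moreover have "open {y. r2 y \<in> S}"
  proof -
    have "continuous_on UNIV r2"
      using has_derivative_continuous[OF r2_has_derivative] by (simp add: continuous_at_imp_continuous_on)
    from open_vimage[OF S(1) this] show ?thesis by (simp add: vimage_def)
  qed
  ultimately have "(wirtinger_bar k (\<lambda>y. complex_of_real (u (r2 y))) has_derivative ?D) (at z)"
    by (rule has_derivative_transform_within_open) (use assms wirtinger_bar_potential in auto)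
  then have "wirtinger j (wirtinger_bar k (\<lambda>y. complex_of_real (u (r2 y)))) z =
      (?D (axis j 1) - \<i> * ?D (axis j \<i>)) / 2"
    unfolding wirtinger_def by (simp only: frechet_derivative_eqI)
  moreover have ip: "z \<bullet> axis j 1 = Re (z $ j)" "z \<bullet> axis j \<i> = Im (z $ j)"
    by (simp_all add: inner_axis inner_complex_def)
  moreover have ax: "axis j x $ k = (if j = k then x else 0)" for x :: complex
    by (simp add: axis_def)
  ultimately have "wirtinger j (wirtinger_bar k (\<lambda>y. complex_of_real (u (r2 y)))) z =
      (of_real (2 * Re (z $ j) * u2 (r2 z)) * z $ k + of_real (u1 (r2 z)) * (if j = k then 1 else 0)
       - \<i> * (of_real (2 * Im (z $ j) * u2 (r2 z)) * z $ k + of_real (u1 (r2 z)) * (if j = k then \<i> else 0))) / 2"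
    by (simp only:)
  then show ?thesis
    by (cases "j = k") (simp_all add: complex_eq_iff field_simps)
qed

lemma stenzel_form_eq:
  assumes "r2 z \<ge> 1"
  shows "stenzel_form u z v w = \<i> * (hform z v w - hform z w v)"
proof -
  have *: "(\<Sum>j\<in>UNIV. \<Sum>k\<in>UNIV. (of_real (u2 (r2 z)) * cnj (z $ j) * z $ k +
        (if j = k then of_real (u1 (r2 z)) else 0)) * (v $ j * cnj (w $ k))) = hform z v w" for v w
  proof -
    have "(\<Sum>j\<in>UNIV. \<Sum>k\<in>UNIV. (if j = k then of_real (u1 (r2 z)) else 0) * (v $ j * cnj (w $ k)))
        = of_real (u1 (r2 z)) * herm v w"
      by (simp add: herm_def sum_distrib_left if_distrib[of "\<lambda>t. t * _"] cong: if_cong)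
    moreover have "(\<Sum>j\<in>UNIV. \<Sum>k\<in>UNIV. (of_real (u2 (r2 z)) * cnj (z $ j) * z $ k) * (v $ j * cnj (w $ k)))
        = of_real (u2 (r2 z)) * herm v z * herm z w"
      unfolding herm_def mult.assoc
      by (subst sum_product) (unfold sum_distrib_left, intro sum.cong refl, simp only: mult_ac)
    ultimately show ?thesis by (simp add: hform_def distrib_right sum.distrib)
  qed
  show ?thesis
    unfolding stenzel_form_def ddbar_def
      wirtinger_wirtinger_bar_potential[OF ge_1_in_S[OF assms]] right_diff_distrib
    by (simp only: sum_subtractf * right_diff_distrib)
qed

lemma stenzel_form_eq_Im:
  assumes "r2 z \<ge> 1"
  shows "stenzel_form u z v w = of_real (- 2 * Im (hform z v w))"
  unfolding stenzel_form_eq[OF assms] cnj_hform[of z v w, symmetric] by (simp add: complex_eq_iff)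

lemma kaehler_metric_eq:
  assumes "r2 z \<ge> 1"
  shows "kaehler_metric (stenzel_form u) z v w = 2 * Re (hform z v w)"
  unfolding kaehler_metric_def stenzel_form_eq_Im[OF assms] by (simp add: hform_simps)

end

section \<open>Null coordinates on the quadric\<close>

lemma UNIV_6: "(UNIV :: 6 set) = {1, 2, 3, 4, 5, 6}"
  by (rule card_subset_eq[symmetric]) auto

lemma sum_6: "sum f (UNIV :: 6 set) = f 1 + f 2 + f 3 + f 4 + f 5 + f 6"
  unfolding UNIV_6 by (simp add: add.assoc)

lemma forall_6: "(\<forall>i::6. P i) \<longleftrightarrow> P 1 \<and> P 2 \<and> P 3 \<and> P 4 \<and> P 5 \<and> P 6"
proof -
  have "(\<forall>i::6. P i) \<longleftrightarrow> (\<forall>i\<in>UNIV. P i)" by simp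
  then show ?thesis unfolding UNIV_6 by simp
qed

lemma UNIV_5: "(UNIV :: 5 set) = {0, 1, 2, 3, 4}"
  by (rule card_subset_eq[symmetric]) auto

lemma forall_5: "(\<forall>i::5. P i) \<longleftrightarrow> P 0 \<and> P 1 \<and> P 2 \<and> P 3 \<and> P 4"
proof -
  have "(\<forall>i::5. P i) \<longleftrightarrow> (\<forall>i\<in>UNIV. P i)" by simp
  then show ?thesis unfolding UNIV_5 by simp
qed

definition W1 :: "complex^6 \<Rightarrow> complex" where "W1 z = z $ 1 + \<i> * z $ 2"
definition W2 :: "complex^6 \<Rightarrow> complex" where "W2 z = z $ 3 + \<i> * z $ 4"
definition W3 :: "complex^6 \<Rightarrow> complex" where "W3 z = z $ 5 + \<i> * z $ 6"
definition V1 :: "complex^6 \<Rightarrow> complex" where "V1 z = z $ 1 - \<i> * z $ 2"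
definition V2 :: "complex^6 \<Rightarrow> complex" where "V2 z = z $ 3 - \<i> * z $ 4"
definition V3 :: "complex^6 \<Rightarrow> complex" where "V3 z = z $ 5 - \<i> * z $ 6"

lemmas WV_defs = W1_def W2_def W3_def V1_def V2_def V3_def

lemma quadric_iff_WV: "z \<in> quadric \<longleftrightarrow> W1 z * V1 z + W2 z * V2 z + W3 z * V3 z = 1"
proof -
  have "(\<Sum>i\<in>UNIV. (z $ i)\<^sup>2) = W1 z * V1 z + W2 z * V2 z + W3 z * V3 z"
    by (simp add: sum_6 WV_defs algebra_simps power2_eq_square)
  then show ?thesis by (simp add: quadric_def)
qed

lemma quadric_tangent_iff_WV: "w \<in> quadric_tangent z \<longleftrightarrow>
  W1 z * V1 w + V1 z * W1 w + W2 z * V2 w + V2 z * W2 w + W3 z * V3 w + V3 z * W3 w = 0"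
proof -
  have "2 * (\<Sum>i\<in>UNIV. z $ i * w $ i) =
    W1 z * V1 w + V1 z * W1 w + W2 z * V2 w + V2 z * W2 w + W3 z * V3 w + V3 z * W3 w"
    by (simp add: sum_6 WV_defs algebra_simps)
  then show ?thesis unfolding quadric_tangent_def mem_Collect_eq
    by (metis mult_eq_0_iff zero_neq_numeral)
qed

lemma herm_WV: "herm v w = (W1 v * cnj (W1 w) + W2 v * cnj (W2 w) + W3 v * cnj (W3 w) +
  V1 v * cnj (V1 w) + V2 v * cnj (V2 w) + V3 v * cnj (V3 w)) / 2"
  by (simp add: herm_def sum_6 WV_defs algebra_simps)

section \<open>The Monge-Ampere equation\<close>

text \<open>The matrix determinant lemma, by two block eliminations of one bordered matrix. The
  factor \<open>a\<close> on the left avoids a division.\<close>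

lemma det_rank_one_update:
  fixes a :: complex
  assumes X: "X \<in> carrier_mat n 1" and Y: "Y \<in> carrier_mat 1 n"
  shows "a * det (a \<cdot>\<^sub>m 1\<^sub>m n + X * Y) = a ^ n * (a + (Y * X) $$ (0, 0))"
proof -
  let ?P = "four_block_mat (1\<^sub>m 1) (- Y) X (a \<cdot>\<^sub>m 1\<^sub>m n)"
  let ?L = "four_block_mat (1\<^sub>m 1) (0\<^sub>m 1 n) (- X) (1\<^sub>m n)"
  let ?R = "four_block_mat (a \<cdot>\<^sub>m 1\<^sub>m 1) (0\<^sub>m 1 n) (- X) (1\<^sub>m n)"
  have P: "?P \<in> carrier_mat (1 + n) (1 + n)" and L: "?L \<in> carrier_mat (1 + n) (1 + n)"
    and R: "?R \<in> carrier_mat (1 + n) (1 + n)" using X Y by auto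
  have "?L * ?P = four_block_mat (1\<^sub>m 1 * 1\<^sub>m 1 + 0\<^sub>m 1 n * X) (1\<^sub>m 1 * (- Y) + 0\<^sub>m 1 n * (a \<cdot>\<^sub>m 1\<^sub>m n))
      (- X * 1\<^sub>m 1 + 1\<^sub>m n * X) (- X * (- Y) + 1\<^sub>m n * (a \<cdot>\<^sub>m 1\<^sub>m n))"
    by (rule mult_four_block_mat) (use X Y in auto)
  also have "1\<^sub>m 1 * 1\<^sub>m 1 + 0\<^sub>m 1 n * X = 1\<^sub>m 1" using X by simp
  also have "- X * 1\<^sub>m 1 + 1\<^sub>m n * X = 0\<^sub>m n 1" using X by (auto intro!: eq_matI)
  also have "- X * (- Y) + 1\<^sub>m n * (a \<cdot>\<^sub>m 1\<^sub>m n) = a \<cdot>\<^sub>m 1\<^sub>m n + X * Y" using X Y by (auto intro!: eq_matI)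
  finally have "det (?L * ?P) = det (1\<^sub>m 1) * det (a \<cdot>\<^sub>m 1\<^sub>m n + X * Y)"
    using X Y by (simp only:) (rule det_four_block_mat_lower_left_zero, auto)
  moreover have "det ?L = 1"
    using X by (subst det_four_block_mat_upper_right_zero[where n = 1 and m = n]) auto
  ultimately have 1: "det ?P = det (a \<cdot>\<^sub>m 1\<^sub>m n + X * Y)"
    using det_mult[OF L P] by simp
  have "?P * ?R = four_block_mat (1\<^sub>m 1 * (a \<cdot>\<^sub>m 1\<^sub>m 1) + (- Y) * (- X)) (1\<^sub>m 1 * 0\<^sub>m 1 n + (- Y) * 1\<^sub>m n)
      (X * (a \<cdot>\<^sub>m 1\<^sub>m 1) + (a \<cdot>\<^sub>m 1\<^sub>m n) * (- X)) (X * 0\<^sub>m 1 n + (a \<cdot>\<^sub>m 1\<^sub>m n) * 1\<^sub>m n)"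
    by (rule mult_four_block_mat) (use X Y in auto)
  also have "X * (a \<cdot>\<^sub>m 1\<^sub>m 1) + (a \<cdot>\<^sub>m 1\<^sub>m n) * (- X) = 0\<^sub>m n 1"
    using mult_smult_distrib[OF X one_carrier_mat[of 1], of a]
      mult_smult_assoc_mat[OF one_carrier_mat[of n] uminus_carrier_mat[OF X], of a] X
    by (auto intro!: eq_matI)
  also have "X * 0\<^sub>m 1 n + (a \<cdot>\<^sub>m 1\<^sub>m n) * 1\<^sub>m n = a \<cdot>\<^sub>m 1\<^sub>m n"
    using X by (simp add: right_mult_one_mat[of _ n n])
  finally have "det (?P * ?R) = det (1\<^sub>m 1 * (a \<cdot>\<^sub>m 1\<^sub>m 1) + (- Y) * (- X)) * det (a \<cdot>\<^sub>m 1\<^sub>m n)"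
    using X Y by (simp only:) (rule det_four_block_mat_lower_left_zero, auto)
  also have "det (1\<^sub>m 1 * (a \<cdot>\<^sub>m 1\<^sub>m 1) + (- Y) * (- X)) = a + (Y * X) $$ (0, 0)"
    using X Y by (subst det_single) (auto simp: scalar_prod_def)
  also have "det (a \<cdot>\<^sub>m 1\<^sub>m n) = a ^ n" by simp
  finally have "det (?P * ?R) = (a + (Y * X) $$ (0, 0)) * a ^ n" .
  moreover have "det ?R = a"
    using X by (subst det_four_block_mat_upper_right_zero[where n = 1 and m = n]) (auto simp: det_single)
  ultimately show ?thesis using det_mult[OF P R] 1 by (simp add: mult.commute)
qed

text \<open>The order matters: \<open>V1\<close> is last because the quadric equation determines it
  where \<open>W1\<close> is nonzero, and the other five follow the order of the chart parameters,
  which makes the coordinate frame triangular.\<close>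

definition null_coord :: "nat \<Rightarrow> complex^6 \<Rightarrow> complex" where
  "null_coord i z = [W1 z, W2 z, W3 z, V2 z, V3 z, V1 z] ! i"

lemma null_coord_simps:
  "null_coord 0 z = W1 z" "null_coord 1 z = W2 z" "null_coord (Suc 0) z = W2 z" "null_coord 2 z = W3 z" "null_coord 3 z = V2 z" "null_coord 4 z = V3 z" "null_coord 5 z = V1 z"
  by (simp_all add: null_coord_def)

lemma sum_lt_6: "(\<Sum>i = 0..<6. f i) = f 0 + f 1 + f 2 + f 3 + f 4 + f (5::nat)"
  by (simp add: eval_nat_numeral)

lemma herm_null_coord: "(\<Sum>i = 0..<6. null_coord i v * cnj (null_coord i w)) = 2 * herm v w"
  by (simp add: sum_lt_6 null_coord_simps herm_WV algebra_simps)

lemma det_map_cnj: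
  fixes A :: "complex mat"
  shows "det (map_mat cnj A) = cnj (det A)"
proof -
  interpret comm_ring_hom cnj by unfold_locales auto
  show ?thesis by simp
qed

context stenzel
begin

text \<open>The tangent frame is completed by the conjugate of \<open>z\<close>, which is Hermitian
  orthogonal to the tangent space. The 6 by 6 Gram matrix is then block diagonal and factors as
  \<open>F * K * Fh\<close>, where \<open>F\<close> holds the frame and \<open>K\<close> is a
  rank-one change of a scalar matrix. The differential equation evaluates the determinant of
  \<open>K\<close>; the triangular frame and the tangency equations evaluate that of
  \<open>F\<close>.\<close>

lemma monge_ampere:
  assumes z: "z \<in> quadric" and f: "\<And>j. j < 5 \<Longrightarrow> f j \<in> quadric_tangent z" and W1: "W1 z \<noteq> 0"
    and tri: "\<And>i j. i < j \<Longrightarrow> j < 5 \<Longrightarrow> null_coord i (f j) = 0"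
  shows "(\<Sum>\<rho> | \<rho> permutes {..<5}. of_int (sign \<rho>) * (\<Prod>j<5. hform z (f j) (f (\<rho> j)))) =
    of_real (\<kappa> / 16 * (cmod (\<Prod>j<5. null_coord j (f j)) / cmod (W1 z))\<^sup>2)"
proof -
  define r where "r = r2 z"
  have r: "r \<ge> 1" using r2_quadric_ge_1[OF z] by (simp add: r_def)
  define zb where "zb = (\<chi> i. cnj (z $ i))"
  have zb: "W1 zb = cnj (V1 z)" "W2 zb = cnj (V2 z)" "W3 zb = cnj (V3 z)"
    "V1 zb = cnj (W1 z)" "V2 zb = cnj (W2 z)" "V3 zb = cnj (W3 z)"
    by (simp_all add: zb_def WV_defs)
  have herm_zb: "herm z zb = 1" "herm zb zb = of_real r" "herm zb z = 1"
  proof -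
    show "herm z zb = 1" using z by (simp add: herm_def zb_def quadric_def power2_eq_square)
    then show "herm zb z = 1" by (metis cnj_herm complex_cnj_one)
    have "herm zb zb = herm z z" by (simp add: herm_def zb_def mult.commute)
    then show "herm zb zb = of_real r" by (simp add: herm_self r_def)
  qed
  have f_zb: "herm (f j) zb = 0" "herm zb (f j) = 0" if "j < 5" for j
  proof -
    show "herm (f j) zb = 0"
      using f[OF that] by (simp add: herm_def zb_def quadric_tangent_def mult.commute)
    then show "herm zb (f j) = 0" by (metis cnj_herm complex_cnj_zero)
  qed
  \<comment> \<open>\<open>z\<close> corrected by a multiple of \<open>zb\<close> so as to be
    orthogonal to \<open>zb\<close>. It still pairs with tangent vectors like \<open>z\<close>, so
    the rank-one term keeps \<open>hform\<close> on them while the row of \<open>zb\<close>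
    decouples.\<close>
  define t where "t = z + (- 1 / of_real r) *s zb"
  have t: "herm v t = herm v z - herm v zb / of_real r" "herm t v = herm z v - herm zb v / of_real r" for v
    unfolding t_def by (simp_all only: herm_simps) simp_all
  have tt: "herm t t = of_real (r - 1 / r)"
    unfolding t(2)[of t] t(1)[of z] t(1)[of zb] herm_zb herm_self[of z] r_def[symmetric]
    using r by simp
  define g where "g j = (if j < 5 then f j else zb)" for j :: nat
  define a where "a = complex_of_real (u1 r)"
  define b where "b = complex_of_real (u2 r)"
  define F where "F = mat 6 6 (\<lambda>(j, i). null_coord i (g j))"
  define Fh where "Fh = mat 6 6 (\<lambda>(i, k). cnj (null_coord i (g k)))"
  define X where "X = mat 6 1 (\<lambda>(i, k::nat). cnj (null_coord i t))"
  define Y where "Y = mat 1 6 (\<lambda>(k::nat, i). b / 4 * null_coord i t)"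
  \<comment> \<open>Null coordinates double the Hermitian product, by
    \<open>herm_null_coord\<close>; this explains \<open>a / 2\<close> here and \<open>b / 4\<close>
    in \<open>Y\<close>.\<close>
  define K where "K = (a / 2) \<cdot>\<^sub>m 1\<^sub>m 6 + X * Y"
  define M where "M = mat 5 5 (\<lambda>(j, k). hform z (f j) (f k))"
  note carr [simp] = mat_carrier[of 6 6 "\<lambda>(j, i). null_coord i (g j)", folded F_def]
    mat_carrier[of 6 6 "\<lambda>(i, k). cnj (null_coord i (g k))", folded Fh_def]
    mat_carrier[of 6 1 "\<lambda>(i, k::nat). cnj (null_coord i t)", folded X_def]
    mat_carrier[of 1 6 "\<lambda>(k::nat, i). b / 4 * null_coord i t", folded Y_def]
  note dims [simp] = carr[THEN carrier_matD(1)] carr[THEN carrier_matD(2)]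
  note carr_simp [simp] = carr[unfolded One_nat_def]
  note XY [simp] = mult_carrier_mat[OF carr(3,4)]
  have FX [simp]: "F * X \<in> carrier_mat 6 1" "F * X \<in> carrier_mat 6 (Suc 0)"
    using mult_carrier_mat[OF carr(1,3)] by simp_all
  have FXY [simp]: "F * X * Y \<in> carrier_mat 6 6" by (rule mult_carrier_mat[OF FX(1) carr(4)])
  have K: "K \<in> carrier_mat 6 6" by (simp add: K_def)
  note carrs = K mult_carrier_mat[OF carr(1) K]
  have "F * K * Fh = (a / 2) \<cdot>\<^sub>m (F * Fh) + (F * X) * (Y * Fh)"
  proof -
    have "F * K = F * ((a / 2) \<cdot>\<^sub>m 1\<^sub>m 6) + F * (X * Y)"
      unfolding K_def by (rule mult_add_distrib_mat[of _ 6 6 _ 6]) auto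
    also have "F * ((a / 2) \<cdot>\<^sub>m 1\<^sub>m 6) = (a / 2) \<cdot>\<^sub>m F"
      by (subst mult_smult_distrib[of F 6 6 _ 6]) (auto simp: right_mult_one_mat[OF carr(1)])
    also have "F * (X * Y) = F * X * Y" by (rule assoc_mult_mat[symmetric, of _ 6 6 _ 1 _ 6]) auto
    finally have "F * K * Fh = (a / 2) \<cdot>\<^sub>m F * Fh + F * X * Y * Fh"
      by (simp only:) (rule add_mult_distrib_mat[of _ 6 6 _ _ 6], auto)
    also have "(a / 2) \<cdot>\<^sub>m F * Fh = (a / 2) \<cdot>\<^sub>m (F * Fh)" by (rule mult_smult_assoc_mat[of _ 6 6 _ 6]) auto
    also have "F * X * Y * Fh = (F * X) * (Y * Fh)" by (rule assoc_mult_mat[of _ 6 1 _ 6 _ 6]) auto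
    finally show ?thesis .
  qed
  also have "\<dots> = four_block_mat M (0\<^sub>m 5 1) (0\<^sub>m 1 5) (mat 1 1 (\<lambda>_. a * of_real r))"
  proof (rule eq_matI)
    fix j k assume "j < dim_row (four_block_mat M (0\<^sub>m 5 1) (0\<^sub>m 1 5) (mat 1 1 (\<lambda>_. a * of_real r)))"
      "k < dim_col (four_block_mat M (0\<^sub>m 5 1) (0\<^sub>m 1 5) (mat 1 1 (\<lambda>_. a * of_real r)))"
    then have jk: "j < 6" "k < 6" by (auto simp: M_def)
    have 1: "(F * Fh) $$ (j, k) = 2 * herm (g j) (g k)"
      using jk by (simp add: F_def Fh_def scalar_prod_def herm_null_coord)
    have 2: "(F * X) $$ (j, 0) = 2 * herm (g j) t"
      using jk by (simp add: F_def X_def scalar_prod_def herm_null_coord)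
    have 3: "(Y * Fh) $$ (0, k) = b / 2 * herm t (g k)"
      using jk by (simp add: Y_def Fh_def scalar_prod_def mult.assoc herm_null_coord flip: sum_distrib_left sum_divide_distrib)
    have "((a / 2) \<cdot>\<^sub>m (F * Fh) + (F * X) * (Y * Fh)) $$ (j, k) =
        a / 2 * (F * Fh) $$ (j, k) + (F * X) $$ (j, 0) * (Y * Fh) $$ (0, k)"
      using jk by (simp add: scalar_prod_def)
    also have "\<dots> = a * herm (g j) (g k) + b * herm (g j) t * herm t (g k)"
      unfolding 1 2 3 by simp
    also have "\<dots> = four_block_mat M (0\<^sub>m 5 1) (0\<^sub>m 1 5) (mat 1 1 (\<lambda>_. a * of_real r)) $$ (j, k)"
      using jk r by (auto simp: M_def g_def hform_def t f_zb herm_zb a_def b_def r_def[symmetric])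
    finally show "((a / 2) \<cdot>\<^sub>m (F * Fh) + (F * X) * (Y * Fh)) $$ (j, k) =
      four_block_mat M (0\<^sub>m 5 1) (0\<^sub>m 1 5) (mat 1 1 (\<lambda>_. a * of_real r)) $$ (j, k)" .
  qed (auto simp: M_def)
  finally have d1: "det (F * K * Fh) = det M * (a * of_real r)"
    by (simp only:) (subst det_four_block_mat_upper_right_zero[where n = 5 and m = 1], auto simp: M_def det_single)
  have d2: "det (F * K * Fh) = det F * det K * det Fh"
    by (simp only: det_mult[OF carrs(2) carr(2)] det_mult[OF carr(1) carrs(1)])
  have d3: "det Fh = cnj (det F)"
  proof -
    have "Fh = map_mat cnj (transpose_mat F)" by (rule eq_matI) (auto simp: F_def Fh_def)
    then show ?thesis by (simp add: det_map_cnj det_transpose[OF carr(1)])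
  qed
  have d4: "det K = a * of_real \<kappa> / (64 * of_real r)"
  proof -
    have "(Y * X) $$ (0, 0) = b / 2 * of_real (r - 1 / r)"
      by (simp add: Y_def X_def scalar_prod_def mult.assoc herm_null_coord tt flip: sum_distrib_left sum_divide_distrib)
    then have "a / 2 * det K = (a / 2) ^ 6 * (a / 2 + b / 2 * of_real (r - 1 / r))"
      unfolding K_def using det_rank_one_update[of X 6 Y "a / 2"] by simp
    \<comment> \<open>The powers are grouped so that the left side of \<open>ode_ge_1\<close>
      appears as a factor.\<close>
    also have "\<dots> = of_real (u1 r / 2 * (u1 r * (u1 r ^ 4 * (u1 r * r + u2 r * (r\<^sup>2 - 1))) / (64 * r)))"
      using r by (simp add: a_def b_def field_simps power2_eq_square eval_nat_numeral)
    finally have "a / 2 * det K = a / 2 * (a * of_real \<kappa> / (64 * of_real r))"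
      unfolding ode_ge_1[OF r] by (simp add: a_def)
    moreover have "a / 2 \<noteq> 0" using u1_pos[OF r] by (simp add: a_def)
    ultimately show ?thesis by (metis mult_cancel_left)
  qed
  have "det F * W1 z = (\<Prod>j<5. null_coord j (f j)) * (2 * of_real r)"
  proof -
    \<comment> \<open>The last column lists the coefficients of the differential of the quadric
      equation, in the order of \<open>null_coord\<close>. It annihilates the tangent rows and gives
      \<open>2 * r\<close> on the row of \<open>zb\<close>.\<close>
    define C where "C = mat 6 6 (\<lambda>(i, k). if k < 5 then if i = k then 1 else 0
      else [V1 z, V2 z, V3 z, W2 z, W3 z, W1 z] ! i)"
    have C: "C \<in> carrier_mat 6 6" by (simp add: C_def)
    have "upper_triangular C" by (auto simp: C_def)
    then have "det C = prod_list (diag_mat C)" by (rule det_upper_triangular[OF _ C])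
    also have "\<dots> = W1 z" by (simp add: diag_mat_def C_def numeral_eq_Suc)
    finally have detC: "det C = W1 z" .
    define A where "A = mat 5 5 (\<lambda>(j, i). null_coord i (f j))"
    have A: "A \<in> carrier_mat 5 5" by (simp add: A_def)
    have "upper_triangular A" using tri by (auto simp: A_def)
    then have "det A = prod_list (diag_mat A)" by (rule det_upper_triangular[OF _ A])
    also have "\<dots> = (\<Prod>j<5. null_coord j (f j))" by (simp add: diag_mat_def A_def numeral_eq_Suc mult.assoc)
    finally have detA: "det A = (\<Prod>j<5. null_coord j (f j))" .
    have tang: "W1 (f j) * V1 z + W2 (f j) * V2 z + W3 (f j) * V3 z + V2 (f j) * W2 z + V3 (f j) * W3 z
        + V1 (f j) * W1 z = 0" if "j < 5" for j
      using f[OF that] unfolding quadric_tangent_iff_WV by (simp add: algebra_simps)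
    have norm: "cnj (V1 z) * V1 z + cnj (V2 z) * V2 z + cnj (V3 z) * V3 z + cnj (W2 z) * W2 z
        + cnj (W3 z) * W3 z + cnj (W1 z) * W1 z = 2 * of_real r"
      using herm_self[of z] by (simp add: herm_WV r_def algebra_simps)
    have "F * C = four_block_mat A (0\<^sub>m 5 1) (mat 1 5 (\<lambda>(j, i). null_coord i zb)) (mat 1 1 (\<lambda>_. 2 * of_real r))"
    proof (rule eq_matI)
      fix j k
      assume "j < dim_row (four_block_mat A (0\<^sub>m 5 1) (mat 1 5 (\<lambda>(j, i). null_coord i zb)) (mat 1 1 (\<lambda>_. 2 * of_real r)))"
        "k < dim_col (four_block_mat A (0\<^sub>m 5 1) (mat 1 5 (\<lambda>(j, i). null_coord i zb)) (mat 1 1 (\<lambda>_. 2 * of_real r)))"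
      then have jk: "j < 6" "k < 6" by (auto simp: A_def)
      have e: "(F * C) $$ (j, k) = (\<Sum>i = 0..<6. null_coord i (g j) * C $$ (i, k))"
        using jk C by (simp add: F_def scalar_prod_def)
      show "(F * C) $$ (j, k) =
        four_block_mat A (0\<^sub>m 5 1) (mat 1 5 (\<lambda>(j, i). null_coord i zb)) (mat 1 1 (\<lambda>_. 2 * of_real r)) $$ (j, k)"
      proof (cases "k < 5")
        case True
        have "(\<Sum>i = 0..<6. null_coord i (g j) * C $$ (i, k)) = (\<Sum>i = 0..<6. if i = k then null_coord i (g j) else 0)"
          by (rule sum.cong[OF refl]) (use True in \<open>auto simp: C_def\<close>)
        also have "\<dots> = null_coord k (g j)" using jk by simp
        finally show ?thesis unfolding e using True jk by (auto simp: A_def g_def)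
      next
        case False
        then have k: "k = 5" using jk by simp
        show ?thesis
        proof (cases "j < 5")
          case True
          then show ?thesis unfolding k e[unfolded k] using tang[OF True] by (simp add: sum_lt_6 C_def null_coord_simps g_def A_def)
        next
          case False
          then have j: "j = 5" using jk by simp
          show ?thesis unfolding k j e[unfolded k j] using norm by (simp add: sum_lt_6 C_def null_coord_simps g_def A_def zb)
        qed
      qed
    qed (auto simp: A_def F_def C_def)
    then have "det (F * C) = det A * (2 * of_real r)"
      by (simp only:) (subst det_four_block_mat_upper_right_zero[where n = 5 and m = 1], auto simp: A_def det_single)
    then show ?thesis by (simp add: det_mult[OF carr(1) C] detC detA)
  qed
  then have "cmod (det F) * cmod (W1 z) = cmod (\<Prod>j<5. null_coord j (f j)) * (2 * r)"
    using r by (metis abs_of_nonneg norm_mult norm_numeral norm_of_real order_trans zero_le_one)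
  then have F: "cmod (det F) = cmod (\<Prod>j<5. null_coord j (f j)) / cmod (W1 z) * (2 * r)"
    using W1 by (simp add: field_simps)
  have "det M * (a * of_real r) = (det F * cnj (det F)) * (a * of_real \<kappa> / (64 * of_real r))"
    using d1 d2 unfolding d3 d4 by (simp only: mult_ac)
  then have "det M * (a * of_real r) = of_real ((cmod (det F))\<^sup>2) * (a * of_real \<kappa> / (64 * of_real r))"
    by (simp only: complex_norm_square)
  also have "\<dots> = of_real (\<kappa> / 16 * (cmod (\<Prod>j<5. null_coord j (f j)) / cmod (W1 z))\<^sup>2) * (a * of_real r)"
    unfolding F using r by (simp add: field_simps power2_eq_square)
  finally have "det M = of_real (\<kappa> / 16 * (cmod (\<Prod>j<5. null_coord j (f j)) / cmod (W1 z))\<^sup>2)"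
    using u1_pos[OF r] r by (simp add: a_def)
  moreover have "det M = (\<Sum>\<rho> | \<rho> permutes {..<5}. of_int (sign \<rho>) * (\<Prod>j<5. hform z (f j) (f (\<rho> j))))"
  proof -
    have "M \<in> carrier_mat 5 5" by (simp add: M_def)
    moreover have "(\<Prod>j<5. M $$ (j, \<rho> j)) = (\<Prod>j<5. hform z (f j) (f (\<rho> j)))" if "\<rho> permutes {..<5}" for \<rho>
      by (rule prod.cong[OF refl]) (use permutes_in_image[OF that] in \<open>simp add: M_def\<close>)
    ultimately show ?thesis
      unfolding det_def' lessThan_atLeast0[symmetric] by (simp add: det_def' lessThan_atLeast0[symmetric])
  qed
  ultimately show ?thesis by simp
qed

end

section \<open>Holomorphic charts of the quadric\<close>

lemma has_derivative_vec_lambda: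
  fixes f :: "'n::finite \<Rightarrow> 'a::real_normed_vector \<Rightarrow> 'b::euclidean_space"
  assumes "\<And>i. (f i has_derivative f' i) (at x)"
  shows "((\<lambda>x. \<chi> i. f i x) has_derivative (\<lambda>h. \<chi> i. f' i h)) (at x)"
proof -
  have *: "(\<chi> i. y i) = (\<Sum>i\<in>UNIV. axis i (y i))" for y :: "'n \<Rightarrow> 'b"
    by (simp add: cart_eq_iff axis_def)
  show ?thesis unfolding *
    by (intro has_derivative_sum bounded_linear.has_derivative[OF bounded_linear_axis] assms)
qed

lemma has_derivative_exp_comp:
  fixes g :: "'a::real_normed_vector \<Rightarrow> complex"
  assumes "(g has_derivative g') (at x)"
  shows "((\<lambda>x. exp (g x)) has_derivative (\<lambda>h. exp (g x) * g' h)) (at x)"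
  using has_derivative_compose[OF assms, of exp "(*) (exp (g x))"] DERIV_exp[of "g x"]
  by (simp add: has_field_derivative_def)

definition of_null :: "complex \<Rightarrow> complex \<Rightarrow> complex \<Rightarrow> complex \<Rightarrow> complex \<Rightarrow> complex \<Rightarrow> complex^6" where
  "of_null w1 w2 w3 v1 v2 v3 = (\<chi> i. if i = 1 then (w1 + v1) / 2 else if i = 2 then \<i> * (v1 - w1) / 2
     else if i = 3 then (w2 + v2) / 2 else if i = 4 then \<i> * (v2 - w2) / 2
     else if i = 5 then (w3 + v3) / 2 else \<i> * (v3 - w3) / 2)"

lemma WV_of_null [simp]:
  "W1 (of_null w1 w2 w3 v1 v2 v3) = w1" "W2 (of_null w1 w2 w3 v1 v2 v3) = w2" "W3 (of_null w1 w2 w3 v1 v2 v3) = w3"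
  "V1 (of_null w1 w2 w3 v1 v2 v3) = v1" "V2 (of_null w1 w2 w3 v1 v2 v3) = v2" "V3 (of_null w1 w2 w3 v1 v2 v3) = v3"
  by (simp_all add: of_null_def WV_defs field_simps)

lemma vec_6_eqI: "(\<And>i. i \<in> {1, 2, 3, 4, 5, 6} \<Longrightarrow> x $ i = y $ i) \<Longrightarrow> x = (y :: 'a^6)"
  using UNIV_6 by (simp add: cart_eq_iff)

lemma of_null_WV [simp]: "of_null (W1 z) (W2 z) (W3 z) (V1 z) (V2 z) (V3 z) = z"
  by (rule vec_6_eqI) (auto simp: of_null_def WV_defs field_simps)

lemma WV_eqI:
  "W1 z = W1 z' \<Longrightarrow> W2 z = W2 z' \<Longrightarrow> W3 z = W3 z' \<Longrightarrow> V1 z = V1 z' \<Longrightarrow> V2 z = V2 z' \<Longrightarrow> V3 z = V3 z' \<Longrightarrow> z = z'"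
  by (metis of_null_WV)

lemma WV_linear [simp]:
  "W1 (x + y) = W1 x + W1 y" "W2 (x + y) = W2 x + W2 y" "W3 (x + y) = W3 x + W3 y"
  "V1 (x + y) = V1 x + V1 y" "V2 (x + y) = V2 x + V2 y" "V3 (x + y) = V3 x + V3 y"
  "W1 (c *s x) = c * W1 x" "W2 (c *s x) = c * W2 x" "W3 (c *s x) = c * W3 x"
  "V1 (c *s x) = c * V1 x" "V2 (c *s x) = c * V2 x" "V3 (c *s x) = c * V3 x"
  "W1 0 = 0" "W2 0 = 0" "W3 0 = 0" "V1 0 = 0" "V2 0 = 0" "V3 0 = 0"
  by (simp_all add: WV_defs algebra_simps)

lemma has_derivative_If_const:
  assumes "P \<Longrightarrow> (f has_derivative f') F" "\<not> P \<Longrightarrow> (g has_derivative g') F"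
  shows "((\<lambda>x. if P then f x else g x) has_derivative (\<lambda>h. if P then f' h else g' h)) F"
  using assms by (cases P) auto

lemma of_null_has_derivative:
  assumes "(w1 has_derivative w1') (at x)" "(w2 has_derivative w2') (at x)" "(w3 has_derivative w3') (at x)"
    "(v1 has_derivative v1') (at x)" "(v2 has_derivative v2') (at x)" "(v3 has_derivative v3') (at x)"
  shows "((\<lambda>x. of_null (w1 x) (w2 x) (w3 x) (v1 x) (v2 x) (v3 x)) has_derivative
    (\<lambda>h. of_null (w1' h) (w2' h) (w3' h) (v1' h) (v2' h) (v3' h))) (at x)"
  unfolding of_null_def
proof (rule has_derivative_vec_lambda)
  have p: "((\<lambda>x. (w x + v x) / 2) has_derivative (\<lambda>h. (w' h + v' h) / 2)) (at x)"
    "((\<lambda>x. \<i> * (v x - w x) / 2) has_derivative (\<lambda>h. \<i> * (v' h - w' h) / 2)) (at x)"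
    if "(w has_derivative w') (at x)" "(v has_derivative v') (at x)" for w w' v v' :: "'a \<Rightarrow> complex"
    using that by (auto intro!: derivative_eq_intros)
  fix i :: 6
  show "((\<lambda>x. if i = 1 then (w1 x + v1 x) / 2 else if i = 2 then \<i> * (v1 x - w1 x) / 2
     else if i = 3 then (w2 x + v2 x) / 2 else if i = 4 then \<i> * (v2 x - w2 x) / 2
     else if i = 5 then (w3 x + v3 x) / 2 else \<i> * (v3 x - w3 x) / 2) has_derivative
    (\<lambda>h. if i = 1 then (w1' h + v1' h) / 2 else if i = 2 then \<i> * (v1' h - w1' h) / 2
     else if i = 3 then (w2' h + v2' h) / 2 else if i = 4 then \<i> * (v2' h - w2' h) / 2
     else if i = 5 then (w3' h + v3' h) / 2 else \<i> * (v3' h - w3' h) / 2)) (at x)"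
    by (intro has_derivative_If_const p assms)
qed

text \<open>The case \<open>k = 1\<close> is adapted to the first Lagrangian, the case \<open>k = 0\<close> to the second one.\<close>

definition chart :: "complex \<Rightarrow> complex^5 \<Rightarrow> complex^6" where
  "chart k p = of_null (exp (p $ 0)) (exp (p $ 0) * p $ 1) (exp (k * p $ 0) * p $ 2)
     (exp (- (p $ 0)) * (1 - p $ 1 * p $ 3 - p $ 2 * p $ 4)) (exp (- (p $ 0)) * p $ 3)
     (exp (- (k * p $ 0)) * p $ 4)"

definition Dchart :: "complex \<Rightarrow> complex^5 \<Rightarrow> complex^5 \<Rightarrow> complex^6" where
  "Dchart k p h = of_null (exp (p $ 0) * h $ 0) (exp (p $ 0) * (h $ 0 * p $ 1 + h $ 1))
     (exp (k * p $ 0) * (k * h $ 0 * p $ 2 + h $ 2))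
     (exp (- (p $ 0)) * (- h $ 0 * (1 - p $ 1 * p $ 3 - p $ 2 * p $ 4)
        - (h $ 1 * p $ 3 + p $ 1 * h $ 3 + h $ 2 * p $ 4 + p $ 2 * h $ 4)))
     (exp (- (p $ 0)) * (- h $ 0 * p $ 3 + h $ 3))
     (exp (- (k * p $ 0)) * (- k * h $ 0 * p $ 4 + h $ 4))"

lemma exp_mult_minus [simp]:
  "exp a * (exp (- a) * b) = (b::complex)" "exp (- a) * (exp a * b) = (b::complex)"
  by (simp_all add: exp_minus)

lemma chart_in_quadric: "chart k p \<in> quadric"
proof -
  have "exp a * x * (exp (- a) * y) = x * y" for a x y :: complex
    by (simp add: mult.assoc mult.left_commute[of x])
  then show ?thesis
    by (simp only: quadric_iff_WV chart_def WV_of_null exp_mult_minus) simp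
qed

lemma chart_has_derivative: "(chart k has_derivative Dchart k p) (at p)"
proof -
  have c: "((\<lambda>p::complex^5. p $ i) has_derivative (\<lambda>h. h $ i)) (at p)" for i
    by (rule bounded_linear_imp_has_derivative[OF bounded_linear_vec_nth])
  have e: "((\<lambda>p::complex^5. exp (c * p $ 0)) has_derivative (\<lambda>h. exp (c * p $ 0) * (c * h $ 0))) (at p)" for c
    by (intro has_derivative_exp_comp has_derivative_mult_right c)
  have e': "((\<lambda>p::complex^5. exp (p $ 0)) has_derivative (\<lambda>h. exp (p $ 0) * h $ 0)) (at p)"
    "((\<lambda>p::complex^5. exp (- (p $ 0))) has_derivative (\<lambda>h. exp (- (p $ 0)) * (- h $ 0))) (at p)"
    "((\<lambda>p::complex^5. exp (- (k * p $ 0))) has_derivative (\<lambda>h. exp (- (k * p $ 0)) * (- k * h $ 0))) (at p)"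
    using e[of 1] e[of "-1"] e[of "-k"] by simp_all
  have "((\<lambda>p. chart k p) has_derivative (\<lambda>h. Dchart k p h)) (at p)"
    unfolding chart_def Dchart_def
    by (rule of_null_has_derivative;
        (rule derivative_eq_intros c e e' refl)+; simp add: fun_eq_iff algebra_simps)
  then show ?thesis by simp
qed

lemma Dchart_linear: "Dchart k p (c *s h) = c *s Dchart k p h" "Dchart k p (h + h') = Dchart k p h + Dchart k p h'"
  by (rule WV_eqI; simp add: Dchart_def algebra_simps)+

lemma Dchart_eq_0:
  assumes "Dchart k p h = 0"
  shows "h = 0"
proof -
  have "W1 (Dchart k p h) = 0" "W2 (Dchart k p h) = 0" "W3 (Dchart k p h) = 0"
    "V2 (Dchart k p h) = 0" "V3 (Dchart k p h) = 0"
    by (simp_all add: assms)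
  then show ?thesis by (simp add: Dchart_def cart_eq_iff forall_5)
qed

lemma Dchart_tangent: "Dchart k p h \<in> quadric_tangent (chart k p)"
proof -
  have "exp a * x * (exp (- a) * y) = x * y" "exp (- a) * x * (exp a * y) = x * y" for a x y :: complex
    by (simp_all add: mult.assoc mult.left_commute[of x])
  then show ?thesis
    by (simp only: quadric_tangent_iff_WV chart_def Dchart_def WV_of_null exp_mult_minus) (simp add: algebra_simps)
qed

lemma Dchart_inj: "inj (Dchart k p)"
proof (rule injI)
  fix h h' assume "Dchart k p h = Dchart k p h'"
  then have "Dchart k p (h + (-1) *s h') = 0" by (simp only: Dchart_linear) (simp add: cart_eq_iff)
  then have "h + (-1) *s h' = 0" by (rule Dchart_eq_0)
  then show "h = h'" by (simp add: cart_eq_iff)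
qed

lemma frechet_derivative_chart: "frechet_derivative (chart k) (at p) = Dchart k p"
  by (rule frechet_derivative_eqI[OF chart_has_derivative])

lemma holomorphic_immersion_chart: "holomorphic_immersion_quadric (chart k) UNIV"
  unfolding holomorphic_immersion_quadric_def holomorphic_fun_on_def
proof (intro conjI allI ballI)
  fix i and w :: "complex^5"
  have "((\<lambda>w. chart k w $ i) has_derivative (\<lambda>h. Dchart k w h $ i)) (at w)"
    by (rule bounded_linear.has_derivative[OF bounded_linear_vec_nth chart_has_derivative])
  moreover have "\<forall>s v. Dchart k w (s *s v) $ i = s * Dchart k w v $ i"
    by (simp add: Dchart_linear)
  ultimately show "\<exists>D. ((\<lambda>w. chart k w $ i) has_derivative D) (at w) \<and> (\<forall>s v. D (s *s v) = s * D v)"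
    by blast
qed (use chart_in_quadric Dchart_inj in \<open>auto simp: frechet_derivative_chart\<close>)

lemma coord_frame_chart: "coord_frame (chart k) p = (\<lambda>i. Dchart k p (axis (of_nat i) 1))"
  by (simp add: coord_frame_def frechet_derivative_chart)

section \<open>Holomorphic volume forms\<close>

text \<open>Differentiating the squared modulus makes \<open>F w\<close> orthogonal to
  \<open>D h\<close>. Inserting \<open>\<i> *s h\<close> makes it orthogonal to
  \<open>\<i> * D h\<close> as well, and in the complex plane this forces
  \<open>D h = 0\<close>.\<close>

lemma holomorphic_constant_norm:
  fixes F :: "complex^'n \<Rightarrow> complex"
  assumes hol: "holomorphic_fun_on F UNIV" and norm: "\<And>p. cmod (F p) = c"
  shows "F p = F q"
proof (cases "c = 0")
  case True
  then show ?thesis using norm by (metis norm_eq_zero)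
next
  case False
  have "(F has_derivative (\<lambda>h. 0)) (at w)" for w
  proof -
    obtain D where D: "(F has_derivative D) (at w)" "\<And>s v. D (s *s v) = s * D v"
      using hol unfolding holomorphic_fun_on_def by blast
    have "((\<lambda>p. F p \<bullet> F p) has_derivative (\<lambda>h. F w \<bullet> D h + D h \<bullet> F w)) (at w)"
      by (rule has_derivative_inner[OF D(1) D(1)])
    moreover have "(\<lambda>p. F p \<bullet> F p) = (\<lambda>p. c\<^sup>2)" using norm by (simp add: dot_square_norm)
    ultimately have "(\<lambda>h. F w \<bullet> D h + D h \<bullet> F w) = (\<lambda>h. 0)"
      using has_derivative_unique[OF _ has_derivative_const] by metis
    then have z: "F w \<bullet> D h = 0" for h by (metis inner_commute mult_2 mult_eq_0_iff zero_neq_numeral)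
    have "D h = 0" for h
    proof -
      have "F w \<bullet> D h = 0" "F w \<bullet> (\<i> * D h) = 0" using z[of h] z[of "\<i> *s h"] by (simp_all add: D(2))
      then have "cnj (F w) * D h = 0" by (simp add: inner_complex_def complex_eq_iff algebra_simps)
      moreover have "F w \<noteq> 0" using norm[of w] False by auto
      ultimately show ?thesis by simp
    qed
    then have "D = (\<lambda>h. 0)" by blast
    with D(1) show ?thesis by simp
  qed
  then show ?thesis
    using has_derivative_zero_constant[of UNIV F] by (metis UNIV_I convex_UNIV)
qed

lemma quadric_tangent_subspace:
  "0 \<in> quadric_tangent z" "a \<in> quadric_tangent z \<Longrightarrow> b \<in> quadric_tangent z \<Longrightarrow> a + b \<in> quadric_tangent z"
  "a \<in> quadric_tangent z \<Longrightarrow> s *s a \<in> quadric_tangent z"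
  by (simp_all add: quadric_tangent_def algebra_simps sum.distrib flip: sum_distrib_left)

locale stenzel_volume = stenzel +
  fixes \<Omega> :: "complex^6 \<Rightarrow> (complex^6) form"
  assumes volume: "stenzel_volume_form u \<Omega>"
begin

lemma alternating_Omega: "z \<in> quadric \<Longrightarrow> alternating_form 5 (quadric_tangent z) (\<Omega> z)"
  using volume quadric_tangent_subspace
  unfolding alternating_form_def stenzel_volume_form_def holomorphic_volume_form_def by auto

lemma norm_Omega_eq_det:
  assumes z: "z \<in> quadric" and f: "\<And>i. i < 5 \<Longrightarrow> f i \<in> quadric_tangent z"
  shows "of_real ((cmod (\<Omega> z f))\<^sup>2) =
    32 * (\<Sum>\<rho> | \<rho> permutes {..<5}. of_int (sign \<rho>) * (\<Prod>j<5. hform z (f j) (f (\<rho> j))))"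
proof -
  interpret alternating_form 5 "quadric_tangent z" "\<Omega> z" by (rule alternating_Omega[OF z])
  interpret type_11_form "quadric_tangent z" "\<Omega> z" "hform z"
    by unfold_locales (simp_all add: hform_simps)
  have "stenzel_form u z v w = \<i> * (hform z v w - hform z w v)" for v w
    by (rule stenzel_form_eq[OF r2_quadric_ge_1[OF z]])
  then have "\<Omega> z f * cnj (\<Omega> z f) =
    32 * (\<Sum>\<rho> | \<rho> permutes {..<5}. of_int (sign \<rho>) * (\<Prod>j<5. hform z (f j) (f (\<rho> j))))"
    using volume z f unfolding stenzel_volume_form_def by (intro norm_square_eq_det) auto
  then show ?thesis by (simp only: complex_norm_square)
qed

definition frame_value :: "complex \<Rightarrow> complex^5 \<Rightarrow> complex" where
  "frame_value k p = \<Omega> (chart k p) (coord_frame (chart k) p)"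

text \<open>The diagonal entries of the triangular frame multiply to \<open>exp (p $ 0)\<close>, the
  exponentials with \<open>k\<close> cancelling. This is also \<open>W1\<close> of the point, so the
  quotient in \<open>monge_ampere\<close> is 1 and \<open>32 * \<kappa> / 16\<close>
  remains.\<close>

lemma cmod_frame_value: "(cmod (frame_value k p))\<^sup>2 = 2 * \<kappa>"
proof -
  let ?f = "coord_frame (chart k) p"
  have j: "j < 5 \<longleftrightarrow> j \<in> {0, 1, 2, 3, 4}" for j :: nat by auto
  have tri: "null_coord i (?f j) = 0" if "i < j" "j < 5" for i j
    using that by (auto simp: j coord_frame_chart Dchart_def null_coord_def axis_def less_Suc_eq numeral_eq_Suc)
  have diag: "(\<Prod>j<5. null_coord j (?f j)) = exp (p $ 0)"
    by (simp add: eval_nat_numeral lessThan_Suc coord_frame_chart Dchart_def null_coord_def axis_def mult.assoc mult.left_commute)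
  have tang: "?f j \<in> quadric_tangent (chart k p)" for j
    by (simp add: coord_frame_chart Dchart_tangent)
  have W1: "W1 (chart k p) = exp (p $ 0)" by (simp add: chart_def)
  then have "W1 (chart k p) \<noteq> 0" by simp
  then have "of_real ((cmod (frame_value k p))\<^sup>2) = 32 * complex_of_real (\<kappa> / 16 *
      (cmod (\<Prod>j<5. null_coord j (?f j)) / cmod (W1 (chart k p)))\<^sup>2)"
    unfolding frame_value_def norm_Omega_eq_det[OF chart_in_quadric tang]
    by (subst monge_ampere[OF chart_in_quadric tang _ tri]) auto
  then have "complex_of_real ((cmod (frame_value k p))\<^sup>2) = of_real (2 * \<kappa>)"
    unfolding diag W1 by simp
  then show ?thesis by (simp only: of_real_eq_iff)
qed

lemma frame_value_constant: "frame_value k p = frame_value k q"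
proof (rule holomorphic_constant_norm)
  show "holomorphic_fun_on (frame_value k) UNIV"
    using volume holomorphic_immersion_chart[of k]
    unfolding stenzel_volume_form_def holomorphic_volume_form_def frame_value_def by blast
  show "cmod (frame_value k p) = sqrt (2 * \<kappa>)" for p
    using cmod_frame_value[of k p] by (metis norm_ge_zero real_sqrt_unique)
qed

text \<open>At the origin charts with different \<open>k\<close> agree together with their
  differentials, so the constants coincide.\<close>

lemma frame_value_eq: "frame_value k p = frame_value k' q"
proof -
  have z: "exp (k * 0) = 1" for k :: complex by simp
  have "chart k 0 = chart k' 0" by (simp add: chart_def)
  moreover have "Dchart k 0 h = Dchart k' 0 h" for h by (simp add: Dchart_def)
  ultimately have "frame_value k 0 = frame_value k' 0" by (simp add: frame_value_def coord_frame_chart)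
  then show ?thesis using frame_value_constant by metis
qed

end

section \<open>Further closure properties of k times differentiable maps\<close>

lemma Ck_on_diff:
  assumes "open S" "Ck_on k f S" "Ck_on k g S"
  shows "Ck_on k (\<lambda>x. f x - g x) S"
  using Ck_on_add[OF assms(1,2) Ck_on_linear_comp[OF bounded_linear_minus[OF bounded_linear_ident] assms(1,3)]]
  by simp

lemma Ck_on_exp_comp:
  fixes g :: "'a::euclidean_space \<Rightarrow> 'b::{real_normed_field,banach,euclidean_space}"
  assumes "open S" "Ck_on k g S"
  shows "Ck_on k (\<lambda>x. exp (g x)) S"
  using Ck_on_comp[OF assms(1) open_UNIV _ Ck_on_exp assms(2)] by simp

lemma Ck_on_If_const:
  assumes "P \<Longrightarrow> Ck_on k f S" "\<not> P \<Longrightarrow> Ck_on k g S"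
  shows "Ck_on k (\<lambda>x. if P then f x else g x) S"
  using assms by (cases P) auto

section \<open>Real slices\<close>

text \<open>The flag \<open>c\<close> selects the Lagrangian: \<open>True\<close> for the first one, \<open>False\<close> for the second one.\<close>

definition chart_weight :: "bool \<Rightarrow> complex" where "chart_weight c = (if c then 1 else 0)"

text \<open>\<open>\<sigma>\<close> is the logarithm of the modulus of \<open>W1\<close> and
  \<open>q $ 0\<close> its angle. In the second case the entries 2 and 4 jointly encode
  \<open>V3 = - cnj W3\<close>.\<close>

definition slice :: "bool \<Rightarrow> real \<Rightarrow> real^5 \<Rightarrow> complex^5" where
  "slice c \<sigma> q = (\<chi> i. if i = 0 then Complex \<sigma> (q $ 0)
     else if i = 2 then (if c then of_real (q $ 2) else Complex (q $ 2) (q $ 4))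
     else if i = 4 then (if c then of_real (q $ 4) else Complex (- (q $ 2)) (q $ 4))
     else of_real (q $ i))"

lemma slice_nth [simp]:
  "slice c \<sigma> q $ 0 = Complex \<sigma> (q $ 0)" "slice c \<sigma> q $ 1 = of_real (q $ 1)"
  "slice c \<sigma> q $ 2 = (if c then of_real (q $ 2) else Complex (q $ 2) (q $ 4))"
  "slice c \<sigma> q $ 3 = of_real (q $ 3)"
  "slice c \<sigma> q $ 4 = (if c then of_real (q $ 4) else Complex (- (q $ 2)) (q $ 4))"
  by (simp_all add: slice_def)

definition slice_point :: "bool \<Rightarrow> real \<Rightarrow> real^5 \<Rightarrow> complex^6" where
  "slice_point c \<sigma> q = chart (chart_weight c) (slice c \<sigma> q)"

definition real_weight :: "bool \<Rightarrow> real" where "real_weight c = (if c then 1 else 0)"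

text \<open>In the second case the common value of the squared moduli of \<open>W3\<close> and
  \<open>V3\<close>: it enters \<open>r2\<close> but cancels in the moment map. It is 0 in the first
  case.\<close>

definition slice_m :: "bool \<Rightarrow> real^5 \<Rightarrow> real" where
  "slice_m c q = (1 - real_weight c) * (q $ 2 * q $ 2 + q $ 4 * q $ 4)"

text \<open>This is the product \<open>W1 * V1\<close>, which is real on the slice.\<close>

definition slice_n :: "bool \<Rightarrow> real^5 \<Rightarrow> real" where
  "slice_n c q = 1 + slice_m c q - q $ 1 * q $ 3 - real_weight c * (q $ 2 * q $ 4)"

definition slice_A :: "bool \<Rightarrow> real^5 \<Rightarrow> real" where
  "slice_A c q = 1 + q $ 1 * q $ 1 + real_weight c * (q $ 2 * q $ 2)"

definition slice_B :: "bool \<Rightarrow> real^5 \<Rightarrow> real" where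
  "slice_B c q = slice_n c q * slice_n c q + q $ 3 * q $ 3 + real_weight c * (q $ 4 * q $ 4)"

lemma slice_m_nonneg: "slice_m c q \<ge> 0"
  by (simp add: slice_m_def real_weight_def)

text \<open>Lagrange's identity for the vectors \<open>(1, q1, q2)\<close> and
  \<open>(n, q3, q4)\<close>, whose last entries count in the first case only. By the quadric
  equation their scalar product is \<open>1 + m\<close>.\<close>

lemma slice_A_slice_B_ge: "slice_A c q * slice_B c q \<ge> (1 + slice_m c q)\<^sup>2"
proof -
  have "slice_A c q * slice_B c q = (slice_n c q + q $ 1 * q $ 3 + real_weight c * (q $ 2 * q $ 4))\<^sup>2 + (q $ 3 - q $ 1 * slice_n c q)\<^sup>2
      + real_weight c * ((q $ 4 - q $ 2 * slice_n c q)\<^sup>2 + (q $ 1 * q $ 4 - q $ 2 * q $ 3)\<^sup>2)"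
    by (cases c) (simp_all add: slice_A_def slice_B_def real_weight_def power2_eq_square algebra_simps)
  moreover have "slice_n c q + q $ 1 * q $ 3 + real_weight c * (q $ 2 * q $ 4) = 1 + slice_m c q" by (simp add: slice_n_def)
  ultimately show ?thesis by (simp add: real_weight_def)
qed

section \<open>The squared norm and the moment map on a slice\<close>

lemma r2_WV: "r2 z = ((cmod (W1 z))\<^sup>2 + (cmod (W2 z))\<^sup>2 + (cmod (W3 z))\<^sup>2 +
  (cmod (V1 z))\<^sup>2 + (cmod (V2 z))\<^sup>2 + (cmod (V3 z))\<^sup>2) / 2"
proof -
  have "complex_of_real (r2 z) = of_real (((cmod (W1 z))\<^sup>2 + (cmod (W2 z))\<^sup>2 + (cmod (W3 z))\<^sup>2 +
    (cmod (V1 z))\<^sup>2 + (cmod (V2 z))\<^sup>2 + (cmod (V3 z))\<^sup>2) / 2)"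
    unfolding herm_self[symmetric] herm_WV by (simp add: complex_norm_square del: of_real_power)
  then show ?thesis by (simp only: of_real_eq_iff)
qed

definition null_diff :: "complex^6 \<Rightarrow> real" where
  "null_diff z = ((cmod (W1 z))\<^sup>2 + (cmod (W2 z))\<^sup>2 + (cmod (W3 z))\<^sup>2 -
    (cmod (V1 z))\<^sup>2 - (cmod (V2 z))\<^sup>2 - (cmod (V3 z))\<^sup>2) / 2"

definition slice_rho :: "bool \<Rightarrow> real \<times> (real^5) \<Rightarrow> real" where
  "slice_rho c x = (exp (2 * fst x) * slice_A c (snd x) + exp (- 2 * fst x) * slice_B c (snd x)) / 2 + slice_m c (snd x)"

definition slice_q :: "bool \<Rightarrow> real \<times> (real^5) \<Rightarrow> real" where
  "slice_q c x = (exp (2 * fst x) * slice_A c (snd x) - exp (- 2 * fst x) * slice_B c (snd x)) / 2"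

lemma slice_point_norms:
  "(cmod (W1 (slice_point c \<sigma> q)))\<^sup>2 = exp (2 * \<sigma>)"
  "(cmod (W2 (slice_point c \<sigma> q)))\<^sup>2 = exp (2 * \<sigma>) * (q $ 1)\<^sup>2"
  "(cmod (W3 (slice_point c \<sigma> q)))\<^sup>2 = (if c then exp (2 * \<sigma>) * (q $ 2)\<^sup>2 else slice_m c q)"
  "(cmod (V1 (slice_point c \<sigma> q)))\<^sup>2 = exp (- 2 * \<sigma>) * (slice_n c q)\<^sup>2"
  "(cmod (V2 (slice_point c \<sigma> q)))\<^sup>2 = exp (- 2 * \<sigma>) * (q $ 3)\<^sup>2"
  "(cmod (V3 (slice_point c \<sigma> q)))\<^sup>2 = (if c then exp (- 2 * \<sigma>) * (q $ 4)\<^sup>2 else slice_m c q)"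
proof -
  have e: "(exp x)\<^sup>2 = exp (2 * x)" for x :: real by (simp add: exp_double)
  have cc: "cmod (Complex a b) * cmod (Complex a b) = a * a + b * b" for a b by (simp add: cmod_def flip: power2_eq_square)
  have n: "1 - slice c \<sigma> q $ 1 * slice c \<sigma> q $ 3 - slice c \<sigma> q $ 2 * slice c \<sigma> q $ 4 = of_real (slice_n c q)"
    by (cases c) (simp_all add: slice_n_def slice_m_def real_weight_def complex_eq_iff algebra_simps)
  show "(cmod (V1 (slice_point c \<sigma> q)))\<^sup>2 = exp (- 2 * \<sigma>) * (slice_n c q)\<^sup>2"
    unfolding slice_point_def chart_def WV_of_null n by (simp add: norm_mult power_mult_distrib e)
  show "(cmod (W1 (slice_point c \<sigma> q)))\<^sup>2 = exp (2 * \<sigma>)"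
    "(cmod (W2 (slice_point c \<sigma> q)))\<^sup>2 = exp (2 * \<sigma>) * (q $ 1)\<^sup>2"
    "(cmod (V2 (slice_point c \<sigma> q)))\<^sup>2 = exp (- 2 * \<sigma>) * (q $ 3)\<^sup>2"
    "(cmod (W3 (slice_point c \<sigma> q)))\<^sup>2 = (if c then exp (2 * \<sigma>) * (q $ 2)\<^sup>2 else slice_m c q)"
    "(cmod (V3 (slice_point c \<sigma> q)))\<^sup>2 = (if c then exp (- 2 * \<sigma>) * (q $ 4)\<^sup>2 else slice_m c q)"
    by (auto simp: cc slice_point_def chart_def chart_weight_def norm_mult power_mult_distrib slice_m_def real_weight_def
        power2_eq_square mult_exp_exp algebra_simps)
qed

lemma r2_slice_point: "r2 (slice_point c \<sigma> q) = slice_rho c (\<sigma>, q)"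
  unfolding r2_WV slice_point_norms slice_rho_def slice_A_def slice_B_def
  by (simp add: real_weight_def slice_m_def power2_eq_square field_simps)

lemma null_diff_slice_point: "null_diff (slice_point c \<sigma> q) = slice_q c (\<sigma>, q)"
  unfolding null_diff_def slice_point_norms slice_q_def slice_A_def slice_B_def
  by (simp add: real_weight_def slice_m_def power2_eq_square field_simps)

lemma slice_point_in_quadric: "slice_point c \<sigma> q \<in> quadric"
  by (simp add: slice_point_def chart_in_quadric)

lemma slice_rho_ge_1: "slice_rho c x \<ge> 1"
  using r2_quadric_ge_1[OF slice_point_in_quadric, of c "fst x" "snd x"] by (simp add: r2_slice_point)

lemmas Ck_intros = Ck_on_mult Ck_on_add Ck_on_diff Ck_on_const Ck_on_exp_comp Ck_on_If_const

lemma Ck_on_slice_functions: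
  "Ck_on k (\<lambda>x. slice_rho c x) UNIV" "Ck_on k (\<lambda>x. slice_q c x) UNIV"
proof -
  have l: "Ck_on k (\<lambda>x::real \<times> (real^5). fst x) UNIV" "Ck_on k (\<lambda>x::real \<times> (real^5). snd x $ i) UNIV" for i
    by (intro Ck_on_linear open_UNIV bounded_linear_fst bounded_linear_compose[OF bounded_linear_vec_nth bounded_linear_snd])+
  show "Ck_on k (\<lambda>x. slice_rho c x) UNIV" "Ck_on k (\<lambda>x. slice_q c x) UNIV"
    unfolding slice_rho_def slice_q_def slice_A_def slice_B_def slice_n_def slice_m_def divide_inverse
    by (intro Ck_intros open_UNIV l)+
qed

context stenzel
begin

definition moment :: "complex^6 \<Rightarrow> real" where
  "moment z = u1 (r2 z) * null_diff z"

definition slice_moment :: "bool \<Rightarrow> real \<times> (real^5) \<Rightarrow> real" where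
  "slice_moment c x = u1 (slice_rho c x) * slice_q c x"

lemma moment_slice_point: "moment (slice_point c \<sigma> q) = slice_moment c (\<sigma>, q)"
  by (simp add: moment_def slice_moment_def r2_slice_point null_diff_slice_point)

lemma smooth_slice_moment: "smooth_on (slice_moment c) UNIV"
proof -
  have "Ck_on k (\<lambda>x. u1 (slice_rho c x) * slice_q c x) UNIV" for k
    using smooth_u1 S slice_rho_ge_1[of c] unfolding smooth_on_def
    by (intro Ck_on_mult open_UNIV Ck_on_slice_functions Ck_on_comp[OF open_UNIV S(1) _ _ Ck_on_slice_functions(1)]) auto
  then show ?thesis by (simp add: smooth_on_def slice_moment_def[abs_def])
qed

text \<open>For negative \<open>u2 \<rho>\<close> the inequality
  \<open>\<rho> * Q\<^sup>2 \<le> P * (\<rho>\<^sup>2 - 1)\<close> reduces the claim to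
  \<open>u2_bound\<close>. It is the hypothesis on \<open>Q\<close> when \<open>m = 0\<close>, and a
  positive \<open>m\<close> only enlarges the gap.\<close>

lemma u2_bound_slice:
  assumes "\<rho> = P + m" "m \<ge> 0" "Q\<^sup>2 \<le> P\<^sup>2 - (1 + m)\<^sup>2" "P > 0" "\<rho> \<ge> 1"
  shows "u1 \<rho> * P + u2 \<rho> * Q\<^sup>2 > 0"
proof (cases "u2 \<rho> \<ge> 0")
  case True
  have "u1 \<rho> * P > 0" using u1_pos[OF assms(5)] assms(4) by simp
  moreover have "u2 \<rho> * Q\<^sup>2 \<ge> 0" using True by simp
  ultimately show ?thesis by linarith
next
  case False
  have "\<rho> * (P\<^sup>2 - (1 + m)\<^sup>2) - P * (\<rho>\<^sup>2 - 1) = - (m * P\<^sup>2 + 2 * m * P + 2 * m\<^sup>2 * P + m * (1 + m)\<^sup>2)"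
    unfolding assms(1) by (simp add: power2_eq_square algebra_simps)
  also have "0 \<le> m * P\<^sup>2 + 2 * m * P + 2 * m\<^sup>2 * P + m * (1 + m)\<^sup>2"
    by (intro add_nonneg_nonneg mult_nonneg_nonneg) (use assms in auto)
  then have "- (m * P\<^sup>2 + 2 * m * P + 2 * m\<^sup>2 * P + m * (1 + m)\<^sup>2) \<le> 0" by linarith
  finally have le: "\<rho> * (P\<^sup>2 - (1 + m)\<^sup>2) \<le> P * (\<rho>\<^sup>2 - 1)" by simp
  have "\<rho> * Q\<^sup>2 \<le> \<rho> * (P\<^sup>2 - (1 + m)\<^sup>2)" using assms(3,5) by (intro mult_left_mono) auto
  with le have "\<rho> * Q\<^sup>2 \<le> P * (\<rho>\<^sup>2 - 1)" by linarith
  then have "u2 \<rho> * (\<rho> * Q\<^sup>2) \<ge> u2 \<rho> * (P * (\<rho>\<^sup>2 - 1))" using False by (intro mult_left_mono_neg) auto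
  moreover have "P * (u1 \<rho> * \<rho> + u2 \<rho> * (\<rho>\<^sup>2 - 1)) > 0" using u2_bound[OF assms(5)] assms(4) by simp
  ultimately have "\<rho> * (u1 \<rho> * P + u2 \<rho> * Q\<^sup>2) > 0" by (simp add: algebra_simps)
  then show ?thesis using assms(5) by (simp add: zero_less_mult_iff)
qed

text \<open>In the direction of \<sigma>, \<open>slice_rho - slice_m\<close> and
  \<open>slice_q\<close> differentiate into twice each other like cosh and sinh, with
  \<open>?P\<^sup>2 - slice_q\<^sup>2 = A * B\<close>. With \<open>slice_A_slice_B_ge\<close> this
  is the situation of \<open>u2_bound_slice\<close>.\<close>

lemma slice_moment_derivative_pos: "frechet_derivative (slice_moment c) (at x) (1, 0) > 0"
proof -
  obtain \<sigma> q where x: "x = (\<sigma>, q)" by fastforce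
  have 1: "((\<lambda>s. slice_rho c (s, q)) has_real_derivative 2 * slice_q c (\<sigma>, q)) (at \<sigma>)"
    unfolding slice_rho_def slice_q_def by (auto intro!: derivative_eq_intros)
  have 2: "((\<lambda>s. slice_q c (s, q)) has_real_derivative 2 * (slice_rho c (\<sigma>, q) - slice_m c q)) (at \<sigma>)"
    unfolding slice_rho_def slice_q_def by (auto intro!: derivative_eq_intros)
  have 3: "((\<lambda>s. slice_moment c (s, q)) has_real_derivative
      u2 (slice_rho c (\<sigma>, q)) * (2 * slice_q c (\<sigma>, q)) * slice_q c (\<sigma>, q) + 2 * (slice_rho c (\<sigma>, q) - slice_m c q) * u1 (slice_rho c (\<sigma>, q))) (at \<sigma>)"
    unfolding slice_moment_def
    by (rule DERIV_mult DERIV_chain2[OF has_deriv_u1[OF ge_1_in_S[OF slice_rho_ge_1]] 1] 2)+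
  have "((\<lambda>s. (s, q)) has_derivative (\<lambda>h. (h, 0))) (at \<sigma>)"
    by (auto intro!: derivative_eq_intros)
  from has_derivative_compose[OF this smooth_on_has_derivative[OF smooth_slice_moment UNIV_I]]
  have "((\<lambda>s. slice_moment c (s, q)) has_derivative (\<lambda>h. frechet_derivative (slice_moment c) (at (\<sigma>, q)) (h, 0))) (at \<sigma>)" .
  from has_derivative_unique[OF this 3[unfolded has_field_derivative_def]]
  have "frechet_derivative (slice_moment c) (at x) (1, 0) =
      2 * (u1 (slice_rho c x) * (slice_rho c x - slice_m c q) + u2 (slice_rho c x) * (slice_q c x)\<^sup>2)"
    unfolding x by (auto simp: fun_eq_iff power2_eq_square algebra_simps dest!: spec[of _ 1])
  also have "\<dots> > 0"
  proof -
    let ?P = "slice_rho c x - slice_m c q"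
    have A: "slice_A c q > 0" unfolding slice_A_def real_weight_def by (auto intro!: add_pos_nonneg)
    have "slice_A c q * slice_B c q > 0" using slice_A_slice_B_ge[of c q] slice_m_nonneg[of c q] by (smt (verit) zero_less_power)
    then have "slice_B c q > 0" using A by (simp add: zero_less_mult_iff)
    then have P: "?P > 0" using A unfolding slice_rho_def x by (auto intro!: add_pos_pos)
    have "?P\<^sup>2 - (slice_q c x)\<^sup>2 = exp (2 * \<sigma>) * exp (- 2 * \<sigma>) * (slice_A c q * slice_B c q)"
      unfolding slice_rho_def slice_q_def x by (simp add: power2_eq_square field_simps)
    also have "exp (2 * \<sigma>) * exp (- 2 * \<sigma>) = 1" by (simp add: mult_exp_exp)
    finally have "(slice_q c x)\<^sup>2 \<le> ?P\<^sup>2 - (1 + slice_m c q)\<^sup>2" using slice_A_slice_B_ge[of c q] by simp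
    then have "u1 (slice_rho c x) * ?P + u2 (slice_rho c x) * (slice_q c x)\<^sup>2 > 0"
      by (intro u2_bound_slice[where m = "slice_m c q"]) (use P in \<open>auto simp: slice_m_nonneg slice_rho_ge_1\<close>)
    then show ?thesis by simp
  qed
  finally show ?thesis .
qed

end

section \<open>Local parametrizations\<close>

lemma slice_linear:
  "slice c (\<sigma> + \<sigma>') (q + q') = slice c \<sigma> q + slice c \<sigma>' q'"
  "slice c (r * \<sigma>) (r *\<^sub>R q) = r *\<^sub>R slice c \<sigma> q"
  by (simp_all add: cart_eq_iff forall_5 complex_eq_iff)

lemma bounded_linear_slice: "bounded_linear (\<lambda>x. slice c (fst x) (snd x))"
  by (rule linear_conv_bounded_linear[THEN iffD1], rule linearI) (simp_all add: slice_linear)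

lemma smooth_chart: "smooth_on (chart k) UNIV"
proof -
  have l: "Ck_on n (\<lambda>p::complex^5. p $ i) UNIV" for n i
    by (intro Ck_on_linear open_UNIV bounded_linear_vec_nth)
  have m: "Ck_on n (\<lambda>p. - f p) UNIV" if "Ck_on n f UNIV" for n and f :: "complex^5 \<Rightarrow> complex"
    using Ck_on_linear_comp[OF bounded_linear_minus[OF bounded_linear_ident] open_UNIV that] .
  have "Ck_on n (\<lambda>p. chart k p) UNIV" for n
    unfolding chart_def of_null_def divide_inverse
    by (intro Ck_on_vec Ck_intros open_UNIV l m)
  then show ?thesis by (simp add: smooth_on_def)
qed

lemma bounded_linear_WV:
  "bounded_linear W1" "bounded_linear W2" "bounded_linear W3" "bounded_linear V1" "bounded_linear V2" "bounded_linear V3"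
proof -
  have s: "r *\<^sub>R z = complex_of_real r *s z" for r and z :: "complex^6"
    by (simp add: cart_eq_iff) (simp add: scaleR_conv_of_real)
  have c: "r *\<^sub>R x = complex_of_real r * x" for r x by (rule scaleR_conv_of_real)
  show "bounded_linear W1" "bounded_linear W2" "bounded_linear W3" "bounded_linear V1" "bounded_linear V2" "bounded_linear V3"
    by (rule linear_conv_bounded_linear[THEN iffD1], rule linearI; simp only: s c WV_linear)+
qed

lemmas WV_has_derivative = bounded_linear_WV[THEN bounded_linear_imp_has_derivative]

text \<open>A description without the angle: the quotients by \<open>W1\<close>, the products with
  \<open>W1\<close> and the relation \<open>V3 = - cnj W3\<close> are all unaffected by the
  circle.\<close>

definition real_slice :: "bool \<Rightarrow> complex^6 \<Rightarrow> bool" where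
  "real_slice c z \<longleftrightarrow> Im (W2 z / W1 z) = 0 \<and> Im (V2 z * W1 z) = 0 \<and>
    (if c then Im (W3 z / W1 z) = 0 \<and> Im (V3 z * W1 z) = 0 else V3 z = - cnj (W3 z))"

definition slice_coords :: "bool \<Rightarrow> real \<Rightarrow> complex^6 \<Rightarrow> real^5" where
  "slice_coords c t z = (\<chi> i. if i = 0 then t else if i = 1 then Re (W2 z / W1 z)
     else if i = 2 then (if c then Re (W3 z / W1 z) else Re (W3 z))
     else if i = 3 then Re (V2 z * W1 z) else (if c then Re (V3 z * W1 z) else Im (W3 z)))"

lemma slice_coords_nth [simp]: "slice_coords c t z $ 0 = t" "slice_coords c t z $ 1 = Re (W2 z / W1 z)"
  "slice_coords c t z $ 2 = (if c then Re (W3 z / W1 z) else Re (W3 z))" "slice_coords c t z $ 3 = Re (V2 z * W1 z)"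
  "slice_coords c t z $ 4 = (if c then Re (V3 z * W1 z) else Im (W3 z))"
  by (simp_all add: slice_coords_def)

lemma WV_slice_point:
  "W1 (slice_point c \<sigma> q) = exp (Complex \<sigma> (q $ 0))" "W2 (slice_point c \<sigma> q) = exp (Complex \<sigma> (q $ 0)) * of_real (q $ 1)"
  "V2 (slice_point c \<sigma> q) = exp (- Complex \<sigma> (q $ 0)) * of_real (q $ 3)"
  "W3 (slice_point c \<sigma> q) = (if c then exp (Complex \<sigma> (q $ 0)) * of_real (q $ 2) else Complex (q $ 2) (q $ 4))"
  "V3 (slice_point c \<sigma> q) = (if c then exp (- Complex \<sigma> (q $ 0)) * of_real (q $ 4) else Complex (- (q $ 2)) (q $ 4))"
  by (simp_all add: slice_point_def chart_def chart_weight_def)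

lemma real_slice_slice_point: "real_slice c (slice_point c \<sigma> q)"
proof -
  have e: "exp (- a) * b * exp a = (b::complex)" for a b by (simp add: exp_minus)
  show ?thesis
    by (cases c; simp only: real_slice_def WV_slice_point e if_True if_False; simp add: complex_eq_iff)
qed

lemma slice_coords_slice_point: "slice_coords c t (slice_point c \<sigma> q) = (\<chi> i. if i = 0 then t else q $ i)"
proof -
  have e: "exp (- a) * b * exp a = (b::complex)" for a b by (simp add: exp_minus)
  show ?thesis
    by (cases c; simp only: cart_eq_iff forall_5 slice_coords_nth WV_slice_point e if_True if_False; simp)
qed

text \<open>Five null coordinates are recovered directly; \<open>V1\<close> then follows from the
  quadric equation because \<open>W1\<close> is nonzero.\<close>

lemma slice_point_slice_coords:
  assumes z: "z \<in> quadric" and real: "real_slice c z" and W1: "W1 z = exp (Complex \<sigma> t)"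
  shows "slice_point c \<sigma> (slice_coords c t z) = z"
proof -
  let ?p = "slice_point c \<sigma> (slice_coords c t z)"
  have ne: "W1 z \<noteq> 0" using W1 by simp
  have E: "exp (- Complex \<sigma> t) = 1 / W1 z" by (simp add: W1 exp_minus field_simps)
  have r: "of_real (Re x) = x" if "Im x = 0" for x using that by (simp add: complex_eq_iff)
  have 1: "W1 ?p = W1 z" by (simp add: WV_slice_point W1)
  have 2: "W2 ?p = W2 z" using real ne r[of "W2 z / W1 z"] by (simp add: WV_slice_point real_slice_def flip: W1)
  have 3: "V2 ?p = V2 z" using real ne r[of "V2 z * W1 z"] by (simp add: WV_slice_point real_slice_def E)
  have 4: "W3 ?p = W3 z"
    using real ne r[of "W3 z / W1 z"] by (cases c) (simp_all add: WV_slice_point real_slice_def flip: W1)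
  have 5: "V3 ?p = V3 z"
  proof (cases c)
    case True
    then show ?thesis using real ne r[of "V3 z * W1 z"] by (simp add: WV_slice_point real_slice_def E del: times_complex.sel)
  next
    case False
    then show ?thesis using real by (simp add: WV_slice_point real_slice_def complex_eq_iff)
  qed
  have "W1 z * V1 ?p = W1 z * V1 z"
    using z slice_point_in_quadric[of c \<sigma> "slice_coords c t z"] unfolding quadric_iff_WV 1 2 3 4 5
    by (metis add_right_cancel)
  then have "V1 ?p = V1 z" using ne by simp
  with 1 2 3 4 5 show ?thesis by (intro WV_eqI)
qed

section \<open>A differentiable left inverse of the parametrization on an open set\<close>

lemma Re_differentiable: "(g has_derivative g') (at z) \<Longrightarrow> (\<lambda>z. Re (g z)) differentiable at z"
  "(g has_derivative g') (at z) \<Longrightarrow> (\<lambda>z. Im (g z)) differentiable at z"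
  unfolding differentiable_def
  using bounded_linear.has_derivative[OF bounded_linear_Re] bounded_linear.has_derivative[OF bounded_linear_Im]
  by blast+

lemma differentiable_vec_lambda:
  fixes f :: "'n::finite \<Rightarrow> 'a::real_normed_vector \<Rightarrow> 'b::euclidean_space"
  assumes "\<And>i. f i differentiable at x"
  shows "(\<lambda>x. \<chi> i. f i x) differentiable at x"
proof -
  have "\<forall>i. \<exists>D. (f i has_derivative D) (at x)" using assms by (simp add: differentiable_def)
  then obtain D where "\<And>i. (f i has_derivative D i) (at x)" by metis
  from has_derivative_vec_lambda[OF this] show ?thesis by (rule differentiableI)
qed

text \<open>The angle is read from the branch of the logarithm centred at \<open>t\<close>. The
  formula makes sense off the Lagrangian too, so it can be differentiated in the ambient
  space.\<close>

definition coords :: "bool \<Rightarrow> real \<Rightarrow> complex^6 \<Rightarrow> real^5" where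
  "coords c t z = slice_coords c (Im (Ln (W1 z * exp (Complex 0 (- t)))) + t) z"

text \<open>Removes the points where \<open>W1\<close> vanishes or has the angle opposite to
  \<open>t\<close>.\<close>

definition slit :: "real \<Rightarrow> (complex^6) set" where
  "slit t = {z. W1 z * exp (Complex 0 (- t)) \<notin> \<real>\<^sub>\<le>\<^sub>0}"

lemma open_slit: "open (slit t)"
proof -
  have "open ((\<lambda>z. W1 z * exp (Complex 0 (- t))) -` (- \<real>\<^sub>\<le>\<^sub>0))"
    using linear_continuous_on[OF bounded_linear_WV(1)]
    by (intro open_vimage continuous_intros) (auto intro: open_Compl)
  then show ?thesis by (simp add: slit_def vimage_def)
qed

lemma slit_nonzero: "z \<in> slit t \<Longrightarrow> W1 z \<noteq> 0"
  by (auto simp: slit_def)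

lemma slit_exp:
  assumes "W1 z = exp (Complex \<sigma> s)" "\<bar>s - t\<bar> < pi"
  shows "z \<in> slit t" "Ln (W1 z * exp (Complex 0 (- t))) = Complex \<sigma> (s - t)"
proof -
  have e: "W1 z * exp (Complex 0 (- t)) = exp (Complex \<sigma> (s - t))"
    unfolding assms(1) mult_exp_exp by (rule arg_cong[of _ _ exp]) (simp add: complex_eq_iff)
  show L: "Ln (W1 z * exp (Complex 0 (- t))) = Complex \<sigma> (s - t)"
    unfolding e by (rule Ln_exp) (use assms(2) in auto)
  show "z \<in> slit t"
  proof (rule ccontr)
    assume "z \<notin> slit t"
    then have n: "W1 z * exp (Complex 0 (- t)) \<in> \<real>\<^sub>\<le>\<^sub>0" by (simp add: slit_def)
    have nz: "W1 z * exp (Complex 0 (- t)) \<noteq> 0" by (simp add: assms(1))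
    have "Im (Ln (W1 z * exp (Complex 0 (- t)))) = pi"
      using n nz by (subst Im_Ln_eq_pi) (auto simp: complex_nonpos_Reals_iff complex_eq_iff less_le)
    then show False using assms(2) by (simp add: L)
  qed
qed

lemma slit_obtain:
  assumes "z \<in> slit t"
  obtains \<sigma> s where "W1 z = exp (Complex \<sigma> s)" "\<bar>s - t\<bar> < pi"
proof -
  let ?w = "W1 z * exp (Complex 0 (- t))"
  have n: "?w \<notin> \<real>\<^sub>\<le>\<^sub>0" using assms by (simp add: slit_def)
  then have nz: "?w \<noteq> 0" by auto
  have "Im (Ln ?w) \<noteq> pi" using n nz by (subst Im_Ln_eq_pi) (auto simp: complex_nonpos_Reals_iff)
  then have "\<bar>Im (Ln ?w)\<bar> < pi" using mpi_less_Im_Ln[OF nz] Im_Ln_le_pi[OF nz] by auto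
  moreover have "W1 z = exp (Complex (Re (Ln ?w)) (Im (Ln ?w) + t))"
  proof -
    have "Complex (Re (Ln ?w)) (Im (Ln ?w) + t) = Ln ?w + Complex 0 t" by (simp add: complex_eq_iff)
    then have "exp (Complex (Re (Ln ?w)) (Im (Ln ?w) + t)) = ?w * exp (Complex 0 t)"
      using nz by (simp add: exp_add)
    also have "\<dots> = W1 z * exp (Complex 0 (- t) + Complex 0 t)" by (simp only: mult.assoc mult_exp_exp)
    also have "Complex 0 (- t) + Complex 0 t = 0" by (simp add: complex_eq_iff)
    finally show ?thesis by simp
  qed
  ultimately show ?thesis using that[of "Re (Ln ?w)" "Im (Ln ?w) + t"] by simp
qed

lemma coords_differentiable:
  assumes "z \<in> slit t"
  shows "coords c t differentiable at z"
proof -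
  have nz: "W1 z \<noteq> 0" using slit_nonzero[OF assms] .
  have "((\<lambda>z. W1 z * exp (Complex 0 (- t))) has_derivative (\<lambda>h. W1 h * exp (Complex 0 (- t)))) (at z)"
    by (intro has_derivative_mult_left WV_has_derivative)
  from has_derivative_compose[OF this has_field_derivative_Ln[unfolded has_field_derivative_def]] assms
  have L: "((\<lambda>z. Ln (W1 z * exp (Complex 0 (- t)))) has_derivative
      (\<lambda>h. inverse (W1 z * exp (Complex 0 (- t))) * (W1 h * exp (Complex 0 (- t))))) (at z)"
    by (simp add: slit_def)
  note d = has_derivative_divide[OF _ WV_has_derivative(1) nz] has_derivative_mult[OF _ WV_has_derivative(1)]
  have t: "(\<lambda>z. t) differentiable at z" by simp
  show ?thesis
    unfolding coords_def slice_coords_def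
    apply (rule differentiable_vec_lambda)
    subgoal for i
      apply (cases "i = 0")
      subgoal by (simp, intro differentiable_add Re_differentiable(2)[OF L] t)
      apply (cases "i = 1")
      subgoal by (simp, rule Re_differentiable(1)[OF d(1)[OF WV_has_derivative(2)]])
      apply (cases "i = 2")
      subgoal by (cases c; simp; rule Re_differentiable(1)[OF d(1)[OF WV_has_derivative(3)]] Re_differentiable(1)[OF WV_has_derivative(3)])
      apply (cases "i = 3")
      subgoal by (simp del: times_complex.sel, rule Re_differentiable(1)[OF d(2)[OF WV_has_derivative(5)]])
      subgoal by (cases c; simp del: times_complex.sel; rule Re_differentiable(1)[OF d(2)[OF WV_has_derivative(6)]] Re_differentiable(2)[OF WV_has_derivative(3)])
      done
    done
qed

lemma coords_slice_point:
  assumes "\<bar>q $ 0 - t\<bar> < pi"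
  shows "coords c t (slice_point c \<sigma> q) = q"
  unfolding coords_def slit_exp(2)[OF WV_slice_point(1) assms] slice_coords_slice_point
  by (simp add: cart_eq_iff)

text \<open>\<open>L\<close> is prescribed only where \<open>W1\<close> is nonzero; its other points
  are reached by permuting the coordinates. The assumptions on \<open>Sf\<close> and
  \<open>P\<close> are those delivered by \<open>implicit_function_monotone\<close>.\<close>

locale slice_piece = stenzel_volume +
  fixes c :: bool and c0 t0 :: real and L :: "(complex^6) set" and Sf :: "real^5 \<Rightarrow> real" and P :: "(real^5) set"
  assumes L_iff: "\<And>z. W1 z \<noteq> 0 \<Longrightarrow> z \<in> L \<longleftrightarrow> z \<in> quadric \<and> real_slice c z \<and> moment z = c0"
    and P_open: "open P" and Sf_smooth: "smooth_on Sf P"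
    and Sf_eq: "\<And>q. q \<in> P \<Longrightarrow> slice_moment c (Sf q, q) = c0"
    and Sf_unique: "\<And>s q. slice_moment c (s, q) = c0 \<Longrightarrow> q \<in> P \<and> Sf q = s"
begin

definition U :: "(real^5) set" where "U = {q \<in> P. \<bar>q $ 0 - t0\<bar> < pi}"

definition \<phi> :: "real^5 \<Rightarrow> complex^6" where "\<phi> q = slice_point c (Sf q) q"

abbreviation DS :: "real^5 \<Rightarrow> real^5 \<Rightarrow> real" where "DS q \<equiv> frechet_derivative Sf (at q)"

lemma U_subset: "U \<subseteq> P" by (auto simp: U_def)

lemma open_U: "open U"
proof -
  have "U = P \<inter> (\<lambda>q. \<bar>q $ 0 - t0\<bar>) -` {..<pi}" by (auto simp: U_def)
  moreover have "open ((\<lambda>q::real^5. \<bar>q $ 0 - t0\<bar>) -` {..<pi})"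
    by (intro open_vimage continuous_intros)
  ultimately show ?thesis using P_open by auto
qed

lemma \<phi>_has_derivative:
  assumes "q \<in> P"
  shows "(\<phi> has_derivative (\<lambda>a. Dchart (chart_weight c) (slice c (Sf q) q) (slice c (DS q a) a))) (at q)"
proof -
  have "((\<lambda>q. (Sf q, q)) has_derivative (\<lambda>a. (DS q a, a))) (at q)"
    by (intro has_derivative_Pair smooth_on_has_derivative[OF Sf_smooth assms] has_derivative_ident)
  from bounded_linear.has_derivative[OF bounded_linear_slice[of c] this]
  have "((\<lambda>q. slice c (Sf q) q) has_derivative (\<lambda>a. slice c (DS q a) a)) (at q)" by simp
  from has_derivative_compose[OF this chart_has_derivative]
  show ?thesis by (simp add: \<phi>_def[abs_def] slice_point_def)
qed

lemma frechet_derivative_\<phi>: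
  "q \<in> P \<Longrightarrow> frechet_derivative \<phi> (at q) = (\<lambda>a. Dchart (chart_weight c) (slice c (Sf q) q) (slice c (DS q a) a))"
  by (rule frechet_derivative_eqI[OF \<phi>_has_derivative])

lemma smooth_\<phi>: "smooth_on \<phi> U"
proof -
  have "Ck_on k \<phi> P" for k
  proof -
    have "Ck_on k (\<lambda>q. (Sf q, q)) P"
      using Sf_smooth unfolding smooth_on_def
      by (intro Ck_on_Pair[OF P_open _ Ck_on_linear[OF bounded_linear_ident P_open]]) auto
    from Ck_on_linear_comp[OF bounded_linear_slice[of c] P_open this]
    have "Ck_on k (\<lambda>q. slice c (Sf q) q) P" by simp
    from Ck_on_comp[OF P_open open_UNIV _ _ this, of "chart (chart_weight c)"] smooth_chart[of "chart_weight c"]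
    show ?thesis by (simp add: \<phi>_def[abs_def] slice_point_def smooth_on_def)
  qed
  then show ?thesis unfolding smooth_on_def using Ck_on_subset[OF _ U_subset] by blast
qed

lemma W1_\<phi>: "W1 (\<phi> q) = exp (Complex (Sf q) (q $ 0))"
  by (simp add: \<phi>_def WV_slice_point)

lemma \<phi>_in_L: "q \<in> P \<Longrightarrow> \<phi> q \<in> L"
  using L_iff[of "\<phi> q"] Sf_eq[of q] by (simp add: W1_\<phi>) (simp add: \<phi>_def slice_point_in_quadric real_slice_slice_point moment_slice_point)

lemma \<phi>_in_slit: "q \<in> U \<Longrightarrow> \<phi> q \<in> slit t0"
  using slit_exp(1)[OF W1_\<phi>] by (auto simp: U_def)

lemma coords_\<phi>: "q \<in> U \<Longrightarrow> coords c t0 (\<phi> q) = q"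
  by (simp add: \<phi>_def U_def coords_slice_point)

lemma \<phi>_image: "\<phi> ` U = L \<inter> slit t0"
proof
  show "\<phi> ` U \<subseteq> L \<inter> slit t0" using \<phi>_in_L \<phi>_in_slit U_subset by blast
  show "L \<inter> slit t0 \<subseteq> \<phi> ` U"
  proof
    fix z assume "z \<in> L \<inter> slit t0"
    then have z: "z \<in> L" "z \<in> slit t0" by auto
    then have zL: "z \<in> quadric" "real_slice c z" "moment z = c0" using L_iff[OF slit_nonzero] by auto
    obtain \<sigma> s where s: "W1 z = exp (Complex \<sigma> s)" "\<bar>s - t0\<bar> < pi" by (rule slit_obtain[OF z(2)])
    have p: "slice_point c \<sigma> (slice_coords c s z) = z" by (rule slice_point_slice_coords[OF zL(1,2) s(1)])
    then have "slice_moment c (\<sigma>, slice_coords c s z) = c0" using zL(3) by (simp flip: moment_slice_point)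
    then have q: "slice_coords c s z \<in> P" "Sf (slice_coords c s z) = \<sigma>" using Sf_unique by auto
    then have "\<phi> (slice_coords c s z) = z" using p by (simp add: \<phi>_def)
    moreover have "slice_coords c s z \<in> U" using q s(2) by (simp add: U_def)
    ultimately show "z \<in> \<phi> ` U" by force
  qed
qed

text \<open>The differentiable left inverse \<open>coords\<close> yields both the injectivity of the
  differential and the continuity of the inverse. The image is relatively open because an open slit
  domain cuts it out of \<open>L\<close>.\<close>

lemma local_parametrization_\<phi>: "local_parametrization L \<phi> U"
  unfolding local_parametrization_def
proof (intro conjI ballI)
  show "open U" by (rule open_U)
  show "smooth_on \<phi> U" by (rule smooth_\<phi>)
  show "inj (frechet_derivative \<phi> (at q))" if q: "q \<in> U" for q
  proof -
    have d: "(\<phi> has_derivative frechet_derivative \<phi> (at q)) (at q)"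
      by (rule smooth_on_has_derivative[OF smooth_\<phi> q])
    obtain D where D: "(coords c t0 has_derivative D) (at (\<phi> q))"
      using coords_differentiable[OF \<phi>_in_slit[OF q]] by (auto simp: differentiable_def)
    have "((\<lambda>q. coords c t0 (\<phi> q)) has_derivative (\<lambda>a. D (frechet_derivative \<phi> (at q) a))) (at q)"
      by (rule has_derivative_compose[OF d D])
    then have "((\<lambda>q. q) has_derivative (\<lambda>a. D (frechet_derivative \<phi> (at q) a))) (at q)"
      by (rule has_derivative_transform_within_open[OF _ open_U q]) (simp add: coords_\<phi>)
    then have "(\<lambda>a. D (frechet_derivative \<phi> (at q) a)) = (\<lambda>a. a)"
      using has_derivative_unique has_derivative_ident by blast
    then show ?thesis by (metis (no_types, lifting) injI)
  qed
  have "continuous_on (\<phi> ` U) (coords c t0)"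
    using coords_differentiable \<phi>_in_slit
    by (auto intro!: continuous_at_imp_continuous_on differentiable_imp_continuous_within)
  then have "homeomorphism U (\<phi> ` U) \<phi> (coords c t0)"
    using smooth_on_continuous[OF smooth_\<phi>] coords_\<phi> by (auto simp: homeomorphism_def image_iff)
  then show "\<exists>g. homeomorphism U (\<phi> ` U) \<phi> g" by blast
  show "openin (top_of_set L) (\<phi> ` U)"
    unfolding \<phi>_image using open_slit by (auto simp: openin_open)
qed

text \<open>The tangent spaces seen by an arbitrary parametrization are contained in those seen by
  \<open>\<phi>\<close>, as the inverse of \<open>\<phi>\<close> extends to a differentiable map on a neighbourhood.\<close>

lemma range_frechet_derivative_subset:
  assumes lp: "local_parametrization L \<psi> V" and r: "r \<in> V" and slit: "\<psi> r \<in> slit t0"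
  obtains q where "q \<in> U" "\<phi> q = \<psi> r" "range (frechet_derivative \<psi> (at r)) \<subseteq> range (frechet_derivative \<phi> (at q))"
proof -
  have V: "open V" "smooth_on \<psi> V" "\<psi> ` V \<subseteq> L"
    using lp unfolding local_parametrization_def by (auto dest: openin_imp_subset)
  define q where "q = coords c t0 (\<psi> r)"
  define V' where "V' = V \<inter> \<psi> -` slit t0"
  have V': "open V'" unfolding V'_def
    using continuous_on_open_vimage[OF V(1)] smooth_on_continuous[OF V(2)] open_slit by (metis inf_commute)
  have rV': "r \<in> V'" using r slit by (simp add: V'_def)
  have in_U: "coords c t0 (\<psi> x) \<in> U \<and> \<phi> (coords c t0 (\<psi> x)) = \<psi> x" if "x \<in> V'" for x
  proof -
    have "\<psi> x \<in> \<phi> ` U" unfolding \<phi>_image using that V(3) by (auto simp: V'_def)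
    then show ?thesis using coords_\<phi> by auto
  qed
  have q: "q \<in> U" "\<phi> q = \<psi> r" using in_U[OF rV'] by (auto simp: q_def)
  obtain D where D: "(coords c t0 has_derivative D) (at (\<psi> r))"
    using coords_differentiable[OF slit] by (auto simp: differentiable_def)
  have d\<psi>: "(\<psi> has_derivative frechet_derivative \<psi> (at r)) (at r)"
    by (rule smooth_on_has_derivative[OF V(2) r])
  have d\<phi>: "(\<phi> has_derivative frechet_derivative \<phi> (at q)) (at (coords c t0 (\<psi> r)))"
    using smooth_on_has_derivative[OF smooth_\<phi> q(1)] by (simp add: q_def)
  from has_derivative_compose[OF has_derivative_compose[OF d\<psi> D] d\<phi>]
  have "((\<lambda>x. \<phi> (coords c t0 (\<psi> x))) has_derivative
      (\<lambda>a. frechet_derivative \<phi> (at q) (D (frechet_derivative \<psi> (at r) a)))) (at r)" .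
  then have "(\<psi> has_derivative (\<lambda>a. frechet_derivative \<phi> (at q) (D (frechet_derivative \<psi> (at r) a)))) (at r)"
    by (rule has_derivative_transform_within_open[OF _ V' rV']) (use in_U in blast)
  from frechet_derivative_eqI[OF this]
  have "frechet_derivative \<psi> (at r) a = frechet_derivative \<phi> (at q) (D (frechet_derivative \<psi> (at r) a))" for a
    by (rule fun_cong)
  then have "range (frechet_derivative \<psi> (at r)) \<subseteq> range (frechet_derivative \<phi> (at q))"
    by (metis image_subsetI rangeI)
  with q show ?thesis using that by blast
qed

end

section \<open>The moment map and the Lagrangian condition\<close>

text \<open>This is \<open>- \<i>\<close> times the vector field generated by \<open>eta\<close>,
  which multiplies each W by \<open>\<i>\<close> and each V by \<open>- \<i>\<close>.\<close>

definition null_flip :: "complex^6 \<Rightarrow> complex^6" where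
  "null_flip z = of_null (W1 z) (W2 z) (W3 z) (- V1 z) (- V2 z) (- V3 z)"

lemma WV_null_flip [simp]: "W1 (null_flip z) = W1 z" "W2 (null_flip z) = W2 z" "W3 (null_flip z) = W3 z"
  "V1 (null_flip z) = - V1 z" "V2 (null_flip z) = - V2 z" "V3 (null_flip z) = - V3 z"
  by (simp_all add: null_flip_def)

lemma herm_null_flip_self: "herm (null_flip z) z = of_real (null_diff z)"
  by (simp add: herm_WV null_diff_def complex_norm_square del: of_real_power)

lemma null_diff_has_derivative: "(null_diff has_derivative (\<lambda>v. 2 * Re (herm (null_flip z) v))) (at z)"
proof -
  have q: "null_diff = (\<lambda>z. (W1 z \<bullet> W1 z + W2 z \<bullet> W2 z + W3 z \<bullet> W3 z - V1 z \<bullet> V1 z - V2 z \<bullet> V2 z - V3 z \<bullet> V3 z) / 2)"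
    by (simp add: fun_eq_iff null_diff_def dot_square_norm)
  have d: "((\<lambda>z. f z \<bullet> f z) has_derivative (\<lambda>v. 2 * (f z \<bullet> f v))) (at z)"
    if "(f has_derivative f) (at z)" for f :: "complex^6 \<Rightarrow> complex"
    using has_derivative_inner[OF that that] by (simp add: inner_commute)
  have "(null_diff has_derivative (\<lambda>v. (2 * (W1 z \<bullet> W1 v) + 2 * (W2 z \<bullet> W2 v) + 2 * (W3 z \<bullet> W3 v) -
      2 * (V1 z \<bullet> V1 v) - 2 * (V2 z \<bullet> V2 v) - 2 * (V3 z \<bullet> V3 v)) / 2)) (at z)"
    unfolding q divide_inverse
    by (intro has_derivative_mult_left has_derivative_diff has_derivative_add d WV_has_derivative)
  moreover have "(\<lambda>v. (2 * (W1 z \<bullet> W1 v) + 2 * (W2 z \<bullet> W2 v) + 2 * (W3 z \<bullet> W3 v) -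
      2 * (V1 z \<bullet> V1 v) - 2 * (V2 z \<bullet> V2 v) - 2 * (V3 z \<bullet> V3 v)) / 2) = (\<lambda>v. 2 * Re (herm (null_flip z) v))"
    by (simp add: fun_eq_iff herm_WV inner_complex_def)
  ultimately show ?thesis by simp
qed

context stenzel
begin

text \<open>The moment map equation: since \<open>null_flip z\<close> is \<open>- \<i>\<close> times
  the field of \<open>eta\<close>, the right-hand side is minus the Stenzel form of that field and
  \<open>v\<close>.\<close>

lemma moment_has_derivative:
  assumes "r2 z \<ge> 1"
  shows "(moment has_derivative (\<lambda>v. 2 * Re (hform z (null_flip z) v))) (at z)"
proof -
  have "((\<lambda>z. u1 (r2 z)) has_derivative (\<lambda>v. 2 * (z \<bullet> v) * u2 (r2 z))) (at z)"
    by (intro DERIV_compose_FDERIV[where g = r2] has_deriv_u1 ge_1_in_S assms r2_has_derivative)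
  from has_derivative_mult[OF this null_diff_has_derivative]
  have "(moment has_derivative (\<lambda>v. u1 (r2 z) * (2 * Re (herm (null_flip z) v)) + 2 * (z \<bullet> v) * u2 (r2 z) * null_diff z)) (at z)"
    by (simp add: moment_def[abs_def])
  moreover have "(\<lambda>v. u1 (r2 z) * (2 * Re (herm (null_flip z) v)) + 2 * (z \<bullet> v) * u2 (r2 z) * null_diff z) =
      (\<lambda>v. 2 * Re (hform z (null_flip z) v))"
    by (simp add: fun_eq_iff hform_def herm_null_flip_self inner_eq_herm)
  ultimately show ?thesis by simp
qed

end

section \<open>Tangent vectors of a slice\<close>

lemma V1_slice_point: "V1 (slice_point c \<sigma> q) = exp (- Complex \<sigma> (q $ 0)) * of_real (slice_n c q)"
proof -
  have "1 - slice c \<sigma> q $ 1 * slice c \<sigma> q $ 3 - slice c \<sigma> q $ 2 * slice c \<sigma> q $ 4 = of_real (slice_n c q)"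
    by (cases c) (simp_all add: slice_n_def slice_m_def real_weight_def complex_eq_iff algebra_simps)
  then show ?thesis by (simp add: slice_point_def chart_def)
qed

lemma Dchart_diff: "Dchart k p (h - h') = Dchart k p h - Dchart k p h'"
  using Dchart_linear(2)[of k p "h - h'" h'] by (simp add: algebra_simps)

definition slice_tangent :: "bool \<Rightarrow> real \<Rightarrow> real^5 \<Rightarrow> real \<Rightarrow> real^5 \<Rightarrow> complex^6" where
  "slice_tangent c \<sigma> q s a = Dchart (chart_weight c) (slice c \<sigma> q) (slice c s a)"

lemma WV_slice_tangent:
  assumes "a $ 0 = 0"
  shows "W1 (slice_tangent c \<sigma> q s a) = exp (Complex \<sigma> (q $ 0)) * of_real s"
    "W2 (slice_tangent c \<sigma> q s a) = exp (Complex \<sigma> (q $ 0)) * of_real (s * q $ 1 + a $ 1)"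
    "W3 (slice_tangent c \<sigma> q s a) = (if c then exp (Complex \<sigma> (q $ 0)) * of_real (s * q $ 2 + a $ 2)
      else Complex (a $ 2) (a $ 4))"
    "V1 (slice_tangent c \<sigma> q s a) = exp (- Complex \<sigma> (q $ 0)) * of_real (- s * slice_n c q - (a $ 1 * q $ 3 + q $ 1 * a $ 3
      + (if c then a $ 2 * q $ 4 + q $ 2 * a $ 4 else - 2 * (a $ 2 * q $ 2 + a $ 4 * q $ 4))))"
    "V2 (slice_tangent c \<sigma> q s a) = exp (- Complex \<sigma> (q $ 0)) * of_real (- s * q $ 3 + a $ 3)"
    "V3 (slice_tangent c \<sigma> q s a) = (if c then exp (- Complex \<sigma> (q $ 0)) * of_real (- s * q $ 4 + a $ 4)
      else Complex (- (a $ 2)) (a $ 4))"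
proof -
  have C: "Complex s 0 = of_real s" for s by (simp add: complex_eq_iff)
  show "V1 (slice_tangent c \<sigma> q s a) = exp (- Complex \<sigma> (q $ 0)) * of_real (- s * slice_n c q - (a $ 1 * q $ 3 + q $ 1 * a $ 3
      + (if c then a $ 2 * q $ 4 + q $ 2 * a $ 4 else - 2 * (a $ 2 * q $ 2 + a $ 4 * q $ 4))))"
  proof -
    have "- slice c s a $ 0 * (1 - slice c \<sigma> q $ 1 * slice c \<sigma> q $ 3 - slice c \<sigma> q $ 2 * slice c \<sigma> q $ 4) -
        (slice c s a $ 1 * slice c \<sigma> q $ 3 + slice c \<sigma> q $ 1 * slice c s a $ 3 +
         slice c s a $ 2 * slice c \<sigma> q $ 4 + slice c \<sigma> q $ 2 * slice c s a $ 4) =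
      of_real (- s * slice_n c q - (a $ 1 * q $ 3 + q $ 1 * a $ 3
        + (if c then a $ 2 * q $ 4 + q $ 2 * a $ 4 else - 2 * (a $ 2 * q $ 2 + a $ 4 * q $ 4))))"
      by (cases c) (simp_all add: assms slice_n_def slice_m_def real_weight_def complex_eq_iff algebra_simps)
    then show ?thesis unfolding slice_tangent_def Dchart_def WV_of_null by (simp only: slice_nth)
  qed
qed (simp_all add: slice_tangent_def Dchart_def chart_weight_def assms complex_eq_iff)

lemma Im_mult_cnj_real: "Im (E * of_real x * cnj (E * of_real y)) = 0"
  by (simp add: algebra_simps)

text \<open>Without an angular component each W is a real multiple of one phase and each V of its
  inverse, so phases cancel in the products. In the second case the two products from the third pair
  are conjugate to each other.\<close>

lemma Im_herm_slice_tangent: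
  assumes "a $ 0 = 0" "b $ 0 = 0"
  shows "Im (herm (slice_tangent c \<sigma> q s a) (slice_tangent c \<sigma> q s' b)) = 0"
proof (cases c)
  case True
  show ?thesis unfolding herm_WV WV_slice_tangent[OF assms(1)] WV_slice_tangent[OF assms(2)]
    using True by (simp only: if_True Im_divide_numeral plus_complex.sel Im_mult_cnj_real) simp
next
  case False
  show ?thesis unfolding herm_WV WV_slice_tangent[OF assms(1)] WV_slice_tangent[OF assms(2)]
    using False by (simp only: if_False Im_divide_numeral plus_complex.sel Im_mult_cnj_real) simp
qed

lemma Im_herm_slice_tangent_slice_point:
  assumes "a $ 0 = 0"
  shows "Im (herm (slice_tangent c \<sigma> q s a) (slice_point c \<sigma> q)) = 0"
proof -
  have E: "exp (Complex \<sigma> (q $ 0)) = exp (Complex \<sigma> (q $ 0)) * of_real 1" by simp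
  show ?thesis
  proof (cases c)
    case True
    show ?thesis unfolding herm_WV WV_slice_tangent[OF assms(1)] WV_slice_point V1_slice_point
      using True by (subst (2) E, simp only: if_True Im_divide_numeral plus_complex.sel Im_mult_cnj_real) simp
  next
    case False
    show ?thesis unfolding herm_WV WV_slice_tangent[OF assms(1)] WV_slice_point V1_slice_point
      using False by (subst (2) E, simp only: if_False Im_divide_numeral plus_complex.sel Im_mult_cnj_real) simp
  qed
qed

lemma slice_decomp:
  "slice c s a = Complex s (a $ 0) *s slice c 1 0 + slice c 0 (\<chi> i. if i = 0 then 0 else a $ i)"
  by (simp add: cart_eq_iff forall_5 complex_eq_iff)

lemma slice_tangent_decomp:
  "slice_tangent c \<sigma> q s a = Complex s (a $ 0) *s slice_tangent c \<sigma> q 1 0 + slice_tangent c \<sigma> q 0 (\<chi> i. if i = 0 then 0 else a $ i)"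
  unfolding slice_tangent_def by (subst slice_decomp) (simp only: Dchart_linear)

lemma WV_slice_tangent_1_0: "W1 (slice_tangent c \<sigma> q 1 0) = W1 (slice_point c \<sigma> q)" "W2 (slice_tangent c \<sigma> q 1 0) = W2 (slice_point c \<sigma> q)"
  "V1 (slice_tangent c \<sigma> q 1 0) = - V1 (slice_point c \<sigma> q)" "V2 (slice_tangent c \<sigma> q 1 0) = - V2 (slice_point c \<sigma> q)"
  "W3 (slice_tangent c \<sigma> q 1 0) = (if c then W3 (slice_point c \<sigma> q) else 0)"
  "V3 (slice_tangent c \<sigma> q 1 0) = (if c then - V3 (slice_point c \<sigma> q) else 0)"
  by (simp_all add: WV_slice_tangent WV_slice_point V1_slice_point complex_eq_iff)

lemma WV3_slice_tangent: "\<not> c \<Longrightarrow> W3 (slice_tangent c \<sigma> q s a) = Complex (a $ 2) (a $ 4)"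
  "\<not> c \<Longrightarrow> V3 (slice_tangent c \<sigma> q s a) = Complex (- (a $ 2)) (a $ 4)"
  by (simp_all add: slice_tangent_def Dchart_def chart_weight_def complex_eq_iff)

text \<open>In the first case the s-direction is \<open>null_flip\<close> itself. In the second it
  lacks the third pair, which would contribute a difference of conjugate numbers, hence nothing to
  the real part.\<close>

lemma Re_herm_null_flip_slice_tangent: "Re (herm (null_flip (slice_point c \<sigma> q)) (slice_tangent c \<sigma> q s a)) = Re (herm (slice_tangent c \<sigma> q 1 0) (slice_tangent c \<sigma> q s a))"
proof (cases c)
  case True
  then have "slice_tangent c \<sigma> q 1 0 = null_flip (slice_point c \<sigma> q)" by (intro WV_eqI) (simp_all add: WV_slice_tangent_1_0)
  then show ?thesis by simp
next
  case False
  then show ?thesis by (simp add: herm_WV WV_slice_tangent_1_0 WV3_slice_tangent WV_slice_point)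
qed

text \<open>The third pair missing in the second case would contribute the difference of the squared
  moduli of \<open>W3\<close> and \<open>V3\<close>, which is 0.\<close>

lemma herm_null_flip_slice_point: "herm (null_flip (slice_point c \<sigma> q)) (slice_point c \<sigma> q) = herm (slice_tangent c \<sigma> q 1 0) (slice_point c \<sigma> q)"
proof (cases c)
  case True
  then have "slice_tangent c \<sigma> q 1 0 = null_flip (slice_point c \<sigma> q)" by (intro WV_eqI) (simp_all add: WV_slice_tangent_1_0)
  then show ?thesis by simp
next
  case False
  then show ?thesis by (simp add: herm_WV WV_slice_tangent_1_0 WV_slice_point complex_eq_iff)
qed

context stenzel
begin

lemma Im_hform_slice_tangent:
  assumes "a $ 0 = 0" "b $ 0 = 0"
  shows "Im (hform (slice_point c \<sigma> q) (slice_tangent c \<sigma> q s a) (slice_tangent c \<sigma> q s' b)) = 0"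
  using Im_herm_slice_tangent[OF assms] Im_herm_slice_tangent_slice_point[OF assms(1)] Im_herm_slice_tangent_slice_point[OF assms(2), of c \<sigma> q s']
    cnj_herm[of "slice_tangent c \<sigma> q s' b" "slice_point c \<sigma> q"]
  by (simp add: hform_def complex_eq_iff)

lemma Re_hform_null_flip_slice_tangent:
  "Re (hform (slice_point c \<sigma> q) (null_flip (slice_point c \<sigma> q)) (slice_tangent c \<sigma> q s a)) =
   Re (hform (slice_point c \<sigma> q) (slice_tangent c \<sigma> q 1 0) (slice_tangent c \<sigma> q s a))"
  using Re_herm_null_flip_slice_tangent[of c \<sigma> q s a] herm_null_flip_slice_point[of c \<sigma> q]
  by (simp add: hform_def)

text \<open>Write \<open>?f\<close> for the s-direction and the vectors as
  \<open>(s + \<i> a0) f + a'\<close> and \<open>(s' + \<i> b0) f + b'\<close>. All products among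
  \<open>f\<close>, \<open>a'\<close>, \<open>b'\<close> are real, and tangency to the level set
  means \<open>h f a' = - s h f f\<close> and likewise for \<open>b'\<close>; in the imaginary part
  the terms then cancel in pairs.\<close>

lemma Im_hform_slice_tangent_zero:
  assumes a: "Re (hform (slice_point c \<sigma> q) (null_flip (slice_point c \<sigma> q)) (slice_tangent c \<sigma> q s a)) = 0"
    and b: "Re (hform (slice_point c \<sigma> q) (null_flip (slice_point c \<sigma> q)) (slice_tangent c \<sigma> q s' b)) = 0"
  shows "Im (hform (slice_point c \<sigma> q) (slice_tangent c \<sigma> q s a) (slice_tangent c \<sigma> q s' b)) = 0"
proof -
  let ?h = "hform (slice_point c \<sigma> q)" and ?f = "slice_tangent c \<sigma> q 1 0"
  define a' b' where "a' = (\<chi> i. if i = 0 then 0 else a $ i)" and "b' = (\<chi> i. if i = 0 then 0 else b $ i)"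
  let ?a = "slice_tangent c \<sigma> q 0 a'" and ?b = "slice_tangent c \<sigma> q 0 b'"
  have 0: "a' $ 0 = 0" "b' $ 0 = 0" "(0::real^5) $ 0 = 0" by (simp_all add: a'_def b'_def)
  have im: "Im (?h ?f ?f) = 0" "Im (?h ?f ?a) = 0" "Im (?h ?f ?b) = 0" "Im (?h ?a ?b) = 0" "Im (?h ?a ?f) = 0"
    by (intro Im_hform_slice_tangent 0)+
  have sym: "Re (?h ?a ?f) = Re (?h ?f ?a)" 
  proof -
    have "Re (cnj (?h ?f ?a)) = Re (?h ?f ?a)" by simp
    then show ?thesis by (simp only: cnj_hform)
  qed
  have da: "slice_tangent c \<sigma> q s a = Complex s (a $ 0) *s ?f + ?a" and db: "slice_tangent c \<sigma> q s' b = Complex s' (b $ 0) *s ?f + ?b"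
    unfolding a'_def b'_def by (rule slice_tangent_decomp)+
  have "s * Re (?h ?f ?f) + Re (?h ?f ?a) = 0" "s' * Re (?h ?f ?f) + Re (?h ?f ?b) = 0"
    using a b im unfolding Re_hform_null_flip_slice_tangent by (simp_all add: da db hform_simps)
  then have e: "Re (?h ?f ?a) = - (s * Re (?h ?f ?f))" "Re (?h ?f ?b) = - (s' * Re (?h ?f ?f))" by linarith+
  show ?thesis
    unfolding da db hform_simps by (simp add: im sym e algebra_simps)
qed

end

context slice_piece
begin

lemma frechet_derivative_\<phi>_slice_tangent:
  "q \<in> P \<Longrightarrow> frechet_derivative \<phi> (at q) a = slice_tangent c (Sf q) q (DS q a) a"
  by (simp add: frechet_derivative_\<phi> slice_tangent_def)

lemma moment_derivative_\<phi>:
  assumes "q \<in> P"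
  shows "Re (hform (\<phi> q) (null_flip (\<phi> q)) (frechet_derivative \<phi> (at q) a)) = 0"
proof -
  have r: "r2 (\<phi> q) \<ge> 1" unfolding \<phi>_def by (rule r2_quadric_ge_1[OF slice_point_in_quadric])
  have "(\<phi> has_derivative frechet_derivative \<phi> (at q)) (at q)"
    using \<phi>_has_derivative[OF assms] frechet_derivative_\<phi>[OF assms] by simp
  from has_derivative_compose[OF this moment_has_derivative[OF r]]
  have "((\<lambda>q. moment (\<phi> q)) has_derivative (\<lambda>a. 2 * Re (hform (\<phi> q) (null_flip (\<phi> q)) (frechet_derivative \<phi> (at q) a)))) (at q)" .
  then have "((\<lambda>q. c0) has_derivative (\<lambda>a. 2 * Re (hform (\<phi> q) (null_flip (\<phi> q)) (frechet_derivative \<phi> (at q) a)))) (at q)"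
    by (rule has_derivative_transform_within_open[OF _ P_open assms]) (simp add: \<phi>_def moment_slice_point Sf_eq)
  from has_derivative_unique[OF this has_derivative_const] show ?thesis by (simp add: fun_eq_iff)
qed

lemma hform_\<phi>_real:
  assumes "q \<in> P"
  shows "Im (hform (\<phi> q) (frechet_derivative \<phi> (at q) a) (frechet_derivative \<phi> (at q) b)) = 0"
  using moment_derivative_\<phi>[OF assms, of a] moment_derivative_\<phi>[OF assms, of b]
  unfolding frechet_derivative_\<phi>_slice_tangent[OF assms] \<phi>_def by (rule Im_hform_slice_tangent_zero)

lemma stenzel_form_zero:
  assumes lp: "local_parametrization L \<psi> V" and r: "r \<in> V" and slit: "\<psi> r \<in> slit t0"
  shows "stenzel_form u (\<psi> r) (frechet_derivative \<psi> (at r) a) (frechet_derivative \<psi> (at r) b) = 0"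
proof -
  obtain q where q: "q \<in> U" "\<phi> q = \<psi> r" "range (frechet_derivative \<psi> (at r)) \<subseteq> range (frechet_derivative \<phi> (at q))"
    by (rule range_frechet_derivative_subset[OF assms])
  obtain a' b' where ab: "frechet_derivative \<psi> (at r) a = frechet_derivative \<phi> (at q) a'"
    "frechet_derivative \<psi> (at r) b = frechet_derivative \<phi> (at q) b'"
  proof -
    have "frechet_derivative \<psi> (at r) a \<in> range (frechet_derivative \<phi> (at q))"
      "frechet_derivative \<psi> (at r) b \<in> range (frechet_derivative \<phi> (at q))"
      using q(3) by auto
    then show ?thesis using that by (auto elim!: rangeE)
  qed
  have "r2 (\<phi> q) \<ge> 1" unfolding \<phi>_def by (rule r2_quadric_ge_1[OF slice_point_in_quadric])
  then show ?thesis
    using hform_\<phi>_real[of q a' b'] q(1) U_subset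
    unfolding ab q(2)[symmetric] by (auto simp: stenzel_form_eq_Im)
qed

section \<open>The Lagrangian angle\<close>

text \<open>The reduced moment map does not involve the angle, so by uniqueness its solution
  \<open>Sf\<close> does not either.\<close>

lemma DS_axis_0:
  assumes "q \<in> P"
  shows "DS q (axis 0 1) = 0"
proof -
  have inv: "Sf (q + t *\<^sub>R axis 0 1) = Sf q" for t
  proof -
    have "slice_moment c (s, q + t *\<^sub>R axis 0 1) = slice_moment c (s, q)" for s
      by (simp add: slice_moment_def slice_rho_def slice_q_def slice_A_def slice_B_def slice_n_def slice_m_def axis_def)
    then show ?thesis using Sf_eq[OF assms] Sf_unique by metis
  qed
  have "((\<lambda>t. q + t *\<^sub>R axis 0 1) has_derivative (\<lambda>t. t *\<^sub>R axis 0 1)) (at 0)"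
    by (auto intro!: derivative_eq_intros)
  moreover have "(Sf has_derivative DS q) (at (q + 0 *\<^sub>R axis 0 1))"
    using smooth_on_has_derivative[OF Sf_smooth assms] by simp
  ultimately have "((\<lambda>t. Sf (q + t *\<^sub>R axis 0 1)) has_derivative (\<lambda>t. DS q (t *\<^sub>R axis 0 1))) (at 0)"
    by (rule has_derivative_compose)
  then have "((\<lambda>t. Sf q) has_derivative (\<lambda>t. DS q (t *\<^sub>R axis 0 1))) (at (0::real))" by (simp only: inv)
  from has_derivative_unique[OF this has_derivative_const] have "(\<lambda>t. DS q (t *\<^sub>R axis 0 1)) = (\<lambda>t::real. 0)" .
  from fun_cong[OF this, of 1] show ?thesis by simp
qed

text \<open>The angular direction is \<open>\<i>\<close> times the s-direction, which gives a factor
  \<open>\<i>\<close>. The multiples of the s-direction in the other vectors drop out by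
  alternation. In the second case \<open>(f 2, f 4)\<close> is replaced by
  \<open>(f 2 - f 4, \<i> f 2 + \<i> f 4)\<close>, of determinant \<open>2 * \<i>\<close>, so the
  total factor is -2.\<close>

lemma Omega_frame:
  assumes q: "q \<in> P"
  shows "\<Omega> (\<phi> q) (coord_frame \<phi> q) = (if c then \<i> else - 2) * frame_value 1 0"
proof -
  define p where "p = slice c (Sf q) q"
  define f where "f = coord_frame (chart (chart_weight c)) p"
  have \<phi>p: "\<phi> q = chart (chart_weight c) p" by (simp add: \<phi>_def slice_point_def p_def)
  have T: "f i \<in> quadric_tangent (\<phi> q)" for i
    by (simp add: f_def coord_frame_chart \<phi>p Dchart_tangent)
  interpret alternating_form 5 "quadric_tangent (\<phi> q)" "\<Omega> (\<phi> q)"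
    by (rule alternating_Omega) (simp add: \<phi>p chart_in_quadric)
  have F: "\<Omega> (\<phi> q) f = frame_value 1 0"
    unfolding \<phi>p f_def by (fold frame_value_def) (rule frame_value_eq)
  define D where "D = Dchart (chart_weight c) p"
  have D: "D (a *s h) = a *s D h" "D (h + h') = D h + D h'" "D (h - h') = D h - D h'" for a h h'
    by (simp_all only: D_def Dchart_linear Dchart_diff)
  have fj: "f i = D (axis (of_nat i) 1)" for i
    by (simp add: f_def coord_frame_chart D_def)
  define s where "s i = complex_of_real (DS q (axis (of_nat i) 1))" for i :: nat
  define g where "g = (if c then f else f(2 := f 2 - f 4, 4 := \<i> *s f 2 + \<i> *s f 4))"
  have T_diff: "a - b \<in> quadric_tangent (\<phi> q)" if "a \<in> quadric_tangent (\<phi> q)" "b \<in> quadric_tangent (\<phi> q)" for a b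
    using T_add[OF that(1) T_scale[OF that(2), of "-1"]] by simp
  have gT: "g i \<in> quadric_tangent (\<phi> q)" for i
    unfolding g_def using T T_add[OF T_scale[OF T] T_scale[OF T]] T_diff[OF T T] by auto
  have G: "\<Omega> (\<phi> q) g = (if c then 1 else 2 * \<i>) * frame_value 1 0"
  proof (cases c)
    case True
    then have "g = f" by (simp add: g_def)
    show ?thesis unfolding \<open>g = f\<close> F using True by simp
  next
    case False
    define y where "y = f(2 := f 2 - f 4)"
    have yT: "y i \<in> quadric_tangent (\<phi> q)" for i unfolding y_def using T T_diff[OF T T] by auto
    have y: "\<Omega> (\<phi> q) y = \<Omega> (\<phi> q) f"
      using add_multiple[of f 2 4 "- 1"] T by (simp add: y_def)
    have "g = y(4 := \<i> *s (2 *s y 4 + y 2))"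
    proof
      fix i
      show "g i = (y(4 := \<i> *s (2 *s y 4 + y 2))) i"
        using False by (simp add: g_def y_def cart_eq_iff algebra_simps)
    qed
    then have "\<Omega> (\<phi> q) g = \<i> * (\<Omega> (\<phi> q) (y(4 := 2 *s y 4)) + \<Omega> (\<phi> q) (y(4 := y 2)))"
      using scale[of y 4 "2 *s y 4 + y 2" \<i>] add[of y 4 "2 *s y 4" "y 2"] yT T_add T_scale by simp
    also have "\<Omega> (\<phi> q) (y(4 := 2 *s y 4)) = 2 * \<Omega> (\<phi> q) y"
      using scale[of y 4 "y 4" 2] yT by simp
    also have "\<Omega> (\<phi> q) (y(4 := y 2)) = 0"
      by (rule eq_zero[of _ 2 4]) (use yT in auto)
    finally have "\<Omega> (\<phi> q) g = \<i> * (2 * frame_value 1 0 + 0)" by (simp only: y F)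
    then show ?thesis unfolding if_not_P[OF False] by simp
  qed
  have g0: "g 0 = f 0" by (simp add: g_def)
  \<comment> \<open>Inserts the multiples of the s-direction that stem from the derivative of
    \<open>Sf\<close>, one slot at a time up to slot \<open>n\<close>.\<close>
  define k where "k n = (\<lambda>i. if 1 \<le> i \<and> i \<le> n then g i + s i *s g 0 else g i)" for n :: nat
  have kT: "k n i \<in> quadric_tangent (\<phi> q)" for n i unfolding k_def using gT T_add T_scale by auto
  have K: "n \<le> 4 \<Longrightarrow> \<Omega> (\<phi> q) (k n) = \<Omega> (\<phi> q) g" for n
  proof (induction n)
    case 0
    have "k 0 = g" by (auto simp: k_def fun_eq_iff)
    then show ?case by simp
  next
    case (Suc n)
    have "k (Suc n) = (k n)(Suc n := k n (Suc n) + s (Suc n) *s k n 0)"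
      by (auto simp: k_def fun_eq_iff)
    then have "\<Omega> (\<phi> q) (k (Suc n)) = \<Omega> (\<phi> q) (k n)"
      using add_multiple[of "k n" "Suc n" 0 "s (Suc n)"] kT Suc.prems by simp
    then show ?case using Suc by simp
  qed
  have "coord_frame \<phi> q i = ((k 4)(0 := \<i> *s k 4 0)) i" if "i < 5" for i
  proof -
    have v: "coord_frame \<phi> q i = D (slice c (DS q (axis (of_nat i) 1)) (axis (of_nat i) 1))" for i
      by (simp add: coord_frame_def frechet_derivative_\<phi>[OF q] p_def D_def)
    have "i = 0 \<or> i = 1 \<or> i = 2 \<or> i = 3 \<or> i = 4" using that by auto
    then show ?thesis
    proof (elim disjE)
      assume i: "i = 0"
      have "slice c 0 (axis 0 1) = \<i> *s axis 0 1"
        by (simp add: cart_eq_iff forall_5 axis_def complex_eq_iff)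
      then show ?thesis using i by (simp add: v k_def g0 fj DS_axis_0[OF q] D)
    next
      assume i: "i = 1"
      have "slice c x (axis 1 1) = axis 1 1 + of_real x *s axis 0 1" for x
        by (simp add: cart_eq_iff forall_5 axis_def complex_eq_iff)
      then show ?thesis using i by (simp add: v k_def g_def fj s_def D)
    next
      assume i: "i = 2"
      have "slice c x (axis 2 1) = (if c then axis 2 1 else axis 2 1 - axis 4 1) + of_real x *s axis 0 1" for x
        by (simp add: cart_eq_iff forall_5 axis_def complex_eq_iff)
      then show ?thesis using i by (simp add: v k_def g_def fj s_def D)
    next
      assume i: "i = 3"
      have "slice c x (axis 3 1) = axis 3 1 + of_real x *s axis 0 1" for x
        by (simp add: cart_eq_iff forall_5 axis_def complex_eq_iff)
      then show ?thesis using i by (simp add: v k_def g_def fj s_def D)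
    next
      assume i: "i = 4"
      have "slice c x (axis 4 1) = (if c then axis 4 1 else \<i> *s axis 2 1 + \<i> *s axis 4 1) + of_real x *s axis 0 1" for x
        by (simp add: cart_eq_iff forall_5 axis_def complex_eq_iff)
      then show ?thesis using i by (simp add: v k_def g_def fj s_def D)
    qed
  qed
  then have "\<Omega> (\<phi> q) (coord_frame \<phi> q) = \<Omega> (\<phi> q) ((k 4)(0 := \<i> *s k 4 0))"
    by (intro dep) (use kT T_scale in auto)
  also have "\<dots> = \<i> * \<Omega> (\<phi> q) (k 4)"
    using scale[of "k 4" 0 "k 4 0" \<i>] kT by simp
  also have "\<dots> = \<i> * ((if c then 1 else 2 * \<i>) * frame_value 1 0)"
    by (simp only: K[OF order_refl] G)
  also have "\<dots> = (if c then \<i> else - 2) * frame_value 1 0"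
    by (simp split: if_split)
  finally show ?thesis .
qed

text \<open>The volume density is a determinant over the index type \<open>5\<close>, the wedge
  computations use natural numbers below 5; conjugation with the bijection \<open>of_nat\<close>
  matches the permutations and their signs.\<close>

lemma det_of_nat:
  fixes G :: "5 \<Rightarrow> 5 \<Rightarrow> real"
  shows "Determinants.det (\<chi> i j. G i j) =
    (\<Sum>\<rho> | \<rho> permutes {..<5}. of_int (sign \<rho>) * (\<Prod>j<5. G (of_nat j) (of_nat (\<rho> j))))"
proof -
  let ?b = "of_nat :: nat \<Rightarrow> 5"
  have img: "?b ` {..<5} = UNIV"
    unfolding UNIV_5 by (auto simp: lessThan_Suc eval_nat_numeral)
  have inj: "inj_on ?b {..<5}"
    by (rule eq_card_imp_inj_on) (simp_all add: img)
  have b: "bij_betw ?b {..<5} UNIV" using inj img by (simp add: bij_betw_def)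
  let ?m = "map_permutation {..<5} ?b"
  let ?n = "map_permutation UNIV (inv_into {..<5} ?b)"
  have b': "bij_betw (inv_into {..<5} ?b) UNIV {..<5}" by (rule bij_betw_inv_into[OF b])
  have bij: "bij_betw ?m {\<rho>. \<rho> permutes {..<5}} {p. p permutes UNIV}"
  proof (rule bij_betwI[where g = ?n])
    show "?n (?m \<rho>) = \<rho>" if "\<rho> \<in> {\<rho>. \<rho> permutes {..<5}}" for \<rho>
      using that b inv_into_f_f[OF inj] by (intro map_permutation_compose_inv[OF b]) auto
    show "?m (?n p) = p" if "p \<in> {p. p permutes UNIV}" for p
      using that f_inv_into_f[of _ ?b "{..<5}"] img by (intro map_permutation_compose_inv[OF b']) auto
  qed (use map_permutation_permutes[OF b] map_permutation_permutes[OF b'] in auto)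
  have "Determinants.det (\<chi> i j. G i j) = (\<Sum>p | p permutes UNIV. of_int (sign p) * (\<Prod>i\<in>UNIV. G i (p i)))"
    by (simp add: Determinants.det_def)
  also have "\<dots> = (\<Sum>\<rho> | \<rho> permutes {..<5}. of_int (sign (?m \<rho>)) * (\<Prod>i\<in>UNIV. G i (?m \<rho> i)))"
    by (rule sum.reindex_bij_betw[OF bij, symmetric])
  also have "\<dots> = (\<Sum>\<rho> | \<rho> permutes {..<5}. of_int (sign \<rho>) * (\<Prod>j<5. G (of_nat j) (of_nat (\<rho> j))))"
  proof (rule sum.cong[OF refl])
    fix \<rho> assume "\<rho> \<in> {\<rho>. \<rho> permutes {..<5::nat}}"
    then have \<rho>: "\<rho> permutes {..<5}" by simp
    have "(\<Prod>i\<in>UNIV. G i (?m \<rho> i)) = (\<Prod>j<5. G (?b j) (?m \<rho> (?b j)))"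
      by (rule prod.reindex_bij_betw[OF b, symmetric])
    also have "\<dots> = (\<Prod>j<5. G (?b j) (?b (\<rho> j)))"
      by (rule prod.cong[OF refl]) (simp add: map_permutation_apply[OF inj])
    finally show "of_int (sign (?m \<rho>)) * (\<Prod>i\<in>UNIV. G i (?m \<rho> i)) =
        of_int (sign \<rho>) * (\<Prod>j<5. G (of_nat j) (of_nat (\<rho> j)))"
      by (simp add: sign_map_permutation[OF inj \<rho>])
  qed
  finally show ?thesis .
qed

text \<open>On these tangent spaces the Hermitian form is real and equals half the metric. The Gram
  determinant in \<open>norm_Omega_eq_det\<close> is therefore that of the metric over
  \<open>2 ^ 5\<close>, which cancels the 32.\<close>

lemma volume_density_\<phi>:
  assumes q: "q \<in> P"
  shows "volume_density (kaehler_metric (stenzel_form u)) \<phi> q = cmod (\<Omega> (\<phi> q) (coord_frame \<phi> q))"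
proof -
  let ?v = "coord_frame \<phi> q"
  have zq: "\<phi> q \<in> quadric" by (simp add: \<phi>_def slice_point_in_quadric)
  have r: "r2 (\<phi> q) \<ge> 1" by (rule r2_quadric_ge_1[OF zq])
  define g where "g i j = kaehler_metric (stenzel_form u) (\<phi> q) (frechet_derivative \<phi> (at q) (axis i 1))
      (frechet_derivative \<phi> (at q) (axis j 1))" for i j :: 5
  have h: "hform (\<phi> q) (?v i) (?v j) = of_real (g (of_nat i) (of_nat j) / 2)" for i j
    using hform_\<phi>_real[OF q] by (simp add: g_def coord_frame_def kaehler_metric_eq[OF r] complex_eq_iff)
  have "complex_of_real ((cmod (\<Omega> (\<phi> q) ?v))\<^sup>2) =
      32 * (\<Sum>\<rho> | \<rho> permutes {..<5}. of_int (sign \<rho>) * (\<Prod>j<5. hform (\<phi> q) (?v j) (?v (\<rho> j))))"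
    by (rule norm_Omega_eq_det[OF zq])
      (simp add: coord_frame_def frechet_derivative_\<phi>[OF q] \<phi>_def slice_point_def Dchart_tangent)
  also have "\<dots> = of_real (32 * (\<Sum>\<rho> | \<rho> permutes {..<5}. of_int (sign \<rho>) *
      (\<Prod>j<5. g (of_nat j) (of_nat (\<rho> j)) / 2)))"
    unfolding h by simp
  also have "(\<Sum>\<rho> | \<rho> permutes {..<5}. of_int (sign \<rho>) * (\<Prod>j<5. g (of_nat j) (of_nat (\<rho> j)) / 2)) =
      (\<Sum>\<rho> | \<rho> permutes {..<5}. of_int (sign \<rho>) * (\<Prod>j<5. g (of_nat j) (of_nat (\<rho> j)))) / 32"
    by (simp add: prod_dividef sum_divide_distrib)
  also have "\<dots> = Determinants.det (\<chi> i j. g i j) / 32" by (simp only: det_of_nat)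
  finally have "(cmod (\<Omega> (\<phi> q) ?v))\<^sup>2 = Determinants.det (\<chi> i j. g i j)"
    by (simp only: of_real_eq_iff)
  then show ?thesis
    unfolding volume_density_def g_def[symmetric] by (metis norm_ge_zero real_sqrt_unique)
qed

lemma lagrangian_angle_\<phi>:
  assumes q: "q \<in> P"
  shows "lagrangian_angle (stenzel_form u) \<Omega> \<phi> q (Arg ((if c then \<i> else - 2) * frame_value 1 0))"
  unfolding lagrangian_angle_def volume_density_\<phi>[OF q] Omega_frame[OF q]
proof (cases "(if c then \<i> else - 2) * frame_value 1 0 = 0")
  case False
  from Arg_eq[OF this]
  show "(if c then \<i> else - 2) * frame_value 1 0 = exp (\<i> * complex_of_real (Arg ((if c then \<i> else - 2) * frame_value 1 0)))
      * complex_of_real (cmod ((if c then \<i> else - 2) * frame_value 1 0))"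
    by (simp only: mult.commute)
next
  case True
  show "(if c then \<i> else - 2) * frame_value 1 0 = exp (\<i> * complex_of_real (Arg ((if c then \<i> else - 2) * frame_value 1 0)))
      * complex_of_real (cmod ((if c then \<i> else - 2) * frame_value 1 0))"
    unfolding True by simp
qed

end

section \<open>Symmetries permuting the coordinates\<close>

definition perm_coord :: "(6 \<Rightarrow> 6) \<Rightarrow> complex^6 \<Rightarrow> complex^6" where
  "perm_coord \<pi> z = (\<chi> i. z $ \<pi> i)"

lemma perm_coord_nth [simp]: "perm_coord \<pi> z $ i = z $ \<pi> i"
  by (simp add: perm_coord_def)

lemma perm_coord_linear: "perm_coord \<pi> (x + y) = perm_coord \<pi> x + perm_coord \<pi> y"
  "perm_coord \<pi> (s *s x) = s *s perm_coord \<pi> x" "perm_coord \<pi> (r *\<^sub>R x) = r *\<^sub>R perm_coord \<pi> x"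
  "perm_coord \<pi> (x - y) = perm_coord \<pi> x - perm_coord \<pi> y"
  by (simp_all add: cart_eq_iff)

lemma bounded_linear_perm_coord: "bounded_linear (perm_coord \<pi>)"
  by (rule linear_conv_bounded_linear[THEN iffD1], rule linearI) (simp_all add: perm_coord_linear)

context
  fixes \<pi> :: "6 \<Rightarrow> 6"
  assumes inv: "\<And>i. \<pi> (\<pi> i) = i"
begin

lemma perm_coord_invol [simp]: "perm_coord \<pi> (perm_coord \<pi> z) = z"
  by (simp add: cart_eq_iff inv)

lemma sum_perm: "(\<Sum>i\<in>UNIV. f (\<pi> i)) = (\<Sum>i\<in>UNIV. f i :: complex)"
proof -
  have "bij \<pi>" by (rule o_bij[of \<pi>]) (auto simp: inv)
  then show ?thesis by (rule sum.reindex_bij_betw)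
qed

lemma perm_coord_quadric [simp]: "perm_coord \<pi> z \<in> quadric \<longleftrightarrow> z \<in> quadric"
  unfolding quadric_def mem_Collect_eq perm_coord_nth by (subst sum_perm[of "\<lambda>i. (z $ i)\<^sup>2"]) simp

lemma perm_coord_tangent: "perm_coord \<pi> w \<in> quadric_tangent (perm_coord \<pi> z) \<longleftrightarrow> w \<in> quadric_tangent z"
  unfolding quadric_tangent_def mem_Collect_eq perm_coord_nth by (subst sum_perm[of "\<lambda>i. z $ i * w $ i"]) simp

lemma herm_perm_coord: "herm (perm_coord \<pi> v) (perm_coord \<pi> w) = herm v w"
  unfolding herm_def perm_coord_nth by (rule sum_perm[of "\<lambda>i. v $ i * cnj (w $ i)"])

lemma r2_perm_coord: "r2 (perm_coord \<pi> z) = r2 z"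
  using herm_perm_coord[of z z] by (simp add: herm_self)

lemma inj_perm_coord: "inj (perm_coord \<pi>)"
  by (metis injI perm_coord_invol)

lemma frechet_derivative_perm_coord:
  assumes "\<psi> differentiable (at w)"
  shows "frechet_derivative (\<lambda>w. perm_coord \<pi> (\<psi> w)) (at w) = (\<lambda>h. perm_coord \<pi> (frechet_derivative \<psi> (at w) h))"
  using assms unfolding frechet_derivative_works
  by (intro frechet_derivative_eqI bounded_linear.has_derivative[OF bounded_linear_perm_coord])

lemma coord_frame_perm_coord:
  assumes "\<psi> differentiable (at w)"
  shows "coord_frame (\<lambda>w. perm_coord \<pi> (\<psi> w)) w = (\<lambda>i. perm_coord \<pi> (coord_frame \<psi> w i))"
  by (simp add: coord_frame_def frechet_derivative_perm_coord[OF assms])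

lemma local_parametrization_perm_coord:
  assumes lp: "local_parametrization L \<phi> U" and L: "\<And>z. perm_coord \<pi> z \<in> L \<longleftrightarrow> z \<in> L"
  shows "local_parametrization L (\<lambda>q. perm_coord \<pi> (\<phi> q)) U"
  unfolding local_parametrization_def
proof (intro conjI ballI)
  note * = lp[unfolded local_parametrization_def]
  show "open U" using * by blast
  show "smooth_on (\<lambda>q. perm_coord \<pi> (\<phi> q)) U"
    using * unfolding smooth_on_def by (blast intro: Ck_on_linear_comp[OF bounded_linear_perm_coord])
  show "inj (frechet_derivative (\<lambda>q. perm_coord \<pi> (\<phi> q)) (at q))" if q: "q \<in> U" for q
  proof -
    have d: "\<phi> differentiable (at q)"
      using smooth_on_has_derivative[of \<phi> U q] * q by (auto simp: differentiable_def)
    show ?thesis unfolding frechet_derivative_perm_coord[OF d]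
      using * q inj_perm_coord by (auto simp: inj_def)
  qed
  obtain g where g: "homeomorphism U (\<phi> ` U) \<phi> g" using * by blast
  have c: "continuous_on S (perm_coord \<pi>)" for S
    by (rule linear_continuous_on[OF bounded_linear_perm_coord])
  have "homeomorphism U ((\<lambda>q. perm_coord \<pi> (\<phi> q)) ` U) (\<lambda>q. perm_coord \<pi> (\<phi> q)) (\<lambda>z. g (perm_coord \<pi> z))"
  proof (rule homeomorphismI)
    show "continuous_on U (\<lambda>q. perm_coord \<pi> (\<phi> q))"
      by (rule continuous_on_compose2[OF c[of UNIV] homeomorphism_cont1[OF g]]) auto
    show "continuous_on ((\<lambda>q. perm_coord \<pi> (\<phi> q)) ` U) (\<lambda>z. g (perm_coord \<pi> z))"
      by (rule continuous_on_compose2[OF homeomorphism_cont2[OF g] c]) auto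
  qed (use homeomorphism_apply1[OF g] in auto)
  then show "\<exists>g. homeomorphism U ((\<lambda>q. perm_coord \<pi> (\<phi> q)) ` U) (\<lambda>q. perm_coord \<pi> (\<phi> q)) g" by blast
  obtain T where T: "open T" "\<phi> ` U = L \<inter> T" using * by (auto simp: openin_open)
  have "(\<lambda>q. perm_coord \<pi> (\<phi> q)) ` U = L \<inter> perm_coord \<pi> -` T"
  proof -
    have "(\<lambda>q. perm_coord \<pi> (\<phi> q)) ` U = perm_coord \<pi> ` (L \<inter> T)" by (simp add: T(2)[symmetric] image_image)
    also have "\<dots> = L \<inter> perm_coord \<pi> -` T" using L by (force simp: image_iff intro: perm_coord_invol[symmetric])
    finally show ?thesis .
  qed
  moreover have "open (perm_coord \<pi> -` T)" using open_vimage[OF T(1) c] .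
  ultimately show "openin (top_of_set L) ((\<lambda>q. perm_coord \<pi> (\<phi> q)) ` U)" by (auto simp: openin_open)
qed

end

context stenzel
begin

lemma hform_perm_coord:
  assumes "\<And>i. \<pi> (\<pi> i) = i"
  shows "hform (perm_coord \<pi> z) (perm_coord \<pi> v) (perm_coord \<pi> w) = hform z v w"
  by (simp add: hform_def herm_perm_coord[OF assms] r2_perm_coord[OF assms])

lemma stenzel_form_perm_coord:
  assumes "\<And>i. \<pi> (\<pi> i) = i" "r2 z \<ge> 1"
  shows "stenzel_form u (perm_coord \<pi> z) (perm_coord \<pi> v) (perm_coord \<pi> w) = stenzel_form u z v w"
proof -
  have "r2 (perm_coord \<pi> z) \<ge> 1" using assms(2) by (simp add: r2_perm_coord[OF assms(1)])
  then show ?thesis by (simp add: stenzel_form_eq assms(2) hform_perm_coord[OF assms(1)])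
qed

lemma kaehler_metric_perm_coord:
  assumes "\<And>i. \<pi> (\<pi> i) = i" "r2 z \<ge> 1"
  shows "kaehler_metric (stenzel_form u) (perm_coord \<pi> z) (perm_coord \<pi> v) (perm_coord \<pi> w) =
    kaehler_metric (stenzel_form u) z v w"
  unfolding kaehler_metric_def perm_coord_linear(2)[symmetric] stenzel_form_perm_coord[OF assms] ..

lemma volume_density_perm_coord:
  assumes "\<And>i. \<pi> (\<pi> i) = i" "r2 (\<phi> q) \<ge> 1" "\<phi> differentiable (at q)"
  shows "volume_density (kaehler_metric (stenzel_form u)) (\<lambda>q. perm_coord \<pi> (\<phi> q)) q =
    volume_density (kaehler_metric (stenzel_form u)) \<phi> q"
  unfolding volume_density_def frechet_derivative_perm_coord[OF assms(1,3)] kaehler_metric_perm_coord[OF assms(1,2)] ..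

end

section \<open>Transport of the holomorphic volume form by a symmetry\<close>

definition pullback :: "(6 \<Rightarrow> 6) \<Rightarrow> (complex^6 \<Rightarrow> (complex^6) form) \<Rightarrow> complex^6 \<Rightarrow> (complex^6) form" where
  "pullback \<pi> \<Omega> z v = \<Omega> (perm_coord \<pi> z) (\<lambda>i. perm_coord \<pi> (v i))"

lemma holomorphic_immersion_perm_coord:
  assumes inv: "\<And>i. \<pi> (\<pi> i) = i" and \<psi>: "holomorphic_immersion_quadric \<psi> W"
  shows "holomorphic_immersion_quadric (\<lambda>w. perm_coord \<pi> (\<psi> w)) W" "w \<in> W \<Longrightarrow> \<psi> differentiable (at w)"
proof -
  have diff: "\<psi> differentiable (at w)" if "w \<in> W" for w
  proof -
    have "\<forall>i. \<exists>D. ((\<lambda>w. \<psi> w $ i) has_derivative D) (at w)"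
      using \<psi> that unfolding holomorphic_immersion_quadric_def holomorphic_fun_on_def by blast
    then have "(\<lambda>w. \<psi> w $ i) differentiable (at w)" for i by (simp add: differentiable_def)
    from differentiable_vec_lambda[of "\<lambda>i w. \<psi> w $ i" w, OF this] show ?thesis by simp
  qed
  then show "w \<in> W \<Longrightarrow> \<psi> differentiable (at w)" .
  show "holomorphic_immersion_quadric (\<lambda>w. perm_coord \<pi> (\<psi> w)) W"
    unfolding holomorphic_immersion_quadric_def
  proof (intro conjI allI ballI)
    show "inj (frechet_derivative (\<lambda>w. perm_coord \<pi> (\<psi> w)) (at w))" if "w \<in> W" for w
      unfolding frechet_derivative_perm_coord[OF inv diff[OF that]]
      using \<psi> that inj_perm_coord[OF inv] unfolding holomorphic_immersion_quadric_def by (auto simp: inj_def)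
  qed (use \<psi> perm_coord_quadric[OF inv] in \<open>auto simp: holomorphic_immersion_quadric_def\<close>)
qed

context stenzel_volume
begin

text \<open>The pulled back form meets the same hypotheses, so everything proved for the pivot
  \<open>W1\<close> applies to it; this replaces separate computations for the other pivots.\<close>

lemma stenzel_volume_form_pullback:
  assumes inv: "\<And>i. \<pi> (\<pi> i) = i"
  shows "stenzel_volume_form u (pullback \<pi> \<Omega>)"
  unfolding stenzel_volume_form_def holomorphic_volume_form_def
proof (intro conjI ballI allI impI)
  let ?P = "perm_coord \<pi>"
  note [simp] = perm_coord_quadric[OF inv] perm_coord_tangent[OF inv] perm_coord_invol[OF inv]
  have vol: "holomorphic_volume_form \<Omega>" using volume by (simp add: stenzel_volume_form_def)
  show "complex_alternating_form 5 (quadric_tangent z) (pullback \<pi> \<Omega> z)" if z: "z \<in> quadric" for z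
  proof -
    interpret alternating_form 5 "quadric_tangent (?P z)" "\<Omega> (?P z)"
      by (rule alternating_Omega) (simp add: z)
    have upd: "(\<lambda>i. ?P ((v(j := a)) i)) = (\<lambda>i. ?P (v i))(j := ?P a)" for v :: "nat \<Rightarrow> complex^6" and j a by auto
    show ?thesis
      unfolding complex_alternating_form_def pullback_def upd perm_coord_linear
    proof (intro allI impI conjI ballI)
      fix v :: "nat \<Rightarrow> complex^6" assume v: "\<forall>i<5. v i \<in> quadric_tangent z"
      show "\<Omega> (?P z) (\<lambda>i. ?P (v' i)) = \<Omega> (?P z) (\<lambda>i. ?P (v i))" if "\<forall>i<5. v' i = v i" for v' :: "nat \<Rightarrow> complex^6"
        by (rule dep) (use v that in auto)
      show "\<Omega> (?P z) ((\<lambda>i. ?P (v i))(i := ?P a + ?P b)) =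
          \<Omega> (?P z) ((\<lambda>i. ?P (v i))(i := ?P a)) + \<Omega> (?P z) ((\<lambda>i. ?P (v i))(i := ?P b))"
        if "i < 5" "a \<in> quadric_tangent z" "b \<in> quadric_tangent z" for i a b
        by (rule add) (use v that in auto)
      show "\<Omega> (?P z) ((\<lambda>i. ?P (v i))(i := s *s ?P a)) = s * \<Omega> (?P z) ((\<lambda>i. ?P (v i))(i := ?P a))"
        if "i < 5" "a \<in> quadric_tangent z" for i a s
        by (rule scale) (use v that in auto)
      show "\<Omega> (?P z) (\<lambda>i. ?P (v i)) = 0" if "i < 5" "j < 5" "i \<noteq> j \<and> v i = v j" for i j
        by (rule eq_zero[of _ i j]) (use v that in auto)
    qed
  qed
  show "\<exists>v. (\<forall>i<5. v i \<in> quadric_tangent z) \<and> pullback \<pi> \<Omega> z v \<noteq> 0" if z: "z \<in> quadric" for z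
  proof -
    have "?P z \<in> quadric" using z by simp
    then obtain v where v: "\<forall>i<5. v i \<in> quadric_tangent (?P z)" "\<Omega> (?P z) v \<noteq> 0"
      using vol unfolding holomorphic_volume_form_def by blast
    have "?P (v i) \<in> quadric_tangent z" if "i < 5" for i
      using v(1) that perm_coord_tangent[OF inv, of "?P (v i)" z] by simp
    then show ?thesis using v(2) by (intro exI[of _ "\<lambda>i. ?P (v i)"]) (simp add: pullback_def)
  qed
  show "holomorphic_fun_on (\<lambda>w. pullback \<pi> \<Omega> (\<psi> w) (coord_frame \<psi> w)) W"
    if \<psi>: "holomorphic_immersion_quadric \<psi> W" for \<psi> W
  proof -
    have W: "open W" using \<psi> by (simp add: holomorphic_immersion_quadric_def)
    have h: "holomorphic_fun_on (\<lambda>w. \<Omega> (?P (\<psi> w)) (coord_frame (\<lambda>w. ?P (\<psi> w)) w)) W"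
      using vol holomorphic_immersion_perm_coord(1)[OF inv \<psi>] unfolding holomorphic_volume_form_def by blast
    have e: "\<Omega> (?P (\<psi> w)) (coord_frame (\<lambda>w. ?P (\<psi> w)) w) = pullback \<pi> \<Omega> (\<psi> w) (coord_frame \<psi> w)"
      if "w \<in> W" for w
      unfolding pullback_def coord_frame_perm_coord[OF inv holomorphic_immersion_perm_coord(2)[OF inv \<psi> that]] ..
    show ?thesis
      unfolding holomorphic_fun_on_def
    proof
      fix w assume w: "w \<in> W"
      obtain D where D: "((\<lambda>w. \<Omega> (?P (\<psi> w)) (coord_frame (\<lambda>w. ?P (\<psi> w)) w)) has_derivative D) (at w)"
          "\<forall>s v. D (s *s v) = s * D v"
        using h w unfolding holomorphic_fun_on_def by blast
      have "((\<lambda>w. pullback \<pi> \<Omega> (\<psi> w) (coord_frame \<psi> w)) has_derivative D) (at w)"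
        by (rule has_derivative_transform_within_open[OF D(1) W w]) (rule e)
      then show "\<exists>D. ((\<lambda>w. pullback \<pi> \<Omega> (\<psi> w) (coord_frame \<psi> w)) has_derivative D) (at w) \<and> (\<forall>s v. D (s *s v) = s * D v)"
        using D(2) by blast
    qed
  qed
  show "wedge_power 2 (\<lambda>v. stenzel_form u z (v 0) (v 1)) 5 v / fact 5 =
      (- 1) ^ (5 * (5 - 1) div 2) * (\<i> / 2) ^ 5 * wedge 5 5 (pullback \<pi> \<Omega> z) (\<lambda>v. cnj (pullback \<pi> \<Omega> z v)) v"
    if z: "z \<in> quadric" and v: "\<forall>i<10. v i \<in> quadric_tangent z" for z v
  proof -
    have r: "r2 z \<ge> 1" by (rule r2_quadric_ge_1[OF z])
    have "wedge_power 2 (\<lambda>v. stenzel_form u z (v 0) (v 1)) k v =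
        wedge_power 2 (\<lambda>v. stenzel_form u (?P z) (v 0) (v 1)) k (\<lambda>i. ?P (v i))" for k v
      by (induction k arbitrary: v) (simp_all add: wedge_def stenzel_form_perm_coord[OF inv r])
    moreover have "wedge 5 5 (pullback \<pi> \<Omega> z) (\<lambda>v. cnj (pullback \<pi> \<Omega> z v)) v =
        wedge 5 5 (\<Omega> (?P z)) (\<lambda>v. cnj (\<Omega> (?P z) v)) (\<lambda>i. ?P (v i))"
      by (simp add: wedge_def pullback_def)
    moreover have "?P z \<in> quadric" "\<forall>i<10. ?P (v i) \<in> quadric_tangent (?P z)" using z v by auto
    moreover from volume[unfolded stenzel_volume_form_def, THEN conjunct2, rule_format, of "?P z" "\<lambda>i. ?P (v i)"] this
    have "wedge_power 2 (\<lambda>v. stenzel_form u (?P z) (v 0) (v 1)) 5 (\<lambda>i. ?P (v i)) / fact 5 =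
      (- 1) ^ (5 * (5 - 1) div 2) * (\<i> / 2) ^ 5 * wedge 5 5 (\<Omega> (?P z)) (\<lambda>v. cnj (\<Omega> (?P z) v)) (\<lambda>i. ?P (v i))"
      by simp
    ultimately show ?thesis by (simp only:)
  qed
qed

lemma stenzel_volume_pullback:
  assumes inv: "\<And>i. \<pi> (\<pi> i) = i"
  shows "stenzel_volume \<kappa> u S (pullback \<pi> \<Omega>)"
  by unfold_locales (rule stenzel_volume_form_pullback[OF inv])

text \<open>At a fixed point of the symmetry the two values can be compared directly.\<close>

lemma frame_value_pullback:
  assumes inv: "\<And>i. \<pi> (\<pi> i) = i"
    and ij: "i < 5" "j < 5" "i \<noteq> 0" "j \<noteq> 0" "i \<noteq> j"
    and fixed: "perm_coord \<pi> (chart k p) = chart k p"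
    and f: "\<And>l. l < 5 \<Longrightarrow> l \<noteq> i \<Longrightarrow> l \<noteq> j \<Longrightarrow> perm_coord \<pi> (coord_frame (chart k) p l) = coord_frame (chart k) p l"
    "perm_coord \<pi> (coord_frame (chart k) p i) = coord_frame (chart k) p 0 - coord_frame (chart k) p i"
    "perm_coord \<pi> (coord_frame (chart k) p j) = - coord_frame (chart k) p j"
  shows "stenzel_volume.frame_value (pullback \<pi> \<Omega>) k' q = frame_value k' q"
proof -
  interpret pb: stenzel_volume \<kappa> u S "pullback \<pi> \<Omega>" by (rule stenzel_volume_pullback[OF inv])
  let ?f = "coord_frame (chart k) p"
  interpret alternating_form 5 "quadric_tangent (chart k p)" "\<Omega> (chart k p)"
    by (rule alternating_Omega[OF chart_in_quadric])
  have T: "?f l \<in> quadric_tangent (chart k p)" for l by (simp add: coord_frame_chart Dchart_tangent)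
  \<comment> \<open>On the frame the symmetry has determinant 1: sign changes in the slots
    \<open>j\<close> and \<open>i\<close>, then the vector of slot 0 added to slot
    \<open>i\<close>.\<close>
  define y where "y = ?f(j := (- 1) *s ?f j)"
  define x where "x = y(i := (- 1) *s y i)"
  have yT: "y l \<in> quadric_tangent (chart k p)" for l
    using T T_scale[OF T, of "- 1" j] by (simp add: y_def)
  have xT: "x l \<in> quadric_tangent (chart k p)" for l
    using yT T_scale[OF yT, of "- 1" i] by (simp add: x_def)
  have "pb.frame_value k p = \<Omega> (chart k p) (\<lambda>l. perm_coord \<pi> (?f l))"
    by (simp add: pb.frame_value_def pullback_def fixed)
  also have "\<dots> = \<Omega> (chart k p) (x(i := x i + 1 *s x 0))"
  proof (rule dep)
    show "(x(i := x i + 1 *s x 0)) l \<in> quadric_tangent (chart k p)" for l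
      using xT T_add[OF xT xT] by simp
    show "perm_coord \<pi> (?f l) = (x(i := x i + 1 *s x 0)) l" if "l < 5" for l
      using f(1)[OF that] f(2,3) ij by (cases "l = i"; cases "l = j") (auto simp: x_def y_def)
  qed
  also have "\<dots> = \<Omega> (chart k p) x" by (rule add_multiple) (use xT ij in auto)
  also have "\<dots> = - \<Omega> (chart k p) y" unfolding x_def using scale[of y i "y i" "- 1"] yT ij by simp
  also have "\<dots> = \<Omega> (chart k p) ?f" unfolding y_def using scale[of ?f j "?f j" "- 1"] T ij by simp
  also have "\<dots> = frame_value k p" by (simp add: frame_value_def)
  finally show ?thesis using pb.frame_value_eq frame_value_eq by metis
qed

end

section \<open>The orbits of the level sets\<close>

text \<open>\<open>\<zeta>\<close> rotates the point back to the Lagrangian, where the null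
  coordinates are real. The exception is the third pair in the second case; its relation is
  invariant and therefore stated without \<open>\<zeta>\<close>.\<close>

definition in_orbit :: "bool \<Rightarrow> complex^6 \<Rightarrow> bool" where
  "in_orbit c z \<longleftrightarrow> (\<exists>\<zeta>. cmod \<zeta> = 1 \<and> Im (W1 z * \<zeta>) = 0 \<and> Im (W2 z * \<zeta>) = 0 \<and>
     Im (V1 z * cnj \<zeta>) = 0 \<and> Im (V2 z * cnj \<zeta>) = 0 \<and>
     (if c then Im (W3 z * \<zeta>) = 0 \<and> Im (V3 z * cnj \<zeta>) = 0 else V3 z = - cnj (W3 z)))"

lemma cmod_1_mult_cnj: "cmod \<zeta> = 1 \<Longrightarrow> \<zeta> * cnj \<zeta> = 1"
  by (simp add: complex_norm_square[symmetric])

lemma Im_0_times_unit: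
  assumes "cmod \<zeta> = 1" "Im (x * \<zeta>) = 0"
  shows "x = of_real (Re (x * \<zeta>)) * cnj \<zeta>"
proof -
  have "of_real (Re (x * \<zeta>)) = x * \<zeta>" using assms(2) by (simp only: complex_eq_iff) simp
  then show ?thesis using cmod_1_mult_cnj[OF assms(1)] by (simp only: mult.assoc) simp
qed

lemma WV_minus [simp]: "W1 (x - y) = W1 x - W1 y" "W2 (x - y) = W2 x - W2 y" "W3 (x - y) = W3 x - W3 y"
  "V1 (x - y) = V1 x - V1 y" "V2 (x - y) = V2 x - V2 y" "V3 (x - y) = V3 x - V3 y"
  "W1 (- x) = - W1 x" "W2 (- x) = - W2 x" "W3 (- x) = - W3 x" "V1 (- x) = - V1 x" "V2 (- x) = - V2 x" "V3 (- x) = - V3 x"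
  by (simp_all add: WV_defs algebra_simps)

lemma Im_of_real_quotient: "Im (of_real a * w / (of_real b * w)) = 0" "cmod \<zeta> = 1 \<Longrightarrow> Im (of_real a * \<zeta> * (of_real b * cnj \<zeta>)) = 0"
proof -
  show "Im (of_real a * w / (of_real b * w)) = 0"
    by (cases "w = 0") (simp_all flip: of_real_divide)
  assume "cmod \<zeta> = 1"
  have "of_real a * \<zeta> * (of_real b * cnj \<zeta>) = of_real (a * b) * (\<zeta> * cnj \<zeta>)" by simp
  then show "Im (of_real a * \<zeta> * (of_real b * cnj \<zeta>)) = 0"
    unfolding cmod_1_mult_cnj[OF \<open>cmod \<zeta> = 1\<close>] by simp
qed

lemma exp_Complex_Arg:
  assumes "w \<noteq> 0"
  shows "w = exp (Complex (ln (cmod w)) (Arg w))"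
proof -
  have e: "Complex (ln (cmod w)) (Arg w) = of_real (ln (cmod w)) + \<i> * of_real (Arg w)"
    by (simp add: complex_eq_iff)
  have "exp (Complex (ln (cmod w)) (Arg w)) = of_real (cmod w) * exp (\<i> * of_real (Arg w))"
    unfolding e exp_add exp_of_real using assms by simp
  then show ?thesis using Arg_eq[OF assms] by simp
qed

lemma Im_mult_eq_0: "Im a = 0 \<Longrightarrow> Im b = 0 \<Longrightarrow> Im (a * b) = 0"
  by simp

text \<open>A given \<open>\<zeta>\<close> cancels in the quotients and products. Conversely
  \<open>\<zeta>\<close> is chosen to make \<open>W1\<close> positive, and the quadric equation
  shows that \<open>W1 * V1\<close> is real, which settles \<open>V1\<close>.\<close>

lemma in_orbit_iff_real_slice:
  assumes z: "z \<in> quadric" and W1: "W1 z \<noteq> 0"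
  shows "in_orbit c z \<longleftrightarrow> real_slice c z"
proof
  assume "in_orbit c z"
  then obtain \<zeta> where \<zeta>: "cmod \<zeta> = 1" and w: "Im (W1 z * \<zeta>) = 0" "Im (W2 z * \<zeta>) = 0" "Im (V2 z * cnj \<zeta>) = 0"
    "if c then Im (W3 z * \<zeta>) = 0 \<and> Im (V3 z * cnj \<zeta>) = 0 else V3 z = - cnj (W3 z)"
    unfolding in_orbit_def by blast
  have \<zeta>': "cmod (cnj \<zeta>) = 1" using \<zeta> by simp
  have quot: "Im (x / W1 z) = 0" if "Im (x * \<zeta>) = 0" for x
    by (subst Im_0_times_unit[OF \<zeta> that], subst Im_0_times_unit[OF \<zeta> w(1)]) (rule Im_of_real_quotient)
  have prod: "Im (x * W1 z) = 0" if "Im (x * cnj \<zeta>) = 0" for x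
    using Im_of_real_quotient(2)[OF \<zeta>] Im_0_times_unit[OF \<zeta>' that] Im_0_times_unit[OF \<zeta> w(1)]
    by (metis complex_cnj_cnj)
  show "real_slice c z"
    unfolding real_slice_def using quot[OF w(2)] prod[OF w(3)] w(4) quot[of "W3 z"] prod[of "V3 z"] by presburger
next
  assume r: "real_slice c z"
  define \<zeta> where "\<zeta> = cnj (W1 z) / of_real (cmod (W1 z))"
  have \<zeta>: "cmod \<zeta> = 1" using W1 by (simp add: \<zeta>_def norm_divide)
  have W1\<zeta>: "W1 z * \<zeta> = of_real (cmod (W1 z))"
    using W1 complex_norm_square[of "W1 z"] by (simp add: \<zeta>_def field_simps power2_eq_square)
  have c\<zeta>: "cnj \<zeta> = W1 z / of_real (cmod (W1 z))" by (simp add: \<zeta>_def)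
  have W: "Im (x * \<zeta>) = 0" if "Im (x / W1 z) = 0" for x
  proof -
    have e: "x * \<zeta> = (x / W1 z) * of_real (cmod (W1 z))" using W1 by (simp flip: W1\<zeta>)
    show ?thesis unfolding e by (rule Im_mult_eq_0[OF that]) simp
  qed
  have V: "Im (x * cnj \<zeta>) = 0" if "Im (x * W1 z) = 0" for x
  proof -
    have "x * cnj \<zeta> = x * W1 z / of_real (cmod (W1 z))" by (simp add: c\<zeta>)
    then show ?thesis using that by (simp del: times_complex.sel)
  qed
  have prod: "Im (x * y) = 0" if "Im (x / W1 z) = 0" "Im (y * W1 z) = 0" for x y
  proof -
    have e: "x * y = (x / W1 z) * (y * W1 z)" using W1 by simp
    show ?thesis unfolding e by (rule Im_mult_eq_0[OF that])
  qed
  have "Im (W2 z * V2 z) = 0" using r prod unfolding real_slice_def by blast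
  moreover have "Im (W3 z * V3 z) = 0"
  proof (cases c)
    case True
    then show ?thesis using r prod unfolding real_slice_def by presburger
  next
    case False
    then show ?thesis using r unfolding real_slice_def by simp
  qed
  moreover have "V1 z * W1 z = 1 - W2 z * V2 z - W3 z * V3 z"
    using z unfolding quadric_iff_WV by (simp add: algebra_simps)
  ultimately have "Im (V1 z * W1 z) = 0" by (simp only: minus_complex.sel) simp
  moreover have "Im (W1 z * \<zeta>) = 0" unfolding W1\<zeta> by simp
  ultimately show "in_orbit c z"
    unfolding in_orbit_def using r \<zeta> W[of "W2 z"] W[of "W3 z"] V[of "V1 z"] V[of "V2 z"] V[of "V3 z"]
    unfolding real_slice_def by (intro exI[of _ \<zeta>]) presburger
qed

section \<open>Change of the pivot coordinate\<close>

definition swap12 :: "6 \<Rightarrow> 6" where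
  "swap12 i = (if i = 1 then 3 else if i = 3 then 1 else if i = 2 then 4 else if i = 4 then 2 else i)"

definition swap13 :: "6 \<Rightarrow> 6" where
  "swap13 i = (if i = 1 then 5 else if i = 5 then 1 else if i = 2 then 6 else if i = 6 then 2 else i)"

text \<open>The third pair may be exchanged in the first case only, where it satisfies the same
  reality condition as the other pairs.\<close>

definition admissible :: "bool \<Rightarrow> (6 \<Rightarrow> 6) set" where
  "admissible c = {id, swap12} \<union> (if c then {swap13} else {})"

lemma WV_swap12 [simp]: "W1 (perm_coord swap12 z) = W2 z" "W2 (perm_coord swap12 z) = W1 z"
  "W3 (perm_coord swap12 z) = W3 z" "V1 (perm_coord swap12 z) = V2 z" "V2 (perm_coord swap12 z) = V1 z"
  "V3 (perm_coord swap12 z) = V3 z"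
  by (simp_all add: WV_defs swap12_def)

lemma WV_swap13 [simp]: "W1 (perm_coord swap13 z) = W3 z" "W2 (perm_coord swap13 z) = W2 z"
  "W3 (perm_coord swap13 z) = W1 z" "V1 (perm_coord swap13 z) = V3 z" "V2 (perm_coord swap13 z) = V2 z"
  "V3 (perm_coord swap13 z) = V1 z"
  by (simp_all add: WV_defs swap13_def)

lemma perm_coord_id [simp]: "perm_coord id z = z"
  by (simp add: cart_eq_iff)

lemma admissible_invol: "\<pi> \<in> admissible c \<Longrightarrow> \<pi> (\<pi> i) = i"
  by (auto simp: admissible_def swap12_def swap13_def split: if_splits)

lemma admissible_null_diff: "\<pi> \<in> admissible c \<Longrightarrow> null_diff (perm_coord \<pi> z) = null_diff z"
  by (auto simp: admissible_def null_diff_def split: if_splits)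

lemma admissible_in_orbit: "\<pi> \<in> admissible c \<Longrightarrow> in_orbit c (perm_coord \<pi> z) \<longleftrightarrow> in_orbit c z"
  unfolding admissible_def in_orbit_def
  by (auto split: if_splits simp del: times_complex.sel)

text \<open>In the second case the vanishing of \<open>W1\<close> and \<open>W2\<close> would turn
  the quadric equation into \<open>- |W3|^2 = 1\<close>, so a pivot among the first two pairs always
  exists.\<close>

lemma admissible_obtain:
  assumes "z \<in> quadric" "in_orbit c z"
  obtains \<pi> where "\<pi> \<in> admissible c" "W1 (perm_coord \<pi> z) \<noteq> 0"
proof -
  have "W1 z \<noteq> 0 \<or> W2 z \<noteq> 0 \<or> c \<and> W3 z \<noteq> 0"
  proof (rule ccontr)
    assume *: "\<not> ?thesis"
    then have "W3 z * V3 z = 1" using assms(1) by (simp add: quadric_iff_WV)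
    moreover from this have "\<not> c" using * by auto
    ultimately have "- (W3 z * cnj (W3 z)) = 1" using assms(2) unfolding in_orbit_def by auto
    then have "- (complex_of_real ((cmod (W3 z))\<^sup>2)) = 1" by (simp only: complex_norm_square)
    then have "- ((cmod (W3 z))\<^sup>2) = 1" by (metis of_real_eq_1_iff of_real_minus)
    then show False by (smt (verit) zero_le_power2)
  qed
  then show ?thesis
    using that[of id] that[of swap12] that[of swap13] by (auto simp: admissible_def)
qed

context stenzel_volume
begin

lemma frame_value_admissible:
  assumes "\<pi> \<in> admissible c"
  shows "stenzel_volume.frame_value (pullback \<pi> \<Omega>) k q = frame_value k q"
proof -
  have l: "l \<in> {0, 1, 2, 3, 4}" if "l < 5" for l :: nat using that by auto
  consider "\<pi> = id" | "\<pi> = swap12" | "\<pi> = swap13" using assms by (auto simp: admissible_def split: if_splits)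
  then show ?thesis
  proof cases
    case 1
    have "pullback \<pi> \<Omega> = \<Omega>" by (simp add: 1 pullback_def fun_eq_iff)
    then show ?thesis by simp
  next
    case 2
    \<comment> \<open>The point with \<open>W1 = W2 = 1\<close>, \<open>V1 = V2 = 1 / 2\<close> and
      vanishing third pair, which the swap fixes.\<close>
    define p :: "complex^5" where "p = (\<chi> i. if i = 1 then 1 else if i = 3 then 1 / 2 else 0)"
    have p: "p $ 0 = 0" "p $ 1 = 1" "p $ 2 = 0" "p $ 3 = 1 / 2" "p $ 4 = 0" by (simp_all add: p_def)
    show ?thesis unfolding 2
    proof (rule frame_value_pullback[where i = 1 and j = 3 and p = p and k = 1])
      show "swap12 (swap12 i) = i" for i by (rule admissible_invol[of _ True]) (simp add: admissible_def)
      show "perm_coord swap12 (chart 1 p) = chart 1 p" by (rule WV_eqI) (simp_all add: chart_def p)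
      show "perm_coord swap12 (coord_frame (chart 1) p m) = coord_frame (chart 1) p m" if "m < 5" "m \<noteq> 1" "m \<noteq> 3" for m
        by (rule WV_eqI) (use l[OF that(1)] that(2,3) in \<open>auto simp: coord_frame_chart Dchart_def p axis_def\<close>)
    qed (simp_all, (rule WV_eqI; simp add: coord_frame_chart Dchart_def p axis_def WV_minus)+)
  next
    case 3
    \<comment> \<open>The analogous fixed point, with the roles of the second and third pairs
      exchanged.\<close>
    define p :: "complex^5" where "p = (\<chi> i. if i = 2 then 1 else if i = 4 then 1 / 2 else 0)"
    have p: "p $ 0 = 0" "p $ 1 = 0" "p $ 2 = 1" "p $ 3 = 0" "p $ 4 = 1 / 2" by (simp_all add: p_def)
    show ?thesis unfolding 3
    proof (rule frame_value_pullback[where i = 2 and j = 4 and p = p and k = 1])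
      show "swap13 (swap13 i) = i" for i by (rule admissible_invol[of _ True]) (simp add: admissible_def)
      show "perm_coord swap13 (chart 1 p) = chart 1 p" by (rule WV_eqI) (simp_all add: chart_def p)
      show "perm_coord swap13 (coord_frame (chart 1) p m) = coord_frame (chart 1) p m" if "m < 5" "m \<noteq> 2" "m \<noteq> 4" for m
        by (rule WV_eqI) (use l[OF that(1)] that(2,3) in \<open>auto simp: coord_frame_chart Dchart_def p axis_def\<close>)
    qed (simp_all, (rule WV_eqI; simp add: coord_frame_chart Dchart_def p axis_def WV_minus)+)
  qed
qed

definition orbit_set :: "bool \<Rightarrow> real \<Rightarrow> (complex^6) set" where
  "orbit_set c c0 = {z \<in> quadric. in_orbit c z \<and> moment z = c0}"

lemma orbit_set_perm_coord:
  assumes "\<pi> \<in> admissible c"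
  shows "perm_coord \<pi> z \<in> orbit_set c c0 \<longleftrightarrow> z \<in> orbit_set c c0"
proof -
  note inv = admissible_invol[OF assms]
  show ?thesis
    by (simp add: orbit_set_def moment_def perm_coord_quadric[OF inv] r2_perm_coord[OF inv]
        admissible_null_diff[OF assms] admissible_in_orbit[OF assms])
qed

lemma slice_piece_exists:
  assumes \<pi>: "\<pi> \<in> admissible c"
  obtains Sf P where "slice_piece \<kappa> u S (pullback \<pi> \<Omega>) c c0 (orbit_set c c0) Sf P"
proof -
  show thesis
  proof (rule implicit_function_monotone[OF smooth_slice_moment[of c] slice_moment_derivative_pos, of c0])
    fix Sf P
    assume *: "open P" "smooth_on Sf P" "\<And>q. q \<in> P \<Longrightarrow> slice_moment c (Sf q, q) = c0"
      "\<And>s q. slice_moment c (s, q) = c0 \<Longrightarrow> q \<in> P \<and> Sf q = s"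
    have "slice_piece \<kappa> u S (pullback \<pi> \<Omega>) c c0 (orbit_set c c0) Sf P"
      unfolding slice_piece_def slice_piece_axioms_def
    proof (intro conjI allI impI)
      show "stenzel_volume \<kappa> u S (pullback \<pi> \<Omega>)" by (rule stenzel_volume_pullback[OF admissible_invol[OF \<pi>]])
    qed (use * in \<open>auto simp: orbit_set_def in_orbit_iff_real_slice\<close>)
    then show thesis by (rule that)
  qed
qed

text \<open>One angle serves all pivots because \<open>frame_value\<close> is unchanged by the
  admissible pullbacks. To test isotropy on an arbitrary parametrization, it is permuted until the
  given point lies in the domain of a slice, and the result is carried back.\<close>

theorem special_lagrangian_orbit_set: "special_lagrangian (stenzel_form u) \<Omega> (orbit_set c c0)"
proof -
  let ?L = "orbit_set c c0"
  let ?\<theta> = "Arg ((if c then \<i> else - 2) * frame_value 1 0)"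
  have quad: "?L \<subseteq> quadric" by (auto simp: orbit_set_def)
  have param: "\<exists>\<phi> U. local_parametrization ?L \<phi> U \<and> z \<in> \<phi> ` U \<and>
      (\<forall>q\<in>U. lagrangian_angle (stenzel_form u) \<Omega> \<phi> q ?\<theta>)" if z: "z \<in> ?L" for z
  proof -
    obtain \<pi> where \<pi>: "\<pi> \<in> admissible c" "W1 (perm_coord \<pi> z) \<noteq> 0"
      using admissible_obtain[of z c] z unfolding orbit_set_def by blast
    note inv = admissible_invol[OF \<pi>(1)]
    define t where "t = Arg (W1 (perm_coord \<pi> z))"
    obtain Sf P where sp: "slice_piece \<kappa> u S (pullback \<pi> \<Omega>) c c0 ?L Sf P"
      using slice_piece_exists[OF \<pi>(1)] by blast
    interpret sp: slice_piece \<kappa> u S "pullback \<pi> \<Omega>" c c0 t ?L Sf P by (rule sp)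
    have "W1 (perm_coord \<pi> z) = exp (Complex (ln (cmod (W1 (perm_coord \<pi> z)))) t)"
      unfolding t_def by (rule exp_Complex_Arg[OF \<pi>(2)])
    then have "perm_coord \<pi> z \<in> slit t" by (rule slit_exp(1)) simp
    then have im: "perm_coord \<pi> z \<in> sp.\<phi> ` sp.U"
      unfolding sp.\<phi>_image using z orbit_set_perm_coord[OF \<pi>(1)] by simp
    have lp: "local_parametrization ?L (\<lambda>q. perm_coord \<pi> (sp.\<phi> q)) sp.U"
      by (rule local_parametrization_perm_coord[OF inv sp.local_parametrization_\<phi> orbit_set_perm_coord[OF \<pi>(1)]])
    have "lagrangian_angle (stenzel_form u) \<Omega> (\<lambda>q. perm_coord \<pi> (sp.\<phi> q)) q ?\<theta>" if q: "q \<in> sp.U" for q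
    proof -
      have d: "sp.\<phi> differentiable (at q)"
        using smooth_on_has_derivative[OF sp.smooth_\<phi> q] by (auto simp: differentiable_def)
      have r: "r2 (sp.\<phi> q) \<ge> 1" unfolding sp.\<phi>_def by (rule r2_quadric_ge_1[OF slice_point_in_quadric])
      have "lagrangian_angle (stenzel_form u) (pullback \<pi> \<Omega>) sp.\<phi> q ?\<theta>"
        using sp.lagrangian_angle_\<phi>[of q] q sp.U_subset frame_value_admissible[OF \<pi>(1)] by auto
      then show ?thesis
        unfolding lagrangian_angle_def volume_density_perm_coord[OF inv r d] coord_frame_perm_coord[OF inv d] pullback_def .
    qed
    moreover have "z \<in> (\<lambda>q. perm_coord \<pi> (sp.\<phi> q)) ` sp.U"
      using im perm_coord_invol[OF inv, of z] by (metis (mono_tags, lifting) imageE imageI)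
    ultimately show ?thesis using lp by blast
  qed
  have lag: "stenzel_form u (\<psi> r) (frechet_derivative \<psi> (at r) a) (frechet_derivative \<psi> (at r) b) = 0"
    if lp: "local_parametrization ?L \<psi> V" and r: "r \<in> V" for \<psi> V r a b
  proof -
    have "\<psi> r \<in> ?L" using lp r unfolding local_parametrization_def by (auto dest: openin_imp_subset)
    then have z: "\<psi> r \<in> quadric" "in_orbit c (\<psi> r)" by (auto simp: orbit_set_def)
    obtain \<pi> where \<pi>: "\<pi> \<in> admissible c" "W1 (perm_coord \<pi> (\<psi> r)) \<noteq> 0"
      using admissible_obtain[OF z] by blast
    note inv = admissible_invol[OF \<pi>(1)]
    define t where "t = Arg (W1 (perm_coord \<pi> (\<psi> r)))"
    obtain Sf P where sp: "slice_piece \<kappa> u S (pullback \<pi> \<Omega>) c c0 ?L Sf P"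
      using slice_piece_exists[OF \<pi>(1)] by blast
    interpret sp: slice_piece \<kappa> u S "pullback \<pi> \<Omega>" c c0 t ?L Sf P by (rule sp)
    have "W1 (perm_coord \<pi> (\<psi> r)) = exp (Complex (ln (cmod (W1 (perm_coord \<pi> (\<psi> r))))) t)"
      unfolding t_def by (rule exp_Complex_Arg[OF \<pi>(2)])
    then have slit: "perm_coord \<pi> (\<psi> r) \<in> slit t" by (rule slit_exp(1)) simp
    have d: "\<psi> differentiable (at r)"
      using lp r smooth_on_has_derivative[of \<psi> V r] unfolding local_parametrization_def by (auto simp: differentiable_def)
    have "stenzel_form u (perm_coord \<pi> (\<psi> r)) (frechet_derivative (\<lambda>q. perm_coord \<pi> (\<psi> q)) (at r) a)
        (frechet_derivative (\<lambda>q. perm_coord \<pi> (\<psi> q)) (at r) b) = 0"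
      by (rule sp.stenzel_form_zero[OF local_parametrization_perm_coord[OF inv lp orbit_set_perm_coord[OF \<pi>(1)]] r slit])
    then show ?thesis
      unfolding frechet_derivative_perm_coord[OF inv d] stenzel_form_perm_coord[OF inv r2_quadric_ge_1[OF z(1)]] .
  qed
  have "submanifold5 ?L" unfolding submanifold5_def using quad param by blast
  then have "lagrangian (stenzel_form u) ?L" unfolding lagrangian_def using lag by blast
  then show ?thesis unfolding special_lagrangian_def using param by blast
qed

end

section \<open>The Lagrangians in the cotangent bundle\<close>

lemma Phi_nth: "Phi (x, \<xi>) $ i =
  complex_of_real (cosh (norm \<xi>) * x $ i) + \<i> * complex_of_real (sinh (norm \<xi>) / norm \<xi> * \<xi> $ i)"
  by (simp add: Phi_def)

lemma Phi_in_quadric: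
  assumes "(x, \<xi>) \<in> cotangent_sphere"
  shows "Phi (x, \<xi>) \<in> quadric"
proof -
  let ?a = "cosh (norm \<xi>)" and ?b = "sinh (norm \<xi>) / norm \<xi>"
  have x: "x \<bullet> x = 1" "x \<bullet> \<xi> = 0" using assms by (auto simp: cotangent_sphere_def dot_square_norm)
  have b: "?b\<^sup>2 * (\<xi> \<bullet> \<xi>) = (sinh (norm \<xi>))\<^sup>2"
    by (cases "\<xi> = 0") (simp_all add: dot_square_norm power_divide)
  have "(\<Sum>i\<in>UNIV. (Phi (x, \<xi>) $ i)\<^sup>2) = of_real (?a\<^sup>2 * (x \<bullet> x) - ?b\<^sup>2 * (\<xi> \<bullet> \<xi>)) + 2 * \<i> * of_real (?a * ?b * (x \<bullet> \<xi>))"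
    unfolding Phi_nth inner_vec_def
    by (simp add: complex_eq_iff power2_eq_square sum_distrib_left sum_subtractf sum_divide_distrib algebra_simps)
  also have "\<dots> = 1" unfolding b x by (simp add: sinh_square_eq)
  finally show ?thesis by (simp add: quadric_def)
qed

text \<open>The factor \<open>arsinh (norm b) / norm b\<close> below is \<open>0\<close> for \<open>b = 0\<close>, which is harmless.\<close>

lemma Phi_surj:
  assumes y: "y \<in> quadric"
  defines "a \<equiv> (\<chi> i. Re (y $ i))" and "b \<equiv> (\<chi> i. Im (y $ i))"
  defines "x \<equiv> (1 / norm a) *\<^sub>R a" and "\<xi> \<equiv> (arsinh (norm b) / norm b) *\<^sub>R b"
  shows "(x, \<xi>) \<in> cotangent_sphere" "Phi (x, \<xi>) = y"
proof -
  have "(\<Sum>i\<in>UNIV. (y $ i)\<^sup>2) = of_real (a \<bullet> a - b \<bullet> b) + 2 * \<i> * of_real (a \<bullet> b)"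
    unfolding inner_vec_def a_def b_def
    by (simp add: complex_eq_iff power2_eq_square sum_distrib_left sum_subtractf algebra_simps)
  with y have "of_real (a \<bullet> a - b \<bullet> b) + 2 * \<i> * of_real (a \<bullet> b) = (1::complex)" by (simp add: quadric_def)
  then have ab: "a \<bullet> a - b \<bullet> b = 1" "a \<bullet> b = 0" by (simp_all add: complex_eq_iff)
  then have na: "(norm a)\<^sup>2 = 1 + (norm b)\<^sup>2" by (simp add: dot_square_norm)
  have "a \<noteq> 0"
  proof
    assume "a = 0"
    with na have "1 + (norm b)\<^sup>2 = 0" by simp
    then show False using zero_le_power2[of "norm b"] by linarith
  qed
  then show "(x, \<xi>) \<in> cotangent_sphere" by (simp add: cotangent_sphere_def x_def \<xi>_def ab(2))
  have "arsinh (norm b) \<ge> 0" using arsinh_real_def[of "norm b"] by (simp add: ln_ge_zero add_increasing)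
  then have n\<xi>: "norm \<xi> = arsinh (norm b)"
    by (cases "b = 0") (simp_all add: \<xi>_def)
  have ch: "cosh (norm \<xi>) = norm a"
  proof -
    have "(cosh (norm \<xi>))\<^sup>2 = (norm a)\<^sup>2" unfolding n\<xi> na using sinh_square_eq[of "arsinh (norm b)"] by simp
    then show ?thesis by (rule power2_eq_imp_eq) simp_all
  qed
  have "sinh (norm \<xi>) / norm \<xi> * \<xi> $ i = b $ i" for i
    unfolding n\<xi> by (cases "b = 0") (simp_all add: \<xi>_def)
  moreover have "cosh (norm \<xi>) * x $ i = a $ i" for i
    unfolding ch using \<open>a \<noteq> 0\<close> by (simp add: x_def)
  ultimately show "Phi (x, \<xi>) = y"
    by (simp add: cart_eq_iff Phi_nth a_def b_def complex_eq_iff)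
qed

section \<open>The group and the moment map in null coordinates\<close>

lemma eta_mult: "((\<chi> i j. complex_of_real (eta $ i $ j)) *v z) $ 1 = - z $ 2"
  "((\<chi> i j. complex_of_real (eta $ i $ j)) *v z) $ 2 = z $ 1"
  "((\<chi> i j. complex_of_real (eta $ i $ j)) *v z) $ 3 = - z $ 4"
  "((\<chi> i j. complex_of_real (eta $ i $ j)) *v z) $ 4 = z $ 3"
  "((\<chi> i j. complex_of_real (eta $ i $ j)) *v z) $ 5 = - z $ 6"
  "((\<chi> i j. complex_of_real (eta $ i $ j)) *v z) $ 6 = z $ 5"
  by (simp_all add: matrix_vector_mult_def sum_6 eta_def xi_def elem_mat_def)

text \<open>\<open>eta\<close> multiplies each W by \<open>\<i>\<close> and each V by
  \<open>- \<i>\<close>, so pairing with \<open>\<i> *s z\<close> leaves a difference of squared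
  moduli.\<close>

lemma inner_eta: "(\<i> *s z) \<bullet> ((\<chi> i j. complex_of_real (eta $ i $ j)) *v z) = null_diff z"
  by (simp add: inner_vec_def sum_6 eta_mult inner_complex_def null_diff_def cmod_power2 WV_defs)
    (simp add: power2_eq_square field_simps)

lemma moment_map_scaleR: "moment_map u z (r *\<^sub>R X) = r * moment_map u z X"
proof -
  have "(\<chi> i j. complex_of_real ((r *\<^sub>R X) $ i $ j)) *v z = r *\<^sub>R ((\<chi> i j. complex_of_real (X $ i $ j)) *v z)"
    by (simp add: cart_eq_iff matrix_vector_mult_def scaleR_sum_right)
      (simp add: scaleR_conv_of_real mult.assoc)
  then show ?thesis by (simp add: moment_map_def)
qed

text \<open>Both sides of the level condition are linear on the line \<open>lie_H\<close>, so it is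
  one real equation at \<open>eta\<close>.\<close>

lemma moment_level_iff:
  assumes "linear c"
  shows "p \<in> moment_level u c \<longleftrightarrow> p \<in> cotangent_sphere \<and> deriv u (r2 (Phi p)) * null_diff (Phi p) = c eta"
proof -
  have "(\<forall>X\<in>lie_H. moment_map u (Phi p) X = c X) \<longleftrightarrow> moment_map u (Phi p) eta = c eta"
    unfolding lie_H_def span_singleton
    by (auto simp: moment_map_scaleR linear_cmul[OF assms] intro: bexI[of _ "1 *\<^sub>R eta"])
  then show ?thesis by (simp add: moment_level_def moment_map_def inner_eta)
qed

lemma rotation_matrix_entries:
  fixes h :: "real^2^2"
  assumes "orthogonal_matrix h" "Determinants.det h = 1"
  shows "h $ 2 $ 2 = h $ 1 $ 1" "h $ 1 $ 2 = - h $ 2 $ 1" "(h $ 1 $ 1)\<^sup>2 + (h $ 2 $ 1)\<^sup>2 = 1"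
proof -
  let ?a = "h $ 1 $ 1" and ?b = "h $ 1 $ 2" and ?c = "h $ 2 $ 1" and ?d = "h $ 2 $ 2"
  have "transpose h ** h = Finite_Cartesian_Product.mat 1" using assms(1) by (simp add: orthogonal_matrix_def)
  then have "(transpose h ** h) $ i $ j = (Finite_Cartesian_Product.mat 1 :: real^2^2) $ i $ j" for i j by simp
  from this[of 1 1] this[of 2 2] this[of 1 2]
  have o: "?a * ?a + ?c * ?c = 1" "?b * ?b + ?d * ?d = 1" "?a * ?b + ?c * ?d = 0"
    by (simp_all add: matrix_matrix_mult_def Finite_Cartesian_Product.transpose_def Finite_Cartesian_Product.mat_def sum_2)
  have dt: "?a * ?d - ?b * ?c = 1" using assms(2) by (simp add: det_2)
  \<comment> \<open>The columns contribute 2 and the determinant removes 2, so this measure of the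
    deviation from the rotation pattern vanishes.\<close>
  have "(?d - ?a)\<^sup>2 + (?b + ?c)\<^sup>2 = (?a * ?a + ?c * ?c) + (?b * ?b + ?d * ?d) - 2 * (?a * ?d - ?b * ?c)"
    by (simp add: power2_eq_square algebra_simps)
  then have "(?d - ?a)\<^sup>2 + (?b + ?c)\<^sup>2 = 0" using o dt by simp
  then show "?d = ?a" "?b = - ?c" by (simp_all add: sum_power2_eq_zero_iff)
  show "?a\<^sup>2 + ?c\<^sup>2 = 1" using o(1) by (simp add: power2_eq_square)
qed

lemma diag3_entries: "diag3 h $ i $ j = (\<Sum>(p, q)\<in>{(1, 2), (3, 4), (5, 6)}.
     h $ 1 $ 1 * (if i = p \<and> j = p then 1 else 0) + h $ 1 $ 2 * (if i = p \<and> j = q then 1 else 0) +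
     h $ 2 $ 1 * (if i = q \<and> j = p then 1 else 0) + h $ 2 $ 2 * (if i = q \<and> j = q then 1 else 0))"
  by (simp add: diag3_def elem_mat_def)

lemma diag3_mult:
  "(diag3 h *v x) $ 1 = h $ 1 $ 1 * x $ 1 + h $ 1 $ 2 * x $ 2"
  "(diag3 h *v x) $ 2 = h $ 2 $ 1 * x $ 1 + h $ 2 $ 2 * x $ 2"
  "(diag3 h *v x) $ 3 = h $ 1 $ 1 * x $ 3 + h $ 1 $ 2 * x $ 4"
  "(diag3 h *v x) $ 4 = h $ 2 $ 1 * x $ 3 + h $ 2 $ 2 * x $ 4"
  "(diag3 h *v x) $ 5 = h $ 1 $ 1 * x $ 5 + h $ 1 $ 2 * x $ 6"
  "(diag3 h *v x) $ 6 = h $ 2 $ 1 * x $ 5 + h $ 2 $ 2 * x $ 6"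
  by (simp_all add: matrix_vector_mult_def sum_6 diag3_entries)

text \<open>The hyperbolic factors in \<open>Phi\<close> depend only on \<open>norm \<xi>\<close>,
  which rotations preserve. Equivariance is then the complex notation for plane rotations, applied
  to each pair.\<close>

lemma Phi_act:
  assumes h: "orthogonal_matrix h" "Determinants.det h = 1"
  shows "W1 (Phi (act (diag3 h) p)) = Complex (h $ 1 $ 1) (h $ 2 $ 1) * W1 (Phi p)"
    "W2 (Phi (act (diag3 h) p)) = Complex (h $ 1 $ 1) (h $ 2 $ 1) * W2 (Phi p)"
    "W3 (Phi (act (diag3 h) p)) = Complex (h $ 1 $ 1) (h $ 2 $ 1) * W3 (Phi p)"
    "V1 (Phi (act (diag3 h) p)) = Complex (h $ 1 $ 1) (- h $ 2 $ 1) * V1 (Phi p)"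
    "V2 (Phi (act (diag3 h) p)) = Complex (h $ 1 $ 1) (- h $ 2 $ 1) * V2 (Phi p)"
    "V3 (Phi (act (diag3 h) p)) = Complex (h $ 1 $ 1) (- h $ 2 $ 1) * V3 (Phi p)"
    "cmod (Complex (h $ 1 $ 1) (h $ 2 $ 1)) = 1"
proof -
  note e = rotation_matrix_entries[OF h]
  obtain x \<xi> where p: "p = (x, \<xi>)" by fastforce
  have "(diag3 h *v \<xi>) \<bullet> (diag3 h *v \<xi>) = ((h $ 1 $ 1)\<^sup>2 + (h $ 2 $ 1)\<^sup>2) * (\<xi> \<bullet> \<xi>)"
    by (simp add: inner_vec_def sum_6 diag3_mult e(1,2) power2_eq_square algebra_simps)
  then have n: "norm (diag3 h *v \<xi>) = norm \<xi>" using e(3) by (simp add: norm_eq)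
  define s where "s = sinh (norm \<xi>) / norm \<xi>"
  have Phi: "Phi (act (diag3 h) p) $ i =
      complex_of_real (cosh (norm \<xi>) * (diag3 h *v x) $ i) + \<i> * complex_of_real (s * (diag3 h *v \<xi>) $ i)"
    "Phi p $ i = complex_of_real (cosh (norm \<xi>) * x $ i) + \<i> * complex_of_real (s * \<xi> $ i)" for i
    by (simp_all add: p act_def Phi_nth n s_def)
  show "W1 (Phi (act (diag3 h) p)) = Complex (h $ 1 $ 1) (h $ 2 $ 1) * W1 (Phi p)"
    "W2 (Phi (act (diag3 h) p)) = Complex (h $ 1 $ 1) (h $ 2 $ 1) * W2 (Phi p)"
    "W3 (Phi (act (diag3 h) p)) = Complex (h $ 1 $ 1) (h $ 2 $ 1) * W3 (Phi p)"
    "V1 (Phi (act (diag3 h) p)) = Complex (h $ 1 $ 1) (- h $ 2 $ 1) * V1 (Phi p)"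
    "V2 (Phi (act (diag3 h) p)) = Complex (h $ 1 $ 1) (- h $ 2 $ 1) * V2 (Phi p)"
    "V3 (Phi (act (diag3 h) p)) = Complex (h $ 1 $ 1) (- h $ 2 $ 1) * V3 (Phi p)"
    by (simp_all add: WV_defs Phi diag3_mult e(1,2) complex_eq_iff algebra_simps)
  show "cmod (Complex (h $ 1 $ 1) (h $ 2 $ 1)) = 1" using e(3) by (simp add: cmod_def)
qed

lemma rotation_exists:
  assumes "cmod \<zeta> = 1"
  obtains h :: "real^2^2" where "orthogonal_matrix h" "Determinants.det h = 1" "Complex (h $ 1 $ 1) (h $ 2 $ 1) = \<zeta>"
    "Complex (h $ 1 $ 1) (- h $ 2 $ 1) = cnj \<zeta>"
proof -
  define h :: "real^2^2" where "h = (\<chi> i j. if i = 1 then if j = 1 then Re \<zeta> else - Im \<zeta>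
    else if j = 1 then Im \<zeta> else Re \<zeta>)"
  have e: "h $ 1 $ 1 = Re \<zeta>" "h $ 1 $ 2 = - Im \<zeta>" "h $ 2 $ 1 = Im \<zeta>" "h $ 2 $ 2 = Re \<zeta>" by (simp_all add: h_def)
  have n: "Re \<zeta> * Re \<zeta> + Im \<zeta> * Im \<zeta> = 1" using assms cmod_power2[of \<zeta>] by (simp add: power2_eq_square)
  have "transpose h ** h = Finite_Cartesian_Product.mat 1"
    using n by (simp add: cart_eq_iff forall_2 matrix_matrix_mult_def
        Finite_Cartesian_Product.transpose_def Finite_Cartesian_Product.mat_def sum_2 e algebra_simps)
  then have "orthogonal_matrix h" by (simp add: orthogonal_matrix)
  moreover have "Determinants.det h = 1" using n by (simp add: det_2 e)
  ultimately show ?thesis by (rule that) (simp_all add: e complex_eq_iff)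
qed

section \<open>The two Lagrangians as vanishing conditions on coordinates\<close>

lemma vector_6: "(vector [a, b, c, d, e, f] :: real^6) $ 1 = a" "(vector [a, b, c, d, e, f] :: real^6) $ 2 = b"
  "(vector [a, b, c, d, e, f] :: real^6) $ 3 = c" "(vector [a, b, c, d, e, f] :: real^6) $ 4 = d"
  "(vector [a, b, c, d, e, f] :: real^6) $ 5 = e" "(vector [a, b, c, d, e, f] :: real^6) $ 6 = f"
  unfolding vector_def by simp_all

lemma norm_eq_1_iff_6: "norm x = 1 \<longleftrightarrow>
    (x $ 1)\<^sup>2 + (x $ 2)\<^sup>2 + (x $ 3)\<^sup>2 + (x $ 4)\<^sup>2 + (x $ 5)\<^sup>2 + (x $ 6)\<^sup>2 = 1" for x :: "real^6"
  by (simp add: norm_eq_1 inner_vec_def sum_6 power2_eq_square)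

definition L_set :: "bool \<Rightarrow> ((real^6) \<times> (real^6)) set" where
  "L_set c = (if c then L1 else L2)"

lemma L_set_iff: "(x, \<xi>) \<in> L_set c \<longleftrightarrow> norm x = 1 \<and> x $ 2 = 0 \<and> x $ 4 = 0 \<and> x $ 6 = 0 \<and> \<xi> $ 1 = 0 \<and> \<xi> $ 3 = 0 \<and>
    (if c then \<xi> $ 5 = 0 else x $ 5 = 0)"
proof (cases c)
  case True
  have "(x, \<xi>) \<in> L1 \<longleftrightarrow> norm x = 1 \<and> x $ 2 = 0 \<and> x $ 4 = 0 \<and> x $ 6 = 0 \<and> \<xi> $ 1 = 0 \<and> \<xi> $ 3 = 0 \<and> \<xi> $ 5 = 0"
    (is "?l \<longleftrightarrow> ?r")
  proof
    assume ?l
    then show ?r by (auto simp: L1_def norm_eq_1_iff_6 vector_6)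
  next
    assume r: ?r
    then have "x = vector [x $ 1, 0, x $ 3, 0, x $ 5, 0]" "\<xi> = vector [0, \<xi> $ 2, 0, \<xi> $ 4, 0, \<xi> $ 6]"
      by (simp_all add: cart_eq_iff forall_6 vector_6)
    moreover have "(x $ 1)\<^sup>2 + (x $ 3)\<^sup>2 + (x $ 5)\<^sup>2 = 1" using r unfolding norm_eq_1_iff_6 by (elim conjE) simp
    ultimately show ?l unfolding L1_def by blast
  qed
  then show ?thesis using True by (simp add: L_set_def)
next
  case False
  have "(x, \<xi>) \<in> L2 \<longleftrightarrow> norm x = 1 \<and> x $ 2 = 0 \<and> x $ 4 = 0 \<and> x $ 6 = 0 \<and> \<xi> $ 1 = 0 \<and> \<xi> $ 3 = 0 \<and> x $ 5 = 0"
    (is "?l \<longleftrightarrow> ?r")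
  proof
    assume ?l
    then show ?r by (auto simp: L2_def norm_eq_1_iff_6 vector_6)
  next
    assume r: ?r
    then have "x = vector [x $ 1, 0, x $ 3, 0, 0, 0]" "\<xi> = vector [0, \<xi> $ 2, 0, \<xi> $ 4, \<xi> $ 5, \<xi> $ 6]"
      by (simp_all add: cart_eq_iff forall_6 vector_6)
    moreover have "(x $ 1)\<^sup>2 + (x $ 3)\<^sup>2 = 1" using r unfolding norm_eq_1_iff_6 by (elim conjE) simp
    ultimately show ?l unfolding L2_def by blast
  qed
  then show ?thesis using False by (simp add: L_set_def)
qed

lemma null_diff_unit_mult:
  assumes "cmod \<zeta> = 1"
    and "W1 z' = \<zeta> * W1 z" "W2 z' = \<zeta> * W2 z" "W3 z' = \<zeta> * W3 z"
    "V1 z' = cnj \<zeta> * V1 z" "V2 z' = cnj \<zeta> * V2 z" "V3 z' = cnj \<zeta> * V3 z"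
  shows "r2 z' = r2 z" "null_diff z' = null_diff z" "z' \<in> quadric \<longleftrightarrow> z \<in> quadric"
proof -
  have m: "\<zeta> * a * (cnj \<zeta> * b) = a * b" for a b
    using cmod_1_mult_cnj[OF assms(1)] by (metis mult.left_commute mult.assoc mult_1)
  show "z' \<in> quadric \<longleftrightarrow> z \<in> quadric" by (simp only: quadric_iff_WV assms(2-) m)
qed (simp_all add: r2_WV null_diff_def assms norm_mult)

text \<open>Points of the Lagrangians have real odd and imaginary even entries under
  \<open>Phi\<close>, which makes W and V real. In the second case the fifth entry is imaginary as
  well, which gives \<open>V3 = - cnj W3\<close>. The group only multiplies by a unit and its
  conjugate, leaving \<open>r2\<close> and \<open>null_diff\<close> alone.\<close>

lemma Phi_image_orbit:
  assumes lin: "linear c"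
  shows "Phi ` orbit_H (L_set d \<inter> moment_level u c) =
    {z \<in> quadric. in_orbit d z \<and> deriv u (r2 z) * null_diff z = c eta}"
proof (intro equalityI subsetI)
  fix z assume "z \<in> Phi ` orbit_H (L_set d \<inter> moment_level u c)"
  then obtain h x \<xi> where h: "orthogonal_matrix h" "Determinants.det h = 1" and z: "z = Phi (act (diag3 h) (x, \<xi>))"
    and L: "(x, \<xi>) \<in> L_set d" and m: "(x, \<xi>) \<in> moment_level u c"
    unfolding orbit_H_def group_H_def by auto
  define \<zeta> where "\<zeta> = Complex (h $ 1 $ 1) (h $ 2 $ 1)"
  have cnj: "cnj \<zeta> = Complex (h $ 1 $ 1) (- h $ 2 $ 1)" by (simp add: \<zeta>_def complex_eq_iff)
  note a = Phi_act(1-6)[OF h, of "(x, \<xi>)", folded z \<zeta>_def cnj] Phi_act(7)[OF h, folded \<zeta>_def]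
  note q = null_diff_unit_mult[OF a(7) a(1-6)]
  have m': "(x, \<xi>) \<in> cotangent_sphere" "deriv u (r2 (Phi (x, \<xi>))) * null_diff (Phi (x, \<xi>)) = c eta"
    using m by (simp_all add: moment_level_iff[OF lin])
  have "z \<in> quadric" using Phi_in_quadric[OF m'(1)] q(3) by simp
  moreover have "deriv u (r2 z) * null_diff z = c eta" using m'(2) q by simp
  moreover have "in_orbit d z"
  proof -
    have u: "\<zeta> * w * cnj \<zeta> = w" "cnj \<zeta> * w * \<zeta> = w" for w
      using cmod_1_mult_cnj[OF a(7)] by (simp_all add: mult.commute mult.left_commute)
    have "Im (W1 (Phi (x, \<xi>))) = 0" "Im (W2 (Phi (x, \<xi>))) = 0" "Im (V1 (Phi (x, \<xi>))) = 0" "Im (V2 (Phi (x, \<xi>))) = 0"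
      "if d then Im (W3 (Phi (x, \<xi>))) = 0 \<and> Im (V3 (Phi (x, \<xi>))) = 0 else V3 (Phi (x, \<xi>)) = - cnj (W3 (Phi (x, \<xi>)))"
      using L unfolding L_set_iff WV_defs Phi_nth by (auto simp: complex_eq_iff split: if_splits)
    \<comment> \<open>The rotation that led to \<open>z\<close> is undone by
      \<open>cnj \<zeta>\<close>.\<close>
    then show ?thesis
      unfolding in_orbit_def a(1-6)
      by (intro exI[of _ "cnj \<zeta>"]) (simp only: complex_cnj_cnj u complex_mod_cnj a(7) complex_cnj_mult simp_thms, auto)
  qed
  ultimately show "z \<in> {z \<in> quadric. in_orbit d z \<and> deriv u (r2 z) * null_diff z = c eta}" by blast
next
  fix z assume "z \<in> {z \<in> quadric. in_orbit d z \<and> deriv u (r2 z) * null_diff z = c eta}"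
  then have z: "z \<in> quadric" "deriv u (r2 z) * null_diff z = c eta" and "in_orbit d z" by auto
  then obtain \<zeta> where \<zeta>: "cmod \<zeta> = 1" and w: "Im (W1 z * \<zeta>) = 0" "Im (W2 z * \<zeta>) = 0"
     "Im (V1 z * cnj \<zeta>) = 0" "Im (V2 z * cnj \<zeta>) = 0"
     "if d then Im (W3 z * \<zeta>) = 0 \<and> Im (V3 z * cnj \<zeta>) = 0 else V3 z = - cnj (W3 z)"
    unfolding in_orbit_def by blast
  \<comment> \<open>The representative of the orbit on the Lagrangian itself; rotating it by
    \<open>cnj \<zeta>\<close> gives \<open>z\<close> back.\<close>
  define y where "y = of_null (\<zeta> * W1 z) (\<zeta> * W2 z) (\<zeta> * W3 z) (cnj \<zeta> * V1 z) (cnj \<zeta> * V2 z) (cnj \<zeta> * V3 z)"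
  have y: "W1 y = \<zeta> * W1 z" "W2 y = \<zeta> * W2 z" "W3 y = \<zeta> * W3 z"
    "V1 y = cnj \<zeta> * V1 z" "V2 y = cnj \<zeta> * V2 z" "V3 y = cnj \<zeta> * V3 z" by (simp_all add: y_def)
  note q = null_diff_unit_mult[OF \<zeta> y]
  define a b where "a = (\<chi> i. Re (y $ i))" and "b = (\<chi> i. Im (y $ i))"
  define x \<xi> where "x = (1 / norm a) *\<^sub>R a" and "\<xi> = (arsinh (norm b) / norm b) *\<^sub>R b"
  have "y \<in> quadric" using z q by simp
  note P = Phi_surj[OF this, folded a_def b_def, folded x_def \<xi>_def]
  have coords: "y $ 1 = (W1 y + V1 y) / 2" "y $ 2 = \<i> * (V1 y - W1 y) / 2" "y $ 3 = (W2 y + V2 y) / 2"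
    "y $ 4 = \<i> * (V2 y - W2 y) / 2" "y $ 5 = (W3 y + V3 y) / 2" "y $ 6 = \<i> * (V3 y - W3 y) / 2"
    by (simp_all add: WV_defs field_simps)
  have im: "Im (W1 y) = 0" "Im (W2 y) = 0" "Im (V1 y) = 0" "Im (V2 y) = 0"
    using w(1-4) unfolding y by (simp_all only: mult.commute)
  have im3: "if d then Im (W3 y) = 0 \<and> Im (V3 y) = 0 else V3 y = - cnj (W3 y)"
    using w(5) unfolding y by (simp add: mult.commute del: times_complex.sel split: if_splits)
  have "a $ 2 = 0 \<and> a $ 4 = 0 \<and> a $ 6 = 0 \<and> b $ 1 = 0 \<and> b $ 3 = 0 \<and> (if d then b $ 5 = 0 else a $ 5 = 0)"
    using im im3 unfolding a_def b_def vec_lambda_beta coords by (simp add: complex_eq_iff split: if_splits)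
  moreover have "norm x = 1" using P(1) by (simp add: cotangent_sphere_def)
  ultimately have "(x, \<xi>) \<in> L_set d" by (auto simp: L_set_iff x_def \<xi>_def)
  moreover have "(x, \<xi>) \<in> moment_level u c" using P z(2) q by (simp add: moment_level_iff[OF lin])
  moreover obtain h :: "real^2^2" where h: "orthogonal_matrix h" "Determinants.det h = 1"
    "Complex (h $ 1 $ 1) (h $ 2 $ 1) = cnj \<zeta>" "Complex (h $ 1 $ 1) (- h $ 2 $ 1) = cnj (cnj \<zeta>)"
    using rotation_exists[of "cnj \<zeta>"] \<zeta> by auto
  moreover have "Phi (act (diag3 h) (x, \<xi>)) = z"
  proof (rule WV_eqI)
    have u: "cnj \<zeta> * (\<zeta> * w) = w" "\<zeta> * (cnj \<zeta> * w) = w" for w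
      using cmod_1_mult_cnj[OF \<zeta>] by (metis mult.assoc mult.commute mult_1)+
  qed (simp_all only: Phi_act[OF h(1,2)] h(3,4) P(2) y complex_cnj_cnj, simp_all add: cmod_1_mult_cnj[OF \<zeta>] mult.assoc[symmetric] mult.commute[of "cnj \<zeta>" \<zeta>])
  ultimately show "z \<in> Phi ` orbit_H (L_set d \<inter> moment_level u c)"
    unfolding orbit_H_def group_H_def by (intro image_eqI[of z Phi "act (diag3 h) (x, \<xi>)"]) auto
qed

theorem proposition5p1:
  fixes u :: "real \<Rightarrow> real" and \<kappa> :: real and \<Omega> :: "complex^6 \<Rightarrow> (complex^6) form"
  assumes "\<kappa> > 0" and "stenzel_potential \<kappa> u" and "stenzel_volume_form u \<Omega>"
  shows "(\<forall>c. linear c \<and> L1 \<inter> moment_level u c \<noteq> {} \<longrightarrow>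
            special_lagrangian (stenzel_form u) \<Omega> (Phi ` orbit_H (L1 \<inter> moment_level u c))) \<and>
         (\<forall>c. linear c \<and> L2 \<inter> moment_level u c \<noteq> {} \<longrightarrow>
            special_lagrangian (stenzel_form u) \<Omega> (Phi ` orbit_H (L2 \<inter> moment_level u c)))"
proof -
  obtain S where S: "open S" "{1..} \<subseteq> S" "smooth_on u S"
    using assms(2) unfolding stenzel_potential_def by blast
  interpret stenzel_volume \<kappa> u S \<Omega>
    by unfold_locales (use assms S in \<open>auto simp: stenzel_potential_def\<close>)
  have "special_lagrangian (stenzel_form u) \<Omega> (Phi ` orbit_H (L_set d \<inter> moment_level u c))" if "linear c" for c d
    using special_lagrangian_orbit_set[of d "c eta"]
    unfolding Phi_image_orbit[OF that] orbit_set_def moment_def .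
  from this[where d = True] this[where d = False] show ?thesis by (simp add: L_set_def)
qed

end
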